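(* Let $G=(\mathcal V,\mathcal E)$ be a connected locally finite unweighted $d$-regular graph ($d\ge2$), with adjacency operator $A_G$ on $\ell^2(\mathcal V)$, and let $Q_G:=dI+A_G$ be its signless Laplacian. Then $$\|\widetilde\Delta_1\|=\|\Delta_0\|=d-\inf\operatorname{spec}(A_G)\le2d,$$ and the following are equivalent: (i) $\|\widetilde\Delta_1\|=2d$; (ii) $2d\in\operatorname{spec}(\Delta_0)$; (iii) $\inf\operatorname{spec}(Q_G)=0$, i.e. $\displaystyle\inf_{\|u\|_{\ell^2}=1}\sum_{\{x,y\}\in\mathcal E}|u(x)+u(y)|^2=0$. Each of these implies $\sup\operatorname{spec}(A_G)=d$, hence the amenability of $G$. Conversely, they all hold as soon as $G$ is bipartite and amenable; in particular they hold for every finite bipartite $d$-regular graph and for every bipartite periodic lattice, such as $\mathbb Z^2$, $\mathbb Z^3$, $\mathbb Z^4$, BCC and diamond. For $G$ finite (and connected), (i)–(iii) hold if and only if $G$ is bipartite.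
   Context: Graphs are simple, undirected, with countable vertex set. "Unweighted" means all vertex and edge weights are $1$. $(A_Gu)(x)=\sum_{y\sim x}u(y)$ on $\ell^2(\mathcal V)$, and $\Delta_0=dI-A_G$. A $1$-cochain is a function $f$ on oriented edges with $f([y,x])=-f([x,y])$, with norm $\|f\|^2=\sum_{\{x,y\}\in\mathcal E}|f([x,y])|^2$. With $(d^1u)([x,y])=u(y)-u(x)$ and $(\delta^1f)(x)=\sum_{y\sim x}f([y,x])$, the edge Laplacian is $\Delta_1=d^1\delta^1$ (the graph is viewed as a $1$-dimensional complex, so there is no up-term), a bounded operator on $\ell^2$ $1$-cochains; in the unweighted case $\widetilde\Delta_1=\Delta_1$. Amenable: there is a sequence of finite (nonempty) vertex sets $\Omega_R$ with $|\partial\Omega_R|/|\Omega_R|\to0$, where $\partial\Omega_R=\{x\in\Omega_R: x\sim y\text{ for some }y\notin\Omega_R\}$. A periodic lattice here is a graph invariant under a group $\Gamma\simeq\mathbb Z^r$ acting freely on the vertices with finitely many vertex and edge orbits (connected and $d$-regular in this statement). $\mathbb Z^r$ carries its nearest-neighbor graph structure. BCC: vertex set $\mathbb Z^3\cup(\mathbb Z^3+(\tfrac12,\tfrac12,\tfrac12))$, adjacency at distance $\sqrt3/2$. Diamond: vertices $A(x),B(x)$, $x\in\mathbb Z^3$, with $A(x)$ adjacent exactly to $B(x)$ and $B(x-e_j)$, $j=1,2,3$. *)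

theory Defs
  imports
    "HOL-Analysis.Analysis"
    "HOL-Algebra.Group_Action"
    "HOL-Algebra.Product_Groups"
begin

section \<open>Graphs\<close>

text \<open>
  A graph is a vertex set \<open>V\<close> together with its adjacency relation \<open>E\<close>. Thus \<open>E\<close> is at the same
  time the set of oriented edges; the unoriented edges are the two-element sets in \<open>edges E\<close>.
\<close>

definition simple_graph :: "'v set \<Rightarrow> ('v \<times> 'v) set \<Rightarrow> bool" where
  "simple_graph V E \<longleftrightarrow> countable V \<and> E \<subseteq> V \<times> V \<and> sym E \<and> irrefl E"

definition connected_graph :: "'v set \<Rightarrow> ('v \<times> 'v) set \<Rightarrow> bool" where
  "connected_graph V E \<longleftrightarrow> V \<noteq> {} \<and> (\<forall>x\<in>V. \<forall>y\<in>V. (x, y) \<in> E\<^sup>*)"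

definition locally_finite :: "'v set \<Rightarrow> ('v \<times> 'v) set \<Rightarrow> bool" where
  "locally_finite V E \<longleftrightarrow> (\<forall>x\<in>V. finite (E `` {x}))"

definition regular_graph :: "'v set \<Rightarrow> ('v \<times> 'v) set \<Rightarrow> nat \<Rightarrow> bool" where
  "regular_graph V E d \<longleftrightarrow> (\<forall>x\<in>V. card (E `` {x}) = d)"

definition bipartite :: "'v set \<Rightarrow> ('v \<times> 'v) set \<Rightarrow> bool" where
  "bipartite V E \<longleftrightarrow> (\<exists>X Y. X \<union> Y = V \<and> X \<inter> Y = {} \<and> E \<subseteq> X \<times> Y \<union> Y \<times> X)"

definition inner_boundary :: "('v \<times> 'v) set \<Rightarrow> 'v set \<Rightarrow> 'v set" where
  "inner_boundary E \<Omega> = {x \<in> \<Omega>. \<exists>y. (x, y) \<in> E \<and> y \<notin> \<Omega>}"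

definition amenable :: "'v set \<Rightarrow> ('v \<times> 'v) set \<Rightarrow> bool" where
  "amenable V E \<longleftrightarrow>
     (\<exists>\<Omega> :: nat \<Rightarrow> 'v set.
        (\<forall>R. finite (\<Omega> R) \<and> \<Omega> R \<noteq> {} \<and> \<Omega> R \<subseteq> V) \<and>
        (\<lambda>R. real (card (inner_boundary E (\<Omega> R))) / real (card (\<Omega> R))) \<longlonglongrightarrow> 0)"

definition edges :: "('v \<times> 'v) set \<Rightarrow> 'v set set" where
  "edges E = {{x, y} | x y. (x, y) \<in> E}"

text \<open>
  For a symmetric \<open>h\<close>, \<open>edge_value h {x, y}\<close> is the common value of \<open>h x y\<close> and \<open>h y x\<close>, so that a
  sum of \<open>edge_value h\<close> over \<open>edges E\<close> counts each unoriented edge once.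
\<close>

definition edge_value :: "('v \<Rightarrow> 'v \<Rightarrow> real) \<Rightarrow> 'v set \<Rightarrow> real" where
  "edge_value h e = (THE r. \<exists>x y. e = {x, y} \<and> r = h x y)"


section \<open>Square-summable functions and cochains\<close>

text \<open>
  Functions on \<open>V\<close> are represented by functions on the whole type that vanish outside \<open>V\<close>.
\<close>

definition ell2 :: "'v set \<Rightarrow> ('v \<Rightarrow> complex) set" where
  "ell2 V = {u. (\<forall>x. x \<notin> V \<longrightarrow> u x = 0) \<and> (\<lambda>x. (cmod (u x))\<^sup>2) summable_on V}"

definition ell2_norm :: "'v set \<Rightarrow> ('v \<Rightarrow> complex) \<Rightarrow> real" where
  "ell2_norm V u = sqrt (\<Sum>\<^sub>\<infinity>x\<in>V. (cmod (u x))\<^sup>2)"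

definition cochains :: "('v \<times> 'v) set \<Rightarrow> ('v \<times> 'v \<Rightarrow> complex) set" where
  "cochains E = {f. (\<forall>p. p \<notin> E \<longrightarrow> f p = 0) \<and> (\<forall>x y. (x, y) \<in> E \<longrightarrow> f (y, x) = - f (x, y)) \<and>
                    edge_value (\<lambda>x y. (cmod (f (x, y)))\<^sup>2) summable_on edges E}"

definition cochain_norm :: "('v \<times> 'v) set \<Rightarrow> ('v \<times> 'v \<Rightarrow> complex) \<Rightarrow> real" where
  "cochain_norm E f = sqrt (\<Sum>\<^sub>\<infinity>e\<in>edges E. edge_value (\<lambda>x y. (cmod (f (x, y)))\<^sup>2) e)"


section \<open>Bounded operators and their spectrum\<close>

text \<open>
  \<open>H\<close> is a complex vector space of functions, normed by \<open>N\<close>; an operator on \<open>H\<close> is a map on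
  functions of which only the restriction to \<open>H\<close> matters.
\<close>

definition bounded_operator ::
    "('a \<Rightarrow> complex) set \<Rightarrow> (('a \<Rightarrow> complex) \<Rightarrow> real) \<Rightarrow> (('a \<Rightarrow> complex) \<Rightarrow> ('a \<Rightarrow> complex)) \<Rightarrow> bool"
  where
  "bounded_operator H N T \<longleftrightarrow>
     (\<forall>u\<in>H. T u \<in> H) \<and>
     (\<forall>u\<in>H. \<forall>v\<in>H. T (\<lambda>x. u x + v x) = (\<lambda>x. T u x + T v x)) \<and>
     (\<forall>c. \<forall>u\<in>H. T (\<lambda>x. c * u x) = (\<lambda>x. c * T u x)) \<and>
     (\<exists>C. \<forall>u\<in>H. N (T u) \<le> C * N u)"

definition operator_norm ::
    "('a \<Rightarrow> complex) set \<Rightarrow> (('a \<Rightarrow> complex) \<Rightarrow> real) \<Rightarrow> (('a \<Rightarrow> complex) \<Rightarrow> ('a \<Rightarrow> complex)) \<Rightarrow> real"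
  where
  "operator_norm H N T = Sup {N (T u) | u. u \<in> H \<and> N u \<le> 1}"

definition spectrum ::
    "('a \<Rightarrow> complex) set \<Rightarrow> (('a \<Rightarrow> complex) \<Rightarrow> real) \<Rightarrow> (('a \<Rightarrow> complex) \<Rightarrow> ('a \<Rightarrow> complex)) \<Rightarrow> complex set"
  where
  "spectrum H N T =
     {z. \<not> (\<exists>S. bounded_operator H N S \<and>
                (\<forall>u\<in>H. S (\<lambda>x. T u x - z * u x) = u \<and> (\<lambda>x. T (S u) x - z * S u x) = u))}"

text \<open>
  The infimum and supremum of the spectrum of a self-adjoint operator; as that spectrum is real,
  \<open>Re\<close> is here only the passage from \<open>complex\<close> to \<open>real\<close>.
\<close>

definition inf_spec ::
    "('a \<Rightarrow> complex) set \<Rightarrow> (('a \<Rightarrow> complex) \<Rightarrow> real) \<Rightarrow> (('a \<Rightarrow> complex) \<Rightarrow> ('a \<Rightarrow> complex)) \<Rightarrow> real"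
  where "inf_spec H N T = Inf (Re ` spectrum H N T)"

definition sup_spec ::
    "('a \<Rightarrow> complex) set \<Rightarrow> (('a \<Rightarrow> complex) \<Rightarrow> real) \<Rightarrow> (('a \<Rightarrow> complex) \<Rightarrow> ('a \<Rightarrow> complex)) \<Rightarrow> real"
  where "sup_spec H N T = Sup (Re ` spectrum H N T)"


section \<open>The operators of a regular graph\<close>

definition adjacency_op :: "('v \<times> 'v) set \<Rightarrow> ('v \<Rightarrow> complex) \<Rightarrow> ('v \<Rightarrow> complex)" where
  "adjacency_op E u = (\<lambda>x. \<Sum>y\<in>E `` {x}. u y)"

definition vertex_laplacian :: "('v \<times> 'v) set \<Rightarrow> nat \<Rightarrow> ('v \<Rightarrow> complex) \<Rightarrow> ('v \<Rightarrow> complex)" where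
  "vertex_laplacian E d u = (\<lambda>x. of_nat d * u x - adjacency_op E u x)"

definition signless_laplacian :: "('v \<times> 'v) set \<Rightarrow> nat \<Rightarrow> ('v \<Rightarrow> complex) \<Rightarrow> ('v \<Rightarrow> complex)" where
  "signless_laplacian E d u = (\<lambda>x. of_nat d * u x + adjacency_op E u x)"

definition coboundary :: "('v \<times> 'v) set \<Rightarrow> ('v \<Rightarrow> complex) \<Rightarrow> ('v \<times> 'v \<Rightarrow> complex)" where
  "coboundary E u = (\<lambda>(x, y). if (x, y) \<in> E then u y - u x else 0)"

definition codifferential :: "('v \<times> 'v) set \<Rightarrow> ('v \<times> 'v \<Rightarrow> complex) \<Rightarrow> ('v \<Rightarrow> complex)" where
  "codifferential E f = (\<lambda>x. \<Sum>y\<in>E `` {x}. f (y, x))"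

definition edge_laplacian :: "('v \<times> 'v) set \<Rightarrow> ('v \<times> 'v \<Rightarrow> complex) \<Rightarrow> ('v \<times> 'v \<Rightarrow> complex)" where
  "edge_laplacian E f = coboundary E (codifferential E f)"

definition norm_condition :: "('v \<times> 'v) set \<Rightarrow> nat \<Rightarrow> bool" where
  "norm_condition E d \<longleftrightarrow>
     operator_norm (cochains E) (cochain_norm E) (edge_laplacian E) = 2 * real d"

definition spectral_condition :: "'v set \<Rightarrow> ('v \<times> 'v) set \<Rightarrow> nat \<Rightarrow> bool" where
  "spectral_condition V E d \<longleftrightarrow>
     2 * of_nat d \<in> spectrum (ell2 V) (ell2_norm V) (vertex_laplacian E d)"

definition signless_condition :: "'v set \<Rightarrow> ('v \<times> 'v) set \<Rightarrow> nat \<Rightarrow> bool" where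
  "signless_condition V E d \<longleftrightarrow>
     inf_spec (ell2 V) (ell2_norm V) (signless_laplacian E d) = 0"

definition variational_condition :: "'v set \<Rightarrow> ('v \<times> 'v) set \<Rightarrow> bool" where
  "variational_condition V E \<longleftrightarrow>
     (INF u \<in> {u \<in> ell2 V. ell2_norm V u = 1}.
        \<Sum>\<^sub>\<infinity>e\<in>edges E. edge_value (\<lambda>x y. (cmod (u x + u y))\<^sup>2) e) = 0"

definition all_conditions :: "'v set \<Rightarrow> ('v \<times> 'v) set \<Rightarrow> nat \<Rightarrow> bool" where
  "all_conditions V E d \<longleftrightarrow>
     norm_condition E d \<and> spectral_condition V E d \<and> signless_condition V E d \<and>
     variational_condition V E"


section \<open>Periodic lattices\<close>

text \<open>
  A group isomorphic to the free abelian group of rank \<open>r\<close> is identified with the power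
  \<open>free_abelian r\<close> of the integers, acting through \<open>\<phi>\<close>. The action being free, \<open>\<phi>\<close> is injective.
\<close>

definition free_abelian :: "nat \<Rightarrow> (nat \<Rightarrow> int) monoid" where
  "free_abelian r = product_group {..<r} (\<lambda>_. integer_group)"

definition periodic :: "'v set \<Rightarrow> ('v \<times> 'v) set \<Rightarrow> bool" where
  "periodic V E \<longleftrightarrow>
     (\<exists>r \<phi>. group_action (free_abelian r) V \<phi> \<and>
        (\<forall>g\<in>carrier (free_abelian r). \<forall>x\<in>V. \<phi> g x = x \<longrightarrow> g = \<one>\<^bsub>free_abelian r\<^esub>) \<and>
        (\<forall>g\<in>carrier (free_abelian r). \<forall>x y. (x, y) \<in> E \<longrightarrow> (\<phi> g x, \<phi> g y) \<in> E) \<and>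
        finite (orbits (free_abelian r) V \<phi>) \<and>
        finite (orbits (free_abelian r) (edges E) (\<lambda>g e. \<phi> g ` e)))"

definition periodic_lattice :: "'v set \<Rightarrow> ('v \<times> 'v) set \<Rightarrow> nat \<Rightarrow> bool" where
  "periodic_lattice V E d \<longleftrightarrow>
     simple_graph V E \<and> connected_graph V E \<and> locally_finite V E \<and> regular_graph V E d \<and>
     periodic V E"

definition integer_lattice_edges :: "((int ^ 'n) \<times> (int ^ 'n)) set" where
  "integer_lattice_edges = {(x, y). (\<Sum>i\<in>UNIV. \<bar>x $ i - y $ i\<bar>) = 1}"

definition integer_points :: "(real ^ 3) set" where
  "integer_points = {x. \<forall>i. x $ i \<in> \<int>}"

definition bcc_vertices :: "(real ^ 3) set" where
  "bcc_vertices = integer_points \<union> (\<lambda>x. x + (\<chi> i. 1 / 2)) ` integer_points"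

definition bcc_edges :: "((real ^ 3) \<times> (real ^ 3)) set" where
  "bcc_edges = {(x, y). x \<in> bcc_vertices \<and> y \<in> bcc_vertices \<and> dist x y = sqrt 3 / 2}"

datatype diamond_vertex = DiamondA "int ^ 3" | DiamondB "int ^ 3"

definition diamond_edges :: "(diamond_vertex \<times> diamond_vertex) set" where
  "diamond_edges =
     (let D = {(DiamondA x, DiamondB x) | x. True} \<union>
              {(DiamondA x, DiamondB (x - axis j 1)) | x j. True}
      in D \<union> D\<inverse>)"

end

theory Submission
  imports Defs
begin

text \<open>
  Write \<open>A\<close> for the adjacency operator, \<open>m = inf spec A\<close> and \<open>M = sup spec A\<close>. Everything follows from
  a few facts on quadratic forms.

  The spectral theorem is needed only through the variational principle: for a bounded self-adjoint
  \<open>T\<close>, the bounds of the spectrum are the best bounds of the form \<open>\<langle>Tu, u\<rangle>\<close> on unit vectors, and they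
  belong to the spectrum. Outside these bounds \<open>T - z\<close> is coercive after multiplication by a suitable
  scalar, and coercive operators are invertible by a contraction argument
  (\<open>coercive_not_in_spectrum\<close>); at the bounds the form of \<open>T - z\<close> is semidefinite and degenerate,
  which excludes a bounded inverse (\<open>degenerate_form_in_spectrum\<close>). Both facts are combined in
  \<open>extremal_spectral_value\<close>.

  The forms of \<open>d - A\<close> and \<open>d + A\<close> are the sums of \<open>\<bar>u x - u y\<bar>\<^sup>2\<close> and of \<open>\<bar>u x + u y\<bar>\<^sup>2\<close> over the edges,
  so both are positive and \<open>- d \<le> m \<le> M \<le> d\<close>. Hence \<open>\<parallel>\<Delta>\<^sub>0\<parallel> = sup spec \<Delta>\<^sub>0 = d - m\<close> and
  \<open>inf spec (d + A) = d + m\<close>, and each of the equivalent conditions says \<open>m = - d\<close>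
  (\<open>conditions_iff\<close>). The edge Laplacian has the norm of \<open>\<Delta>\<^sub>0\<close> because \<open>D D'\<close> and \<open>D' D\<close> have the
  same upper bounds when \<open>D'\<close> is the adjoint of \<open>D\<close> (\<open>adjoint_product_bound\<close>).

  Passing from \<open>u\<close> to \<open>\<bar>u\<bar>\<close> gives \<open>- m \<le> M\<close>, so that \<open>m = - d\<close> implies \<open>M = d\<close>. That \<open>M = d\<close> implies
  amenability is a Cheeger inequality (\<open>Cheeger_gap\<close>): an isoperimetric constant \<open>h > 0\<close> forces
  \<open>M \<le> d - h\<^sup>2 / (8 d)\<close>. Conversely, on a bipartite graph the signed indicator functions of Foelner
  sets have small energy (\<open>bipartite_test_function\<close>). On a finite graph a minimizer of the energy
  exists, and \<open>u y = - u x\<close> along every edge exhibits the two classes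
  (\<open>finite_extremal_bipartite\<close>).

  Periodic lattices are amenable because boxes in \<open>\<int>\<^sup>r\<close> have small boundary (\<open>periodic_amenable\<close>). For
  the concrete lattices it remains to exhibit a translation action with finitely many orbits, to
  count neighbours, to connect the vertices and to name the two classes.
\<close>

section \<open>The Hilbert space of square-summable functions\<close>

text \<open>
  The real part of the Hermitian scalar product. It determines the norm and the values
  \<open>\<langle>Tu, u\<rangle>\<close> of self-adjoint operators, which are real.
\<close>

definition ell2_inner :: "'a set \<Rightarrow> ('a \<Rightarrow> complex) \<Rightarrow> ('a \<Rightarrow> complex) \<Rightarrow> real" where
  "ell2_inner V u v = (\<Sum>\<^sub>\<infinity>x\<in>V. u x \<bullet> v x)"

lemma ell2_summable: "u \<in> ell2 V \<Longrightarrow> (\<lambda>x. (cmod (u x))\<^sup>2) summable_on V"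
  by (simp add: ell2_def)

lemma ell2_outside: "u \<in> ell2 V \<Longrightarrow> x \<notin> V \<Longrightarrow> u x = 0"
  by (simp add: ell2_def)

lemma ell2I:
  assumes "\<And>x. x \<notin> V \<Longrightarrow> u x = 0" and "(\<lambda>x. (cmod (u x))\<^sup>2) summable_on V"
  shows "u \<in> ell2 V"
  using assms by (simp add: ell2_def)

lemma inner_summable:
  assumes "u \<in> ell2 V" and "v \<in> ell2 V"
  shows "(\<lambda>x. u x \<bullet> v x) summable_on V"
proof -
  have "(\<lambda>x. (cmod (u x))\<^sup>2 + (cmod (v x))\<^sup>2) summable_on V"
    using assms by (intro summable_on_add ell2_summable)
  then have "(\<lambda>x. norm (u x \<bullet> v x)) summable_on V"
  proof (rule summable_on_comparison_test)
    fix x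
    have "norm (u x \<bullet> v x) \<le> cmod (u x) * cmod (v x)"
      using Cauchy_Schwarz_ineq2[of "u x" "v x"] by simp
    also have "\<dots> \<le> (cmod (u x))\<^sup>2 + (cmod (v x))\<^sup>2"
      using sum_squares_bound[of "cmod (u x)" "cmod (v x)"]
        mult_nonneg_nonneg[OF norm_ge_zero norm_ge_zero, of "u x" "v x"] by linarith
    finally show "norm (u x \<bullet> v x) \<le> (cmod (u x))\<^sup>2 + (cmod (v x))\<^sup>2" .
  qed auto
  then show ?thesis by (rule abs_summable_summable)
qed

lemma ell2_zero: "(\<lambda>x. 0) \<in> ell2 V"
  by (simp add: ell2_def)

lemma ell2_scale: "u \<in> ell2 V \<Longrightarrow> (\<lambda>x. c * u x) \<in> ell2 V"
  by (auto simp: ell2_def norm_mult power_mult_distrib intro!: summable_on_cmult_right)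

lemma ell2_add:
  assumes "u \<in> ell2 V" and "v \<in> ell2 V"
  shows "(\<lambda>x. u x + v x) \<in> ell2 V"
proof (rule ell2I)
  have "(\<lambda>x. (cmod (u x))\<^sup>2 + (cmod (v x))\<^sup>2 + 2 * (u x \<bullet> v x)) summable_on V"
    using assms by (intro summable_on_add summable_on_cmult_right ell2_summable inner_summable)
  moreover have "(cmod (u x + v x))\<^sup>2 = (cmod (u x))\<^sup>2 + (cmod (v x))\<^sup>2 + 2 * (u x \<bullet> v x)" for x
    using dot_norm[of "u x" "v x"] by simp
  ultimately show "(\<lambda>x. (cmod (u x + v x))\<^sup>2) summable_on V" by simp
qed (simp add: ell2_outside[OF assms(1)] ell2_outside[OF assms(2)])

lemma ell2_uminus: "u \<in> ell2 V \<Longrightarrow> (\<lambda>x. - u x) \<in> ell2 V"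
  using ell2_scale[of u V "-1"] by simp

lemma ell2_diff: "u \<in> ell2 V \<Longrightarrow> v \<in> ell2 V \<Longrightarrow> (\<lambda>x. u x - v x) \<in> ell2 V"
  using ell2_add[of u V "\<lambda>x. - v x"] by (simp add: ell2_uminus)

lemmas ell2_closed = ell2_zero ell2_scale ell2_add ell2_uminus ell2_diff

lemma ell2_finite_support:
  assumes "finite F" and "F \<subseteq> V" and "\<And>x. x \<notin> F \<Longrightarrow> u x = 0"
  shows "u \<in> ell2 V"
proof (rule ell2I)
  show "(\<lambda>x. (cmod (u x))\<^sup>2) summable_on V"
    by (rule finite_nonzero_values_imp_summable_on)
       (use assms in \<open>auto intro: finite_subset[of _ F]\<close>)
qed (use assms in auto)

lemma ell2_inner_commute: "ell2_inner V u v = ell2_inner V v u"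
  by (simp add: ell2_inner_def inner_commute)

lemma ell2_inner_add_left:
  "u \<in> ell2 V \<Longrightarrow> v \<in> ell2 V \<Longrightarrow> w \<in> ell2 V \<Longrightarrow>
   ell2_inner V (\<lambda>x. u x + v x) w = ell2_inner V u w + ell2_inner V v w"
  by (simp add: ell2_inner_def inner_add_left infsum_add inner_summable)

lemma ell2_inner_scale_real_left:
  "ell2_inner V (\<lambda>x. of_real r * u x) w = r * ell2_inner V u w"
proof -
  have "(of_real r * a) \<bullet> b = r * (a \<bullet> b)" for a b :: complex
    by (simp add: inner_complex_def algebra_simps)
  then show ?thesis by (simp add: ell2_inner_def infsum_cmult_right')
qed

lemma ell2_inner_diff_left:
  "u \<in> ell2 V \<Longrightarrow> v \<in> ell2 V \<Longrightarrow> w \<in> ell2 V \<Longrightarrow>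
   ell2_inner V (\<lambda>x. u x - v x) w = ell2_inner V u w - ell2_inner V v w"
  using ell2_inner_add_left[of u V "\<lambda>x. of_real (-1) * v x" w]
    ell2_inner_scale_real_left[of V "-1" v w]
  by (simp add: ell2_uminus)

lemma ell2_inner_add_right:
  "u \<in> ell2 V \<Longrightarrow> v \<in> ell2 V \<Longrightarrow> w \<in> ell2 V \<Longrightarrow>
   ell2_inner V w (\<lambda>x. u x + v x) = ell2_inner V w u + ell2_inner V w v"
  by (simp add: ell2_inner_commute[of V w] ell2_inner_add_left)

lemma ell2_inner_diff_right:
  "u \<in> ell2 V \<Longrightarrow> v \<in> ell2 V \<Longrightarrow> w \<in> ell2 V \<Longrightarrow>
   ell2_inner V w (\<lambda>x. u x - v x) = ell2_inner V w u - ell2_inner V w v"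
  by (simp add: ell2_inner_commute[of V w] ell2_inner_diff_left)

lemma ell2_inner_scale_real_right:
  "ell2_inner V w (\<lambda>x. of_real r * u x) = r * ell2_inner V w u"
  by (simp add: ell2_inner_commute[of V w] ell2_inner_scale_real_left)

lemma ell2_norm_nonneg: "0 \<le> ell2_norm V u"
  by (simp add: ell2_norm_def infsum_nonneg)

lemma ell2_norm_square: "(ell2_norm V u)\<^sup>2 = ell2_inner V u u"
  by (simp add: ell2_norm_def ell2_inner_def infsum_nonneg power2_norm_eq_inner)

lemma ell2_norm_square_infsum: "(ell2_norm V u)\<^sup>2 = (\<Sum>\<^sub>\<infinity>x\<in>V. (cmod (u x))\<^sup>2)"
  by (simp add: ell2_norm_def infsum_nonneg)

lemma ell2_norm_scale: "ell2_norm V (\<lambda>x. c * u x) = cmod c * ell2_norm V u"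
  by (simp add: ell2_norm_def norm_mult power_mult_distrib infsum_cmult_right' real_sqrt_mult)

lemma ell2_norm_zero: "ell2_norm V (\<lambda>x. 0) = 0"
  by (simp add: ell2_norm_def)

lemma ell2_norm_minus_commute: "ell2_norm V (\<lambda>x. u x - v x) = ell2_norm V (\<lambda>x. v x - u x)"
  by (simp add: ell2_norm_def norm_minus_commute)

lemma norm_le_ell2_norm:
  assumes "u \<in> ell2 V"
  shows "cmod (u x) \<le> ell2_norm V u"
proof (cases "x \<in> V")
  case True
  have "(\<Sum>x\<in>{x}. (cmod (u x))\<^sup>2) \<le> (\<Sum>\<^sub>\<infinity>x\<in>V. (cmod (u x))\<^sup>2)"
    by (rule finite_sum_le_infsum) (use assms True in \<open>auto simp: ell2_summable\<close>)
  then show ?thesis by (simp add: ell2_norm_def real_le_rsqrt)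
qed (simp add: ell2_outside[OF assms] ell2_norm_nonneg)

lemma ell2_norm_eq_0: "u \<in> ell2 V \<Longrightarrow> ell2_norm V u = 0 \<Longrightarrow> u = (\<lambda>x. 0)"
  using norm_le_ell2_norm[of u V] by fastforce

text \<open>
  Applied to the squared norm of \<open>u - t v\<close> and to the form of a positive operator at \<open>u - t v\<close>,
  this yields the two Cauchy-Schwarz inequalities on which everything else relies.
\<close>

lemma discriminant_le:
  fixes a b c :: real
  assumes quadratic: "\<And>t. 0 \<le> a - 2 * t * b + t\<^sup>2 * c" and nonneg: "0 \<le> c"
  shows "b\<^sup>2 \<le> a * c"
proof (cases "c = 0")
  case True
  have "b = 0"
  proof (rule ccontr)
    assume "b \<noteq> 0"
    then show False using quadratic[of "(a + 1) / (2 * b)"] True by simp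
  qed
  then show ?thesis using True by simp
next
  case False
  then have "0 < c" using nonneg by simp
  then show ?thesis using quadratic[of "b / c"] by (simp add: field_simps power2_eq_square)
qed

lemma ell2_Cauchy_Schwarz:
  assumes "u \<in> ell2 V" and "v \<in> ell2 V"
  shows "\<bar>ell2_inner V u v\<bar> \<le> ell2_norm V u * ell2_norm V v"
proof -
  have "(ell2_inner V u v)\<^sup>2 \<le> ell2_inner V u u * ell2_inner V v v"
  proof (rule discriminant_le)
    fix t :: real
    have "0 \<le> ell2_inner V (\<lambda>x. u x - of_real t * v x) (\<lambda>x. u x - of_real t * v x)"
      by (simp flip: ell2_norm_square)
    also have "\<dots> = ell2_inner V u u - 2 * t * ell2_inner V u v + t\<^sup>2 * ell2_inner V v v"
      using assms
      by (simp add: ell2_inner_diff_left ell2_inner_diff_right ell2_closed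
          ell2_inner_scale_real_left ell2_inner_scale_real_right ell2_inner_commute[of V v u]
          power2_eq_square algebra_simps)
    finally show "0 \<le> ell2_inner V u u - 2 * t * ell2_inner V u v + t\<^sup>2 * ell2_inner V v v" .
  qed (simp flip: ell2_norm_square)
  then have "\<bar>ell2_inner V u v\<bar>\<^sup>2 \<le> (ell2_norm V u * ell2_norm V v)\<^sup>2"
    by (simp add: power_mult_distrib ell2_norm_square)
  then show ?thesis
    by (rule power2_le_imp_le) (simp add: ell2_norm_nonneg)
qed

lemma ell2_norm_triangle:
  assumes "u \<in> ell2 V" and "v \<in> ell2 V"
  shows "ell2_norm V (\<lambda>x. u x + v x) \<le> ell2_norm V u + ell2_norm V v"
proof (rule power2_le_imp_le)
  have "(ell2_norm V (\<lambda>x. u x + v x))\<^sup>2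
      = (ell2_norm V u)\<^sup>2 + 2 * ell2_inner V u v + (ell2_norm V v)\<^sup>2"
    using assms by (simp add: ell2_norm_square ell2_inner_add_left ell2_inner_add_right
        ell2_closed ell2_inner_commute[of V v u])
  also have "\<dots> \<le> (ell2_norm V u + ell2_norm V v)\<^sup>2"
    using ell2_Cauchy_Schwarz[OF assms] by (simp add: power2_eq_square algebra_simps)
  finally show "(ell2_norm V (\<lambda>x. u x + v x))\<^sup>2 \<le> (ell2_norm V u + ell2_norm V v)\<^sup>2" .
qed (simp add: ell2_norm_nonneg)

lemma ell2_norm_diff_triangle:
  assumes "u \<in> ell2 V" and "v \<in> ell2 V" and "w \<in> ell2 V"
  shows "ell2_norm V (\<lambda>x. u x - w x)
       \<le> ell2_norm V (\<lambda>x. u x - v x) + ell2_norm V (\<lambda>x. v x - w x)"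
  using ell2_norm_triangle[of "\<lambda>x. u x - v x" V "\<lambda>x. v x - w x"] assms by (simp add: ell2_closed)

text \<open>
  Completeness, in the form that a fixed-point iteration needs. The norm dominates the values, so the
  sequence converges pointwise; the bounds of its tails survive the limit on finite sets of points,
  hence in norm.
\<close>

lemma ell2_geometric_limit:
  fixes U :: "nat \<Rightarrow> 'a \<Rightarrow> complex"
  assumes U: "\<And>n. U n \<in> ell2 V"
    and step: "\<And>n. ell2_norm V (\<lambda>x. U (Suc n) x - U n x) \<le> C * q ^ n"
    and q: "0 \<le> q" "q < 1"
  obtains u where "u \<in> ell2 V" and "(\<lambda>n. ell2_norm V (\<lambda>x. U n x - u x)) \<longlonglongrightarrow> 0"
proof -
  have "0 \<le> C" using step[of 0] ell2_norm_nonneg[of V "\<lambda>x. U (Suc 0) x - U 0 x"] by simp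
  define e where "e n = C * q ^ n / (1 - q)" for n
  \<comment> \<open>the tail bound has to telescope, as a bound by \<open>e n\<close> alone would not pass the induction\<close>
  have e_tail: "ell2_norm V (\<lambda>x. U (n + k) x - U n x) \<le> e n - e (n + k)" for n k
  proof (induction k)
    case 0
    then show ?case by (simp add: ell2_norm_zero)
  next
    case (Suc k)
    have "ell2_norm V (\<lambda>x. U (n + Suc k) x - U n x)
        \<le> ell2_norm V (\<lambda>x. U (Suc (n + k)) x - U (n + k) x) + ell2_norm V (\<lambda>x. U (n + k) x - U n x)"
      using ell2_norm_diff_triangle[of "U (Suc (n + k))" V "U (n + k)" "U n"] U by simp
    also have "\<dots> \<le> C * q ^ (n + k) + (e n - e (n + k))"
      using step[of "n + k"] Suc.IH by linarith
    also have "C * q ^ (n + k) = e (n + k) - e (n + Suc k)"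
    proof -
      have "e (n + k) - e (n + Suc k) = C * q ^ (n + k) * (1 - q) / (1 - q)"
        by (simp add: e_def algebra_simps diff_divide_distrib)
      then show ?thesis using q by simp
    qed
    finally show ?case by simp
  qed
  have e_nonneg: "0 \<le> e n" for n using \<open>0 \<le> C\<close> q by (simp add: e_def)
  have tail: "ell2_norm V (\<lambda>x. U (n + k) x - U n x) \<le> e n" for n k
    using e_tail[of n k] e_nonneg[of "n + k"] by linarith
  have e_lim: "e \<longlonglongrightarrow> 0"
  proof -
    have "(\<lambda>n. C / (1 - q) * q ^ n) \<longlonglongrightarrow> C / (1 - q) * 0"
      using q by (intro tendsto_mult tendsto_const LIMSEQ_power_zero) auto
    then show ?thesis by (simp add: e_def[abs_def])
  qed
  have "convergent (\<lambda>n. U n x)" for x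
  proof -
    have "summable (\<lambda>n. U (Suc n) x - U n x)"
    proof (rule summable_comparison_test'[of "\<lambda>n. C * q ^ n"])
      show "summable (\<lambda>n. C * q ^ n)" using q by (intro summable_mult summable_geometric) auto
      show "norm (U (Suc n) x - U n x) \<le> C * q ^ n" for n
        using norm_le_ell2_norm[OF ell2_diff[OF U[of "Suc n"] U[of n]], of x] step[of n] by simp
    qed
    then show ?thesis
      by (simp add: summable_iff_convergent sum_lessThan_telescope[of "\<lambda>n. U n x"]
          convergent_diff_const_right_iff)
  qed
  then obtain u where lim: "\<And>x. (\<lambda>n. U n x) \<longlonglongrightarrow> u x"
    unfolding convergent_def by metis
  have fin: "(\<Sum>x\<in>F. (cmod (u x - U n x))\<^sup>2) \<le> (e n)\<^sup>2" if F: "finite F" "F \<subseteq> V" for F n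
  proof (rule LIMSEQ_le_const2)
    show "(\<lambda>k. \<Sum>x\<in>F. (cmod (U (n + k) x - U n x))\<^sup>2) \<longlonglongrightarrow> (\<Sum>x\<in>F. (cmod (u x - U n x))\<^sup>2)"
      using LIMSEQ_ignore_initial_segment[OF lim, of n]
      by (intro tendsto_intros) (simp add: add.commute)
    have "(\<Sum>x\<in>F. (cmod (U (n + k) x - U n x))\<^sup>2) \<le> (e n)\<^sup>2" for k
    proof -
      have "(\<Sum>x\<in>F. (cmod (U (n + k) x - U n x))\<^sup>2) \<le> (\<Sum>\<^sub>\<infinity>x\<in>V. (cmod (U (n + k) x - U n x))\<^sup>2)"
        by (rule finite_sum_le_infsum) (use F ell2_summable[OF ell2_diff[OF U U]] in auto)
      also have "\<dots> = (ell2_norm V (\<lambda>x. U (n + k) x - U n x))\<^sup>2"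
        by (simp add: ell2_norm_square_infsum)
      also have "\<dots> \<le> (e n)\<^sup>2" by (intro power_mono tail ell2_norm_nonneg)
      finally show ?thesis .
    qed
    then show "\<exists>N. \<forall>k\<ge>N. (\<Sum>x\<in>F. (cmod (U (n + k) x - U n x))\<^sup>2) \<le> (e n)\<^sup>2" by blast
  qed
  have diff_ell2: "(\<lambda>x. u x - U n x) \<in> ell2 V" for n
  proof (rule ell2I)
    show "u x - U n x = 0" if "x \<notin> V" for x
      using lim[of x] that by (simp add: ell2_outside[OF U] LIMSEQ_const_iff)
    show "(\<lambda>x. (cmod (u x - U n x))\<^sup>2) summable_on V"
      by (rule nonneg_bdd_above_summable_on) (auto intro!: bdd_aboveI[of _ "(e n)\<^sup>2"] fin)
  qed
  have "u \<in> ell2 V" using ell2_add[OF diff_ell2 U, of 0 0] by simp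
  moreover have "(\<lambda>n. ell2_norm V (\<lambda>x. U n x - u x)) \<longlonglongrightarrow> 0"
  proof (rule tendsto_sandwich[OF _ _ tendsto_const e_lim])
    show "\<forall>\<^sub>F n in sequentially. 0 \<le> ell2_norm V (\<lambda>x. U n x - u x)"
      by (simp add: ell2_norm_nonneg)
    have "ell2_norm V (\<lambda>x. U n x - u x) \<le> e n" for n
    proof -
      have "(\<Sum>\<^sub>\<infinity>x\<in>V. (cmod (u x - U n x))\<^sup>2) \<le> (e n)\<^sup>2"
        by (rule infsum_le_finite_sums) (use ell2_summable[OF diff_ell2] fin in auto)
      then show ?thesis
        using e_nonneg[of n]
        by (simp add: ell2_norm_def real_le_lsqrt norm_minus_commute)
    qed
    then show "\<forall>\<^sub>F n in sequentially. ell2_norm V (\<lambda>x. U n x - u x) \<le> e n" by simp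
  qed
  ultimately show ?thesis using that by blast
qed

section \<open>Self-adjoint operators and the bounds of their spectrum\<close>

abbreviation "ell2_operator V \<equiv> bounded_operator (ell2 V) (ell2_norm V)"
abbreviation "ell2_spectrum V \<equiv> spectrum (ell2 V) (ell2_norm V)"

text \<open>
  Symmetry for the real part of the scalar product, together with complex linearity, is symmetry for
  the scalar product itself.
\<close>

definition self_adjoint :: "'a set \<Rightarrow> (('a \<Rightarrow> complex) \<Rightarrow> ('a \<Rightarrow> complex)) \<Rightarrow> bool" where
  "self_adjoint V T \<longleftrightarrow> ell2_operator V T \<and>
     (\<forall>u\<in>ell2 V. \<forall>v\<in>ell2 V. ell2_inner V (T u) v = ell2_inner V u (T v))"

lemma bounded_operator_positive_bound:
  assumes "ell2_operator V T"
  obtains C where "c \<le> C" and "0 < C" and "\<And>u. u \<in> ell2 V \<Longrightarrow> ell2_norm V (T u) \<le> C * ell2_norm V u"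
proof -
  obtain C where C: "\<And>u. u \<in> ell2 V \<Longrightarrow> ell2_norm V (T u) \<le> C * ell2_norm V u"
    using assms unfolding bounded_operator_def by blast
  have "ell2_norm V (T u) \<le> max (max c C) 1 * ell2_norm V u" if "u \<in> ell2 V" for u
  proof -
    have "C * ell2_norm V u \<le> max (max c C) 1 * ell2_norm V u"
      by (intro mult_right_mono ell2_norm_nonneg) simp
    then show ?thesis using C[OF that] by linarith
  qed
  then show ?thesis using that[of "max (max c C) 1"] by simp
qed

context
  fixes V :: "'a set" and T
  assumes bounded: "ell2_operator V T"
begin

lemma operator_closed: "u \<in> ell2 V \<Longrightarrow> T u \<in> ell2 V"
  using bounded by (simp add: bounded_operator_def)

lemma operator_add: "u \<in> ell2 V \<Longrightarrow> v \<in> ell2 V \<Longrightarrow> T (\<lambda>x. u x + v x) = (\<lambda>x. T u x + T v x)"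
  using bounded by (simp add: bounded_operator_def)

lemma operator_scale: "u \<in> ell2 V \<Longrightarrow> T (\<lambda>x. c * u x) = (\<lambda>x. c * T u x)"
  using bounded by (simp add: bounded_operator_def)

lemma operator_diff: "u \<in> ell2 V \<Longrightarrow> v \<in> ell2 V \<Longrightarrow> T (\<lambda>x. u x - v x) = (\<lambda>x. T u x - T v x)"
  using operator_add[of u "\<lambda>x. (-1) * v x"] operator_scale[of v "-1"] ell2_uminus[of v V] by simp

end

lemma bounded_operator_affine:
  assumes "ell2_operator V T"
  shows "ell2_operator V (\<lambda>u x. a * u x + b * T u x)"
proof -
  obtain C where "0 < C" and C: "\<And>u. u \<in> ell2 V \<Longrightarrow> ell2_norm V (T u) \<le> C * ell2_norm V u"
    using bounded_operator_positive_bound[OF assms] by blast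
  have "ell2_norm V (\<lambda>x. a * u x + b * T u x) \<le> (cmod a + cmod b * C) * ell2_norm V u"
    if u: "u \<in> ell2 V" for u
  proof -
    have "ell2_norm V (\<lambda>x. a * u x + b * T u x) \<le> cmod a * ell2_norm V u + cmod b * ell2_norm V (T u)"
      using ell2_norm_triangle[of "\<lambda>x. a * u x" V "\<lambda>x. b * T u x"] u operator_closed[OF assms u]
      by (simp add: ell2_closed ell2_norm_scale)
    also have "\<dots> \<le> cmod a * ell2_norm V u + cmod b * (C * ell2_norm V u)"
      by (intro add_left_mono mult_left_mono C u) simp
    finally show ?thesis by (simp add: algebra_simps)
  qed
  then have "\<exists>C. \<forall>u\<in>ell2 V. ell2_norm V (\<lambda>x. a * u x + b * T u x) \<le> C * ell2_norm V u" by blast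
  then show ?thesis
    unfolding bounded_operator_def
    by (simp add: ell2_closed operator_closed[OF assms] operator_add[OF assms]
        operator_scale[OF assms] algebra_simps)
qed

text \<open>
  The Lax-Milgram lemma. If \<open>c \<parallel>u\<parallel>\<^sup>2 \<le> Re \<langle>Bu, u\<rangle>\<close> and \<open>\<parallel>Bu\<parallel> \<le> C \<parallel>u\<parallel>\<close>, then for \<open>t = c / C\<^sup>2\<close> the map
  \<open>1 - t B\<close> has norm at most \<open>\<surd>(1 - c\<^sup>2 / C\<^sup>2) < 1\<close>, so that \<open>u \<mapsto> u - t B u + t g\<close> has a fixed point.
\<close>

lemma coercive_surjective:
  assumes B: "ell2_operator V B" and "0 < c"
    and coercive: "\<And>u. u \<in> ell2 V \<Longrightarrow> c * (ell2_norm V u)\<^sup>2 \<le> ell2_inner V (B u) u"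
    and g: "g \<in> ell2 V"
  obtains u where "u \<in> ell2 V" and "B u = g"
proof -
  obtain C where C: "c \<le> C" "0 < C"
    "\<And>u. u \<in> ell2 V \<Longrightarrow> ell2_norm V (B u) \<le> C * ell2_norm V u"
    using bounded_operator_positive_bound[OF B, of c] by blast
  define t where "t = c / C\<^sup>2"
  define q where "q = sqrt (1 - c\<^sup>2 / C\<^sup>2)"
  have "0 < t" using C \<open>0 < c\<close> by (simp add: t_def)
  have "c\<^sup>2 / C\<^sup>2 \<le> 1" using C \<open>0 < c\<close> by (simp add: power_mono)
  then have q: "0 \<le> q" "q < 1" "q\<^sup>2 = 1 - c\<^sup>2 / C\<^sup>2" using C \<open>0 < c\<close> by (auto simp: q_def)
  note closed = ell2_closed operator_closed[OF B]
  have contraction: "ell2_norm V (\<lambda>x. u x - of_real t * B u x) \<le> q * ell2_norm V u"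
    if u: "u \<in> ell2 V" for u
  proof (rule power2_le_imp_le)
    have "(ell2_norm V (\<lambda>x. u x - of_real t * B u x))\<^sup>2
        = (ell2_norm V u)\<^sup>2 - 2 * t * ell2_inner V (B u) u + t\<^sup>2 * (ell2_norm V (B u))\<^sup>2"
      using u by (simp add: ell2_norm_square closed ell2_inner_diff_left ell2_inner_diff_right
          ell2_inner_scale_real_left ell2_inner_scale_real_right ell2_inner_commute[of V u "B u"]
          power2_eq_square[of t] algebra_simps)
    also have "\<dots> \<le> (ell2_norm V u)\<^sup>2 - 2 * t * (c * (ell2_norm V u)\<^sup>2) + t\<^sup>2 * (C * ell2_norm V u)\<^sup>2"
      using \<open>0 < t\<close>
      by (intro add_mono diff_mono mult_left_mono coercive power_mono C(3) u ell2_norm_nonneg) auto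
    also have "\<dots> = (q * ell2_norm V u)\<^sup>2"
    proof -
      have "1 - 2 * t * c + t\<^sup>2 * C\<^sup>2 = q\<^sup>2"
        unfolding q(3) t_def using C(2) by (simp add: field_simps power2_eq_square)
      then have "(q * ell2_norm V u)\<^sup>2 = (1 - 2 * t * c + t\<^sup>2 * C\<^sup>2) * (ell2_norm V u)\<^sup>2"
        by (simp add: power_mult_distrib)
      then show ?thesis by (simp add: power_mult_distrib algebra_simps)
    qed
    finally show "(ell2_norm V (\<lambda>x. u x - of_real t * B u x))\<^sup>2 \<le> (q * ell2_norm V u)\<^sup>2" .
  qed (simp add: q ell2_norm_nonneg)
  define U where "U = rec_nat (\<lambda>x. 0) (\<lambda>_ u x. u x - of_real t * B u x + of_real t * g x)"
  have U_Suc: "U (Suc n) = (\<lambda>x. U n x - of_real t * B (U n) x + of_real t * g x)" for n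
    by (simp add: U_def)
  have U: "U n \<in> ell2 V" for n
    by (induction n) (simp_all add: U_Suc closed g, simp add: U_def ell2_zero)
  have step: "ell2_norm V (\<lambda>x. U (Suc n) x - U n x) \<le> ell2_norm V (\<lambda>x. U 1 x - U 0 x) * q ^ n" for n
  proof (induction n)
    case (Suc n)
    have D: "(\<lambda>x. U (Suc n) x - U n x) \<in> ell2 V" by (intro closed U)
    have "(\<lambda>x. U (Suc (Suc n)) x - U (Suc n) x)
        = (\<lambda>x. (U (Suc n) x - U n x) - of_real t * B (\<lambda>x. U (Suc n) x - U n x) x)"
      by (simp only: operator_diff[OF B U U]) (simp add: U_Suc[of "Suc n"] U_Suc[of n] algebra_simps)
    then have "ell2_norm V (\<lambda>x. U (Suc (Suc n)) x - U (Suc n) x)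
        \<le> q * ell2_norm V (\<lambda>x. U (Suc n) x - U n x)"
      using contraction[OF D] by simp
    also have "\<dots> \<le> q * (ell2_norm V (\<lambda>x. U 1 x - U 0 x) * q ^ n)"
      by (intro mult_left_mono Suc.IH q)
    finally show ?case by (simp add: algebra_simps)
  qed simp
  obtain u where u: "u \<in> ell2 V" and lim: "(\<lambda>n. ell2_norm V (\<lambda>x. U n x - u x)) \<longlonglongrightarrow> 0"
    using ell2_geometric_limit[OF U step q(1,2)] by blast
  have limit_eq: "ell2_norm V (\<lambda>x. of_real t * (B u x - g x))
      \<le> t * C * ell2_norm V (\<lambda>x. U n x - u x) + ell2_norm V (\<lambda>x. U 1 x - U 0 x) * q ^ n" for n
  proof -
    have D: "(\<lambda>x. U n x - u x) \<in> ell2 V" by (intro closed U u)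
    have "(\<lambda>x. of_real t * (B u x - g x))
        = (\<lambda>x. (U n x - U (Suc n) x) - of_real t * B (\<lambda>x. U n x - u x) x)"
      by (simp add: operator_diff[OF B U u] U_Suc algebra_simps)
    then have "ell2_norm V (\<lambda>x. of_real t * (B u x - g x))
        = ell2_norm V (\<lambda>x. (U n x - U (Suc n) x) + of_real (- t) * B (\<lambda>x. U n x - u x) x)"
      by simp
    also have "\<dots> \<le> ell2_norm V (\<lambda>x. U n x - U (Suc n) x)
        + t * ell2_norm V (B (\<lambda>x. U n x - u x))"
      using ell2_norm_triangle[OF ell2_diff[OF U[of n] U[of "Suc n"]]
          ell2_scale[OF operator_closed[OF B D], of "of_real (- t)"]] \<open>0 < t\<close>
      by (simp only: ell2_norm_scale) simp
    also have "\<dots> \<le> ell2_norm V (\<lambda>x. U 1 x - U 0 x) * q ^ n + t * (C * ell2_norm V (\<lambda>x. U n x - u x))"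
      using step[of n] \<open>0 < t\<close>
      by (intro add_mono mult_left_mono C(3) D) (simp_all add: ell2_norm_minus_commute[of V "U n"])
    finally show ?thesis by (simp add: algebra_simps)
  qed
  have "(\<lambda>n. t * C * ell2_norm V (\<lambda>x. U n x - u x) + ell2_norm V (\<lambda>x. U 1 x - U 0 x) * q ^ n)
      \<longlonglongrightarrow> t * C * 0 + ell2_norm V (\<lambda>x. U 1 x - U 0 x) * 0"
    using q by (intro tendsto_intros lim LIMSEQ_power_zero) auto
  then have "ell2_norm V (\<lambda>x. of_real t * (B u x - g x)) \<le> 0"
    using limit_eq by (intro LIMSEQ_le_const) auto
  then have "ell2_norm V (\<lambda>x. of_real t * (B u x - g x)) = 0"
    using ell2_norm_nonneg by (intro antisym)
  then have "(\<lambda>x. of_real t * (B u x - g x)) = (\<lambda>x. 0)"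
    by (rule ell2_norm_eq_0[rotated]) (intro closed u g)
  then have "B u = g" using \<open>0 < t\<close> by (simp add: fun_eq_iff)
  then show ?thesis using that u by blast
qed

lemma coercive_bounded_below:
  assumes "ell2_operator V B" and u: "u \<in> ell2 V"
    and "c * (ell2_norm V u)\<^sup>2 \<le> ell2_inner V (B u) u"
  shows "c * ell2_norm V u \<le> ell2_norm V (B u)"
proof (cases "ell2_norm V u = 0")
  case False
  then have "0 < ell2_norm V u" using ell2_norm_nonneg[of V u] by simp
  moreover have "c * (ell2_norm V u)\<^sup>2 \<le> ell2_norm V (B u) * ell2_norm V u"
    using assms(3) ell2_Cauchy_Schwarz[OF operator_closed[OF assms(1) u] u] by linarith
  ultimately show ?thesis by (simp add: power2_eq_square flip: mult.assoc)
qed (simp add: ell2_norm_nonneg)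

text \<open>
  The inverse of \<open>T - z\<close> is the inverse of the coercive operator \<open>w (T - z)\<close> after multiplication
  by \<open>w\<close>. The factor \<open>w\<close> serves to make \<open>T - z\<close> coercive: \<open>\<plusminus> 1\<close> for real \<open>z\<close> beyond the range of the
  form of \<open>T\<close>, and \<open>\<i> (Im z)\<close> for non-real \<open>z\<close>.
\<close>

lemma coercive_not_in_spectrum:
  assumes T: "ell2_operator V T" and "0 < c" and "w \<noteq> 0"
    and coercive: "\<And>u. u \<in> ell2 V \<Longrightarrow>
      c * (ell2_norm V u)\<^sup>2 \<le> ell2_inner V (\<lambda>x. w * (T u x - z * u x)) u"
  shows "z \<notin> ell2_spectrum V T"
proof -
  define B where "B u = (\<lambda>x. w * (T u x - z * u x))" for u
  have "B = (\<lambda>u x. (- w * z) * u x + w * T u x)" by (auto simp: B_def fun_eq_iff algebra_simps)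
  then have B: "ell2_operator V B"
    using bounded_operator_affine[OF T, of "- w * z" w] by simp
  have B_coercive: "c * (ell2_norm V u)\<^sup>2 \<le> ell2_inner V (B u) u" if "u \<in> ell2 V" for u
    using coercive[OF that] by (simp add: B_def)
  have below: "c * ell2_norm V u \<le> ell2_norm V (B u)" if "u \<in> ell2 V" for u
    by (rule coercive_bounded_below[OF B that B_coercive[OF that]])
  have "\<exists>u. u \<in> ell2 V \<and> B u = (\<lambda>x. w * g x)" if "g \<in> ell2 V" for g
    using coercive_surjective[OF B \<open>0 < c\<close> B_coercive ell2_scale[OF that]] by metis
  then obtain S where S: "\<And>g. g \<in> ell2 V \<Longrightarrow> S g \<in> ell2 V"
    and BS: "\<And>g. g \<in> ell2 V \<Longrightarrow> B (S g) = (\<lambda>x. w * g x)"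
    by metis
  have inj: "u = v" if "u \<in> ell2 V" "v \<in> ell2 V" "B u = B v" for u v
  proof -
    have "B (\<lambda>x. u x - v x) = (\<lambda>x. 0)" using that by (simp add: operator_diff[OF B])
    then have "ell2_norm V (\<lambda>x. u x - v x) \<le> 0"
      using below[OF ell2_diff[OF that(1,2)]] \<open>0 < c\<close>
      by (simp add: ell2_norm_zero mult_le_0_iff)
    then have "ell2_norm V (\<lambda>x. u x - v x) = 0" using ell2_norm_nonneg by (intro antisym)
    then show ?thesis using ell2_norm_eq_0[OF ell2_diff[OF that(1,2)]] by (simp add: fun_eq_iff)
  qed
  have "ell2_operator V S"
    unfolding bounded_operator_def
  proof (intro conjI ballI allI)
    fix u v assume uv: "u \<in> ell2 V" "v \<in> ell2 V"
    show "S (\<lambda>x. u x + v x) = (\<lambda>x. S u x + S v x)"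
      by (rule inj) (use uv in \<open>simp_all add: S BS ell2_closed operator_add[OF B] algebra_simps\<close>)
  next
    fix a u assume u: "u \<in> ell2 V"
    show "S (\<lambda>x. a * u x) = (\<lambda>x. a * S u x)"
      by (rule inj) (use u in \<open>simp_all add: S BS ell2_closed operator_scale[OF B] algebra_simps\<close>)
  next
    show "\<exists>C. \<forall>u\<in>ell2 V. ell2_norm V (S u) \<le> C * ell2_norm V u"
    proof (intro exI ballI)
      fix u assume u: "u \<in> ell2 V"
      show "ell2_norm V (S u) \<le> (cmod w / c) * ell2_norm V u"
        using below[OF S[OF u]] \<open>0 < c\<close> by (simp add: BS u ell2_norm_scale field_simps)
    qed
  qed (rule S)
  moreover have "S (\<lambda>x. T u x - z * u x) = u \<and> (\<lambda>x. T (S u) x - z * S u x) = u"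
    if u: "u \<in> ell2 V" for u
  proof
    have closed: "(\<lambda>x. T u x - z * u x) \<in> ell2 V"
      using u by (intro ell2_closed operator_closed[OF T])
    show "S (\<lambda>x. T u x - z * u x) = u"
      by (rule inj) (use u closed in \<open>simp_all add: S BS, simp add: B_def\<close>)
    show "(\<lambda>x. T (S u) x - z * S u x) = u"
      using BS[OF u] \<open>w \<noteq> 0\<close> by (simp add: B_def fun_eq_iff)
  qed
  ultimately show ?thesis unfolding spectrum_def by blast
qed

lemma inner_imaginary_self: "ell2_inner V (\<lambda>x. \<i> * u x) u = 0"
  by (simp add: ell2_inner_def inner_complex_def)

lemma self_adjoint_inner_imaginary:
  assumes T: "self_adjoint V T" and u: "u \<in> ell2 V"
  shows "ell2_inner V (\<lambda>x. \<i> * T u x) u = 0"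
proof -
  have bounded: "ell2_operator V T" using T by (simp add: self_adjoint_def)
  have "ell2_inner V (\<lambda>x. \<i> * T u x) u = ell2_inner V (T (\<lambda>x. \<i> * u x)) u"
    by (simp add: operator_scale[OF bounded u])
  also have "\<dots> = ell2_inner V (\<lambda>x. \<i> * u x) (T u)"
    using T u by (simp add: self_adjoint_def ell2_closed)
  also have "\<dots> = - ell2_inner V (\<lambda>x. \<i> * T u x) u"
    by (subst ell2_inner_commute) (simp add: ell2_inner_def inner_complex_def flip: infsum_uminus)
  finally show ?thesis by simp
qed


lemma positive_form_Cauchy_Schwarz:
  assumes P: "self_adjoint V P" and pos: "\<And>u. u \<in> ell2 V \<Longrightarrow> 0 \<le> ell2_inner V (P u) u"
    and u: "u \<in> ell2 V" and v: "v \<in> ell2 V"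
  shows "(ell2_inner V (P u) v)\<^sup>2 \<le> ell2_inner V (P u) u * ell2_inner V (P v) v"
proof (rule discriminant_le)
  fix t :: real
  have B: "ell2_operator V P"
    and sym: "ell2_inner V (P v) u = ell2_inner V (P u) v"
    using P u v by (simp_all add: self_adjoint_def ell2_inner_commute)
  have tv: "(\<lambda>x. of_real t * v x) \<in> ell2 V" using v by (rule ell2_scale)
  have "0 \<le> ell2_inner V (P (\<lambda>x. u x - of_real t * v x)) (\<lambda>x. u x - of_real t * v x)"
    by (intro pos ell2_closed u v)
  also have "\<dots> = ell2_inner V (P u) u - 2 * t * ell2_inner V (P u) v + t\<^sup>2 * ell2_inner V (P v) v"
    using u v tv
    by (simp add: operator_diff[OF B u tv] operator_scale[OF B v] ell2_inner_diff_left
        ell2_inner_diff_right ell2_closed operator_closed[OF B] ell2_inner_scale_real_left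
        ell2_inner_scale_real_right sym power2_eq_square algebra_simps)
  finally show "0 \<le> ell2_inner V (P u) u - 2 * t * ell2_inner V (P u) v + t\<^sup>2 * ell2_inner V (P v) v" .
qed (rule pos[OF v])

text \<open>
  The Cauchy-Schwarz inequality for the form of \<open>P\<close>, at the vectors \<open>u\<close> and \<open>P u\<close>.
\<close>

lemma positive_operator_bound:
  assumes P: "self_adjoint V P" and pos: "\<And>u. u \<in> ell2 V \<Longrightarrow> 0 \<le> ell2_inner V (P u) u"
    and K: "\<And>u. u \<in> ell2 V \<Longrightarrow> ell2_inner V (P u) u \<le> K * (ell2_norm V u)\<^sup>2"
    and u: "u \<in> ell2 V"
  shows "(ell2_norm V (P u))\<^sup>2 \<le> K * ell2_inner V (P u) u"
proof (cases "ell2_norm V (P u) = 0")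
  case True
  have "0 \<le> K * ell2_inner V (P u) u"
  proof (cases "ell2_inner V (P u) u = 0")
    case False
    then have "0 < ell2_inner V (P u) u" using pos[OF u] by simp
    then have "0 < K * (ell2_norm V u)\<^sup>2" using K[OF u] by linarith
    then have "0 \<le> K" by (simp add: zero_less_mult_iff)
    then show ?thesis using pos[OF u] by simp
  qed simp
  then show ?thesis using True by simp
next
  case False
  have "ell2_operator V P" using P by (simp add: self_adjoint_def)
  then have Pu: "P u \<in> ell2 V" using u by (rule operator_closed)
  have "((ell2_norm V (P u))\<^sup>2)\<^sup>2 \<le> ell2_inner V (P u) u * ell2_inner V (P (P u)) (P u)"
    using positive_form_Cauchy_Schwarz[OF P pos u Pu] by (simp add: ell2_norm_square)
  also have "\<dots> \<le> ell2_inner V (P u) u * (K * (ell2_norm V (P u))\<^sup>2)"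
    by (intro mult_left_mono K Pu pos u)
  finally have "(ell2_norm V (P u))\<^sup>2 * (ell2_norm V (P u))\<^sup>2
      \<le> (K * ell2_inner V (P u) u) * (ell2_norm V (P u))\<^sup>2"
    by (simp add: power2_eq_square algebra_simps)
  then show ?thesis by (rule mult_right_le_imp_le) (use False in simp)
qed

lemma bounded_operator_form_bound:
  assumes "ell2_operator V T"
  obtains C where "0 < C" and "\<And>u. u \<in> ell2 V \<Longrightarrow> \<bar>ell2_inner V (T u) u\<bar> \<le> C * (ell2_norm V u)\<^sup>2"
proof -
  obtain C where C: "0 < C" "\<And>u. u \<in> ell2 V \<Longrightarrow> ell2_norm V (T u) \<le> C * ell2_norm V u"
    using bounded_operator_positive_bound[OF assms] by blast
  have "\<bar>ell2_inner V (T u) u\<bar> \<le> C * (ell2_norm V u)\<^sup>2" if u: "u \<in> ell2 V" for u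
  proof -
    have "\<bar>ell2_inner V (T u) u\<bar> \<le> ell2_norm V (T u) * ell2_norm V u"
      by (rule ell2_Cauchy_Schwarz[OF operator_closed[OF assms u] u])
    also have "\<dots> \<le> C * ell2_norm V u * ell2_norm V u"
      by (intro mult_right_mono C u ell2_norm_nonneg)
    finally show ?thesis by (simp add: power2_eq_square)
  qed
  then show ?thesis using that C by blast
qed

text \<open>
  An inverse of \<open>T - z\<close> would bound \<open>\<parallel>u\<parallel>\<close> by a multiple of \<open>\<parallel>P u\<parallel>\<close>, while \<open>\<parallel>P u\<parallel>\<^sup>2 \<le> C \<langle>P u, u\<rangle>\<close>
  can be made arbitrarily small on unit vectors.
\<close>

lemma degenerate_form_in_spectrum:
  assumes P: "self_adjoint V P" and pos: "\<And>u. u \<in> ell2 V \<Longrightarrow> 0 \<le> ell2_inner V (P u) u"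
    and small: "\<And>e. 0 < e \<Longrightarrow> \<exists>u\<in>ell2 V. ell2_inner V (P u) u < e * (ell2_norm V u)\<^sup>2"
    and "w \<noteq> 0" and PT: "\<And>u. u \<in> ell2 V \<Longrightarrow> P u = (\<lambda>x. w * (T u x - z * u x))"
  shows "z \<in> ell2_spectrum V T"
proof (rule ccontr)
  assume "z \<notin> ell2_spectrum V T"
  then obtain S where S: "ell2_operator V S"
    and ST: "\<And>u. u \<in> ell2 V \<Longrightarrow> S (\<lambda>x. T u x - z * u x) = u"
    unfolding spectrum_def by blast
  have B: "ell2_operator V P" using P by (simp add: self_adjoint_def)
  obtain C where C: "0 < C" "\<And>u. u \<in> ell2 V \<Longrightarrow> \<bar>ell2_inner V (P u) u\<bar> \<le> C * (ell2_norm V u)\<^sup>2"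
    using bounded_operator_form_bound[OF B] by blast
  obtain D where D: "0 < D" "\<And>u. u \<in> ell2 V \<Longrightarrow> ell2_norm V (S u) \<le> D * ell2_norm V u"
    using bounded_operator_positive_bound[OF S] by blast
  have below: "(ell2_norm V u)\<^sup>2 \<le> (D / cmod w)\<^sup>2 * C * ell2_inner V (P u) u" if u: "u \<in> ell2 V" for u
  proof -
    have "(\<lambda>x. T u x - z * u x) = (\<lambda>x. (1 / w) * P u x)" using \<open>w \<noteq> 0\<close> by (simp add: PT u)
    then have "u = S (\<lambda>x. (1 / w) * P u x)" using ST[OF u] by simp
    then have "ell2_norm V u \<le> D * ell2_norm V (\<lambda>x. (1 / w) * P u x)"
      using D(2)[OF ell2_scale[OF operator_closed[OF B u], of "1 / w"]] by simp
    then have "ell2_norm V u \<le> (D / cmod w) * ell2_norm V (P u)"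
      by (simp only: ell2_norm_scale) (simp add: norm_divide)
    then have "(ell2_norm V u)\<^sup>2 \<le> ((D / cmod w) * ell2_norm V (P u))\<^sup>2"
      by (intro power_mono ell2_norm_nonneg)
    also have "\<dots> = (D / cmod w)\<^sup>2 * (ell2_norm V (P u))\<^sup>2" by (simp only: power_mult_distrib)
    also have "\<dots> \<le> (D / cmod w)\<^sup>2 * (C * ell2_inner V (P u) u)"
    proof (intro mult_left_mono positive_operator_bound[OF P pos _ u])
      show "ell2_inner V (P v) v \<le> C * (ell2_norm V v)\<^sup>2" if "v \<in> ell2 V" for v
        using C(2)[OF that] by linarith
    qed auto
    finally show ?thesis by simp
  qed
  define k where "k = (D / cmod w)\<^sup>2 * C"
  have "0 < k" using C D \<open>w \<noteq> 0\<close> by (simp add: k_def)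
  then obtain u where u: "u \<in> ell2 V" and less: "ell2_inner V (P u) u < (1 / k) * (ell2_norm V u)\<^sup>2"
    using small[of "1 / k"] by auto
  have "(ell2_norm V u)\<^sup>2 \<le> k * ell2_inner V (P u) u" using below[OF u] by (simp add: k_def)
  then show False using less \<open>0 < k\<close> by (simp add: field_simps)
qed

lemma self_adjoint_affine:
  assumes T: "self_adjoint V T"
  shows "self_adjoint V (\<lambda>u x. of_real a * u x + of_real b * T u x)"
proof -
  have B: "ell2_operator V T" using T by (simp add: self_adjoint_def)
  have "ell2_inner V (\<lambda>x. of_real a * u x + of_real b * T u x) v
      = ell2_inner V u (\<lambda>x. of_real a * v x + of_real b * T v x)"
    if u: "u \<in> ell2 V" and v: "v \<in> ell2 V" for u v
    using T u v
    by (simp add: self_adjoint_def ell2_inner_add_left ell2_inner_add_right ell2_closed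
        operator_closed[OF B] ell2_inner_scale_real_left ell2_inner_scale_real_right)
  then show ?thesis using bounded_operator_affine[OF B] by (simp add: self_adjoint_def)
qed

lemma affine_form:
  assumes "ell2_operator V T" and "u \<in> ell2 V"
  shows "ell2_inner V (\<lambda>x. of_real a * u x + of_real b * T u x) u
       = a * (ell2_norm V u)\<^sup>2 + b * ell2_inner V (T u) u"
  using assms
  by (simp add: ell2_inner_add_left ell2_closed operator_closed[OF assms(1)]
      ell2_inner_scale_real_left ell2_norm_square)

lemma shifted_form:
  assumes "ell2_operator V T" and "u \<in> ell2 V"
  shows "ell2_inner V (\<lambda>x. of_real s * (T u x - of_real a * u x)) u
       = s * (ell2_inner V (T u) u - a * (ell2_norm V u)\<^sup>2)"
  using affine_form[OF assms, of "- s * a" s] by (simp add: algebra_simps)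

text \<open>
  For \<open>b = Im z \<noteq> 0\<close> the real part of \<open>\<langle>\<i> b (T - z) u, u\<rangle>\<close> is \<open>b\<^sup>2 \<parallel>u\<parallel>\<^sup>2\<close>, because \<open>\<langle>T u, u\<rangle>\<close> is real.
\<close>

lemma self_adjoint_spectrum_real:
  assumes T: "self_adjoint V T" and z: "z \<in> ell2_spectrum V T"
  shows "z = of_real (Re z)"
proof (rule ccontr)
  define b where "b = Im z"
  assume "z \<noteq> of_real (Re z)"
  then have "b \<noteq> 0" by (auto simp: b_def complex_eq_iff)
  have B: "ell2_operator V T" using T by (simp add: self_adjoint_def)
  have "b\<^sup>2 * (ell2_norm V u)\<^sup>2 \<le> ell2_inner V (\<lambda>x. (\<i> * of_real b) * (T u x - z * u x)) u"
    if u: "u \<in> ell2 V" for u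
  proof -
    have "(\<lambda>x. (\<i> * of_real b) * (T u x - z * u x))
        = (\<lambda>x. of_real b * (\<i> * T u x) + (of_real (- b * Re z) * (\<i> * u x) + of_real (b\<^sup>2) * u x))"
    proof
      fix x
      have "z = of_real (Re z) + \<i> * of_real b" by (simp add: complex_eq_iff b_def)
      then have "(\<i> * of_real b) * (T u x - z * u x)
          = (\<i> * of_real b) * (T u x - (of_real (Re z) + \<i> * of_real b) * u x)" by simp
      then show "(\<i> * of_real b) * (T u x - z * u x)
          = of_real b * (\<i> * T u x) + (of_real (- b * Re z) * (\<i> * u x) + of_real (b\<^sup>2) * u x)"
        by (simp add: algebra_simps power2_eq_square complex_eq_iff)
    qed
    then show ?thesis
      using u
      by (simp only: ell2_inner_add_left ell2_closed operator_closed[OF B]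
          ell2_inner_scale_real_left inner_imaginary_self self_adjoint_inner_imaginary[OF T u]
          ell2_norm_square)
  qed
  then have "z \<notin> ell2_spectrum V T"
    by (intro coercive_not_in_spectrum[OF B, of "b\<^sup>2" "\<i> * of_real b"]) (use \<open>b \<noteq> 0\<close> in auto)
  then show False using z by simp
qed

text \<open>
  The top (\<open>s = 1\<close>) and the bottom (\<open>s = -1\<close>) of the spectrum are treated together: \<open>s M\<close> is the
  extremal spectral value, where \<open>M\<close> is the least upper bound of the form of \<open>s T\<close>. Beyond it
  \<open>T - z\<close> is coercive up to sign; at it, the form of \<open>M - s T\<close> is positive and degenerate.
\<close>

lemma extremal_spectral_value:
  fixes s :: real
  assumes T: "self_adjoint V T" and s: "s = 1 \<or> s = - 1"
    and nontrivial: "\<exists>u\<in>ell2 V. ell2_norm V u \<noteq> 0"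
  obtains M where "of_real (s * M) \<in> ell2_spectrum V T"
    and "\<And>z. z \<in> ell2_spectrum V T \<Longrightarrow> s * Re z \<le> M"
    and "\<And>K. (\<forall>u\<in>ell2 V. s * ell2_inner V (T u) u \<le> K * (ell2_norm V u)\<^sup>2) \<longleftrightarrow> M \<le> K"
proof -
  have B: "ell2_operator V T" using T by (simp add: self_adjoint_def)
  define Bd where "Bd = {K. \<forall>u\<in>ell2 V. s * ell2_inner V (T u) u \<le> K * (ell2_norm V u)\<^sup>2}"
  define M where "M = Inf Bd"
  obtain C where C: "\<And>u. u \<in> ell2 V \<Longrightarrow> \<bar>ell2_inner V (T u) u\<bar> \<le> C * (ell2_norm V u)\<^sup>2"
    using bounded_operator_form_bound[OF B] by blast
  have "C \<in> Bd" using C s by (force simp: Bd_def abs_le_iff)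
  then have "Bd \<noteq> {}" by blast
  have below: "s * ell2_inner V (T u) u / (ell2_norm V u)\<^sup>2 \<le> K"
    if "u \<in> ell2 V" "ell2_norm V u \<noteq> 0" "K \<in> Bd" for u K
    using that by (simp add: Bd_def divide_le_eq)
  have "bdd_below Bd"
  proof -
    obtain v where "v \<in> ell2 V" "ell2_norm V v \<noteq> 0" using nontrivial by blast
    then show ?thesis using below[of v] by (intro bdd_belowI)
  qed
  have "M \<in> Bd"
    unfolding Bd_def
  proof (intro CollectI ballI)
    fix u assume u: "u \<in> ell2 V"
    show "s * ell2_inner V (T u) u \<le> M * (ell2_norm V u)\<^sup>2"
    proof (cases "ell2_norm V u = 0")
      case True
      then show ?thesis using C[OF u] by simp
    next
      case False
      then have "s * ell2_inner V (T u) u / (ell2_norm V u)\<^sup>2 \<le> M"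
        unfolding M_def using below[OF u] by (intro cInf_greatest[OF \<open>Bd \<noteq> {}\<close>])
      then show ?thesis using False by (simp add: divide_le_eq)
    qed
  qed
  have iff: "K \<in> Bd \<longleftrightarrow> M \<le> K" for K
  proof
    show "K \<in> Bd \<Longrightarrow> M \<le> K" unfolding M_def by (rule cInf_lower[OF _ \<open>bdd_below Bd\<close>])
    assume "M \<le> K"
    then have "M * (ell2_norm V u)\<^sup>2 \<le> K * (ell2_norm V u)\<^sup>2" for u
      by (intro mult_right_mono) auto
    then show "K \<in> Bd" using \<open>M \<in> Bd\<close> by (force simp: Bd_def intro: order_trans)
  qed
  show ?thesis
  proof (rule that)
    have shift: "ell2_inner V (\<lambda>x. of_real (- s) * (T u x - of_real (s * M) * u x)) u
        = M * (ell2_norm V u)\<^sup>2 - s * ell2_inner V (T u) u" if "u \<in> ell2 V" for u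
      using s shifted_form[OF B that, of "- s" "s * M"] by auto
    show "of_real (s * M) \<in> ell2_spectrum V T"
    proof (rule degenerate_form_in_spectrum[where w = "of_real (- s)"])
      show "self_adjoint V (\<lambda>u x. of_real (- s) * (T u x - of_real (s * M) * u x))"
        using self_adjoint_affine[OF T, of "s * s * M" "- s"] by (simp add: algebra_simps)
      show "0 \<le> ell2_inner V (\<lambda>x. of_real (- s) * (T u x - of_real (s * M) * u x)) u"
        if "u \<in> ell2 V" for u
        using \<open>M \<in> Bd\<close> that by (simp only: shift) (simp add: Bd_def)
      fix e :: real assume "0 < e"
      then have "M - e \<notin> Bd" by (simp add: iff)
      then obtain u where u: "u \<in> ell2 V" "\<not> s * ell2_inner V (T u) u \<le> (M - e) * (ell2_norm V u)\<^sup>2"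
        by (auto simp: Bd_def)
      then show "\<exists>u\<in>ell2 V. ell2_inner V (\<lambda>x. of_real (- s) * (T u x - of_real (s * M) * u x)) u
          < e * (ell2_norm V u)\<^sup>2"
        by (intro bexI[OF _ u(1)], simp only: shift) (simp add: algebra_simps)
    qed (use s in auto)
    show "s * Re z \<le> M" if z: "z \<in> ell2_spectrum V T" for z
    proof (rule ccontr)
      assume greater: "\<not> s * Re z \<le> M"
      have z_eq: "z = of_real (Re z)" by (rule self_adjoint_spectrum_real[OF T z])
      have "z \<notin> ell2_spectrum V T"
      proof (rule coercive_not_in_spectrum[OF B])
        show "0 < s * Re z - M" using greater by simp
        show "of_real (- s) \<noteq> (0 :: complex)" using s by auto
        fix u assume u: "u \<in> ell2 V"
        have "ell2_inner V (\<lambda>x. of_real (- s) * (T u x - z * u x)) u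
            = s * Re z * (ell2_norm V u)\<^sup>2 - s * ell2_inner V (T u) u"
          by (subst z_eq, subst shifted_form[OF B u]) (simp add: algebra_simps)
        moreover have "s * ell2_inner V (T u) u \<le> M * (ell2_norm V u)\<^sup>2"
          using \<open>M \<in> Bd\<close> u by (simp add: Bd_def)
        ultimately show "(s * Re z - M) * (ell2_norm V u)\<^sup>2
            \<le> ell2_inner V (\<lambda>x. of_real (- s) * (T u x - z * u x)) u"
          by (simp add: algebra_simps)
      qed
      then show False using z by simp
    qed
    show "(\<forall>u\<in>ell2 V. s * ell2_inner V (T u) u \<le> K * (ell2_norm V u)\<^sup>2) \<longleftrightarrow> M \<le> K" for K
      using iff[of K] by (simp add: Bd_def)
  qed
qed

text \<open>
  The variational principle, as a characterization of the bounds of the form: it makes equalities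
  between norms and spectral bounds consequences of equivalences between upper bounds.
\<close>

context
  fixes V :: "'a set" and T
  assumes T: "self_adjoint V T" and nontrivial: "\<exists>u\<in>ell2 V. ell2_norm V u \<noteq> 0"
begin

lemma sup_spec_properties:
  shows sup_spec_in_spectrum: "of_real (sup_spec (ell2 V) (ell2_norm V) T) \<in> ell2_spectrum V T"
    and spectrum_le_sup_spec: "z \<in> ell2_spectrum V T \<Longrightarrow> Re z \<le> sup_spec (ell2 V) (ell2_norm V) T"
    and sup_spec_le_iff: "sup_spec (ell2 V) (ell2_norm V) T \<le> K \<longleftrightarrow>
      (\<forall>u\<in>ell2 V. ell2_inner V (T u) u \<le> K * (ell2_norm V u)\<^sup>2)"
proof -
  obtain M where M: "of_real (1 * M) \<in> ell2_spectrum V T"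
    "\<And>z. z \<in> ell2_spectrum V T \<Longrightarrow> 1 * Re z \<le> M"
    "\<And>K. (\<forall>u\<in>ell2 V. 1 * ell2_inner V (T u) u \<le> K * (ell2_norm V u)\<^sup>2) \<longleftrightarrow> M \<le> K"
    using extremal_spectral_value[OF T _ nontrivial, of 1] by blast
  have "sup_spec (ell2 V) (ell2_norm V) T = M"
    unfolding sup_spec_def using M(1,2) by (intro cSup_eq_maximum) (force intro: image_eqI[of _ Re "of_real M"])+
  then show "of_real (sup_spec (ell2 V) (ell2_norm V) T) \<in> ell2_spectrum V T"
    "z \<in> ell2_spectrum V T \<Longrightarrow> Re z \<le> sup_spec (ell2 V) (ell2_norm V) T"
    "sup_spec (ell2 V) (ell2_norm V) T \<le> K \<longleftrightarrow>
      (\<forall>u\<in>ell2 V. ell2_inner V (T u) u \<le> K * (ell2_norm V u)\<^sup>2)"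
    using M by simp_all
qed

lemma le_inf_spec_iff:
  "K \<le> inf_spec (ell2 V) (ell2_norm V) T \<longleftrightarrow>
     (\<forall>u\<in>ell2 V. K * (ell2_norm V u)\<^sup>2 \<le> ell2_inner V (T u) u)"
proof -
  obtain M where M: "of_real ((- 1) * M) \<in> ell2_spectrum V T"
    "\<And>z. z \<in> ell2_spectrum V T \<Longrightarrow> (- 1) * Re z \<le> M"
    "\<And>K. (\<forall>u\<in>ell2 V. (- 1) * ell2_inner V (T u) u \<le> K * (ell2_norm V u)\<^sup>2) \<longleftrightarrow> M \<le> K"
    using extremal_spectral_value[OF T _ nontrivial, of "- 1"] by blast
  have "inf_spec (ell2 V) (ell2_norm V) T = - M"
    unfolding inf_spec_def
  proof (rule cInf_eq_minimum)
    show "- M \<in> Re ` ell2_spectrum V T"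
      using M(1) by (force intro: image_eqI[of _ Re "of_real (- M)"])
  qed (use M(2) in force)
  then show ?thesis using M(3)[of "- K"] by auto
qed

end

lemma operator_norm_le_iff:
  fixes N :: "('a \<Rightarrow> complex) \<Rightarrow> real"
  assumes N: "\<And>c u. u \<in> H \<Longrightarrow> N (\<lambda>x. c * u x) = cmod c * N u"
    and zero: "(\<lambda>x. 0) \<in> H" and nontrivial: "\<exists>u\<in>H. 0 < N u" and nonneg: "\<And>u. u \<in> H \<Longrightarrow> 0 \<le> N u"
    and scale: "\<And>c u. u \<in> H \<Longrightarrow> (\<lambda>x. c * u x) \<in> H"
    and T: "bounded_operator H N T"
  shows "operator_norm H N T \<le> K \<longleftrightarrow> (\<forall>u\<in>H. N (T u) \<le> K * N u)"
proof -
  obtain C where C: "\<And>u. u \<in> H \<Longrightarrow> N (T u) \<le> C * N u"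
    using T unfolding bounded_operator_def by blast
  have T_scale: "T (\<lambda>x. c * u x) = (\<lambda>x. c * T u x)" if "u \<in> H" for c u
    using T that by (simp add: bounded_operator_def)
  have T_closed: "T u \<in> H" if "u \<in> H" for u using T that by (simp add: bounded_operator_def)
  have bdd: "bdd_above {N (T u) | u. u \<in> H \<and> N u \<le> 1}"
  proof (rule bdd_aboveI)
    fix r assume "r \<in> {N (T u) | u. u \<in> H \<and> N u \<le> 1}"
    then obtain u where u: "u \<in> H" "N u \<le> 1" "r = N (T u)" by blast
    have "C * N u \<le> \<bar>C\<bar> * N u" by (intro mult_right_mono nonneg u) simp
    also have "\<dots> \<le> \<bar>C\<bar> * 1" by (intro mult_left_mono u) simp
    finally show "r \<le> \<bar>C\<bar>" using C[OF u(1)] u(3) by simp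
  qed
  have norm0: "N (\<lambda>x. 0) = 0" using N[OF zero, of 0] by simp
  have "operator_norm H N T \<le> K \<longleftrightarrow> (\<forall>u\<in>H. N u \<le> 1 \<longrightarrow> N (T u) \<le> K)"
    unfolding operator_norm_def
    by (subst cSup_le_iff[OF _ bdd]) (use zero norm0 in \<open>force+\<close>)
  also have "\<dots> \<longleftrightarrow> (\<forall>u\<in>H. N (T u) \<le> K * N u)"
  proof (intro iffI ballI impI)
    fix u assume unit: "\<forall>u\<in>H. N u \<le> 1 \<longrightarrow> N (T u) \<le> K" and u: "u \<in> H"
    show "N (T u) \<le> K * N u"
    proof (cases "N u = 0")
      case True
      then show ?thesis using C[OF u] by simp
    next
      case False
      then have pos: "0 < N u" using nonneg[OF u] by simp
      define a where "a = complex_of_real (1 / N u)"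
      have a: "cmod a = 1 / N u" using pos by (simp add: a_def norm_divide)
      have "N (\<lambda>x. a * u x) \<le> 1" using pos by (simp add: N[OF u] a)
      then have "N (T (\<lambda>x. a * u x)) \<le> K" using unit scale[OF u, of a] by blast
      then show ?thesis using pos by (simp add: T_scale[OF u] N[OF T_closed[OF u]] a field_simps)
    qed
  next
    fix u assume bound: "\<forall>u\<in>H. N (T u) \<le> K * N u" and u: "u \<in> H" "N u \<le> 1"
    obtain v where v: "v \<in> H" "0 < N v" using nontrivial by blast
    have "0 \<le> K * N v" using bound v nonneg[OF T_closed[OF v(1)]] by force
    then have "0 \<le> K" using v by (simp add: zero_le_mult_iff)
    then have "K * N u \<le> K * 1" using u by (intro mult_left_mono)
    then show "N (T u) \<le> K" using bound u by force
  qed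
  finally show ?thesis .
qed

text \<open>
  An upper bound of \<open>P\<close> bounds the form by the Cauchy-Schwarz inequality; conversely, an upper bound
  \<open>K\<close> of the form gives \<open>\<parallel>P u\<parallel>\<^sup>2 \<le> K \<langle>P u, u\<rangle> \<le> K\<^sup>2 \<parallel>u\<parallel>\<^sup>2\<close>.
\<close>

lemma positive_norm_le_iff:
  assumes P: "self_adjoint V P" and pos: "\<And>u. u \<in> ell2 V \<Longrightarrow> 0 \<le> ell2_inner V (P u) u"
    and nontrivial: "\<exists>u\<in>ell2 V. ell2_norm V u \<noteq> 0"
  shows "operator_norm (ell2 V) (ell2_norm V) P \<le> K \<longleftrightarrow>
    (\<forall>u\<in>ell2 V. ell2_inner V (P u) u \<le> K * (ell2_norm V u)\<^sup>2)"
proof -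
  have B: "ell2_operator V P" using P by (simp add: self_adjoint_def)
  obtain v where v: "v \<in> ell2 V" "0 < ell2_norm V v"
    using nontrivial ell2_norm_nonneg by (metis less_eq_real_def)
  have "(\<forall>u\<in>ell2 V. ell2_norm V (P u) \<le> K * ell2_norm V u) \<longleftrightarrow>
      (\<forall>u\<in>ell2 V. ell2_inner V (P u) u \<le> K * (ell2_norm V u)\<^sup>2)"
  proof (intro iffI ballI)
    fix u assume K: "\<forall>u\<in>ell2 V. ell2_norm V (P u) \<le> K * ell2_norm V u" and u: "u \<in> ell2 V"
    have "ell2_inner V (P u) u \<le> ell2_norm V (P u) * ell2_norm V u"
      using ell2_Cauchy_Schwarz[OF operator_closed[OF B u] u] by linarith
    also have "\<dots> \<le> K * ell2_norm V u * ell2_norm V u"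
      using K u by (intro mult_right_mono ell2_norm_nonneg) auto
    finally show "ell2_inner V (P u) u \<le> K * (ell2_norm V u)\<^sup>2" by (simp add: power2_eq_square)
  next
    fix u assume K: "\<forall>u\<in>ell2 V. ell2_inner V (P u) u \<le> K * (ell2_norm V u)\<^sup>2" and u: "u \<in> ell2 V"
    have "0 \<le> K * (ell2_norm V v)\<^sup>2" using K v pos[OF v(1)] by force
    then have "0 \<le> K" using v by (simp add: zero_le_mult_iff)
    have "(ell2_norm V (P u))\<^sup>2 \<le> K * ell2_inner V (P u) u"
      using K by (intro positive_operator_bound[OF P pos _ u]) auto
    also have "\<dots> \<le> K * (K * (ell2_norm V u)\<^sup>2)" using K u \<open>0 \<le> K\<close> by (intro mult_left_mono) auto
    also have "\<dots> = (K * ell2_norm V u)\<^sup>2" by (simp add: power2_eq_square)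
    finally show "ell2_norm V (P u) \<le> K * ell2_norm V u"
      by (rule power2_le_imp_le) (simp add: \<open>0 \<le> K\<close> ell2_norm_nonneg)
  qed
  moreover have "operator_norm (ell2 V) (ell2_norm V) P \<le> K \<longleftrightarrow>
      (\<forall>u\<in>ell2 V. ell2_norm V (P u) \<le> K * ell2_norm V u)"
    using v by (intro operator_norm_le_iff B ell2_norm_scale ell2_closed ell2_norm_nonneg) auto
  ultimately show ?thesis by simp
qed

section \<open>Sums over oriented and unoriented edges\<close>

locale regular_nonempty_graph =
  fixes V :: "'v set" and E :: "('v \<times> 'v) set" and d :: nat
  assumes simple: "simple_graph V E" and nonempty: "V \<noteq> {}"
    and locally_finite: "locally_finite V E" and regular: "regular_graph V E d"
    and degree_pos: "0 < d"
begin

lemma edge_vertices: "(x, y) \<in> E \<Longrightarrow> x \<in> V" "(x, y) \<in> E \<Longrightarrow> y \<in> V"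
  using simple by (auto simp: simple_graph_def)

lemma edge_sym: "(x, y) \<in> E \<Longrightarrow> (y, x) \<in> E"
  using simple by (auto simp: simple_graph_def dest: symD)

lemma no_loop: "(x, x) \<notin> E"
  using simple by (auto simp: simple_graph_def irrefl_def)

lemma neighbours_outside: "x \<notin> V \<Longrightarrow> E `` {x} = {}"
  using edge_vertices by blast

lemma finite_neighbours: "finite (E `` {x})"
  using locally_finite neighbours_outside[of x] by (cases "x \<in> V") (auto simp: locally_finite_def)

lemma card_neighbours: "x \<in> V \<Longrightarrow> card (E `` {x}) = d"
  using regular by (simp add: regular_graph_def)

lemma edges_Sigma: "E = Sigma V (\<lambda>x. E `` {x})"
  using edge_vertices by auto

lemma flip_summable: "h summable_on E \<longleftrightarrow> (\<lambda>(x, y). h (y, x)) summable_on E"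
  by (rule summable_on_reindex_bij_witness[of _ prod.swap prod.swap]) (auto dest: edge_sym)

lemma flip_infsum: "infsum h E = (\<Sum>\<^sub>\<infinity>(x, y)\<in>E. h (y, x))"
  by (rule infsum_reindex_bij_witness[of _ prod.swap prod.swap]) (auto dest: edge_sym)

lemma infsum_by_tail:
  fixes h :: "'v \<times> 'v \<Rightarrow> real"
  assumes "h summable_on E"
  shows "infsum h E = (\<Sum>\<^sub>\<infinity>x\<in>V. \<Sum>y\<in>E `` {x}. h (x, y))"
    and "(\<lambda>x. \<Sum>y\<in>E `` {x}. h (x, y)) summable_on V"
proof -
  have "h summable_on Sigma V (\<lambda>x. E `` {x})" using assms edges_Sigma by simp
  then have "(\<Sum>\<^sub>\<infinity>x\<in>V. \<Sum>\<^sub>\<infinity>y\<in>E `` {x}. h (x, y)) = infsum h (Sigma V (\<lambda>x. E `` {x}))"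
    "(\<lambda>x. \<Sum>\<^sub>\<infinity>y\<in>E `` {x}. h (x, y)) summable_on V"
    using summable_on_Sigma_banach[of "\<lambda>x y. h (x, y)" V "\<lambda>x. E `` {x}"]
    by (simp_all add: infsum_Sigma_banach[of h])
  then show "infsum h E = (\<Sum>\<^sub>\<infinity>x\<in>V. \<Sum>y\<in>E `` {x}. h (x, y))"
    "(\<lambda>x. \<Sum>y\<in>E `` {x}. h (x, y)) summable_on V"
    using edges_Sigma by (simp_all add: finite_neighbours)
qed

lemma tail_has_sum:
  fixes h :: "'v \<Rightarrow> real"
  assumes "h summable_on V" and "\<And>x. x \<in> V \<Longrightarrow> 0 \<le> h x"
  shows "((\<lambda>(x, y). h x) has_sum (real d * infsum h V)) E"
proof -
  have inner: "((\<lambda>y. (\<lambda>(x, y). h x) (x, y)) has_sum real d * h x) (E `` {x})" if "x \<in> V" for x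
    using that by (intro has_sum_finiteI finite_neighbours) (simp add: card_neighbours)
  have outer: "((\<lambda>x. real d * h x) has_sum real d * infsum h V) V"
    by (intro has_sum_cmult_right has_sum_infsum assms)
  have "(\<lambda>(x, y). h x) summable_on Sigma V (\<lambda>x. E `` {x})"
    by (rule summable_on_SigmaI[OF inner]) (use outer assms in \<open>auto simp: has_sum_imp_summable\<close>)
  then have "((\<lambda>(x, y). h x) has_sum real d * infsum h V) (Sigma V (\<lambda>x. E `` {x}))"
    by (intro has_sum_SigmaI[OF _ outer] inner)
  then show ?thesis using edges_Sigma by simp
qed


lemma edge_value_eq:
  assumes "\<And>x y. (x, y) \<in> E \<Longrightarrow> h y x = h x y" and "(x, y) \<in> E"
  shows "edge_value h {x, y} = h x y"
  unfolding edge_value_def using assms by (intro the_equality) (auto simp: doubleton_eq_iff)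

text \<open>
  Choosing one orientation of every edge splits \<open>E\<close> into two copies of \<open>edges E\<close>, exchanged by the
  flip. So a sum over unoriented edges is half of the sum over oriented ones.
\<close>

lemma edge_value_has_sum:
  fixes h :: "'v \<Rightarrow> 'v \<Rightarrow> real"
  assumes sym: "\<And>x y. (x, y) \<in> E \<Longrightarrow> h y x = h x y"
  shows edge_value_summable_iff: "edge_value h summable_on edges E \<longleftrightarrow> (\<lambda>(x, y). h x y) summable_on E"
    and edge_value_infsum: "(\<lambda>(x, y). h x y) summable_on E \<Longrightarrow>
      (\<Sum>\<^sub>\<infinity>e\<in>edges E. edge_value h e) = (\<Sum>\<^sub>\<infinity>(x, y)\<in>E. h x y) / 2"
proof -
  have "\<forall>e\<in>edges E. \<exists>p. p \<in> E \<and> e = {fst p, snd p}"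
  proof
    fix e assume "e \<in> edges E"
    then obtain x y where "e = {x, y}" "(x, y) \<in> E" unfolding edges_def by blast
    then show "\<exists>p. p \<in> E \<and> e = {fst p, snd p}" by (intro exI[of _ "(x, y)"]) simp
  qed
  from bchoice[OF this] obtain orient
    where "\<forall>e\<in>edges E. orient e \<in> E \<and> e = {fst (orient e), snd (orient e)}" ..
  then have orient: "\<And>e. e \<in> edges E \<Longrightarrow> orient e \<in> E"
    "\<And>e. e \<in> edges E \<Longrightarrow> e = {fst (orient e), snd (orient e)}"
    by blast+
  define E1 where "E1 = orient ` edges E"
  define E2 where "E2 = prod.swap ` E1"
  have bij: "bij_betw orient (edges E) E1"
    unfolding E1_def
  proof (rule inj_on_imp_bij_betw, rule inj_onI)
    fix e f assume "e \<in> edges E" "f \<in> edges E" "orient e = orient f"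
    then show "e = f" using orient(2)[of e] orient(2)[of f] by argo
  qed
  have "E1 \<subseteq> E" using orient by (auto simp: E1_def)
  then have "E2 \<subseteq> E" by (auto simp: E2_def intro: edge_sym)
  have disjoint: "E1 \<inter> E2 = {}"
  proof (rule ccontr)
    assume "E1 \<inter> E2 \<noteq> {}"
    then obtain p where p: "p \<in> E1" "p \<in> E2" by blast
    obtain e where e: "e \<in> edges E" "p = orient e" using \<open>p \<in> E1\<close> unfolding E1_def by (elim imageE)
    obtain q where q: "q \<in> E1" "p = prod.swap q" using \<open>p \<in> E2\<close> unfolding E2_def by (elim imageE)
    obtain f where f: "f \<in> edges E" "q = orient f" using \<open>q \<in> E1\<close> unfolding E1_def by (elim imageE)
    have ef: "e \<in> edges E" "f \<in> edges E" "orient e = prod.swap (orient f)"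
      by (fact e(1), fact f(1), fold e(2) f(2), fact q(2))
    have "e = {snd (orient f), fst (orient f)}" using orient(2)[OF ef(1)] unfolding ef(3) by simp
    also have "\<dots> = f" using orient(2)[OF ef(2), symmetric] by (subst insert_commute)
    finally have "e = f" .
    obtain a b where ab: "orient f = (a, b)" by (cases "orient f")
    have "(a, b) = prod.swap (a, b)" using ef(3) unfolding \<open>e = f\<close> ab .
    then have "fst (a, b) = fst (prod.swap (a, b))" by (rule arg_cong)
    then have "a = b" by (simp only: fst_conv swap_simp snd_conv)
    moreover have "(a, b) \<in> E" using orient(1)[OF ef(2)] unfolding ab .
    ultimately show False using no_loop[of b] by blast
  qed
  have union: "E1 \<union> E2 = E"
  proof
    show "E \<subseteq> E1 \<union> E2"
    proof
      fix p assume "p \<in> E"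
      obtain x y where p: "p = (x, y)" by (cases p)
      then have e: "{x, y} \<in> edges E" using \<open>p \<in> E\<close> by (auto simp: edges_def)
      obtain a b where ab: "orient {x, y} = (a, b)" by (cases "orient {x, y}")
      then have "{x, y} = {a, b}" using orient(2)[OF e] by simp
      then have "orient {x, y} = (x, y) \<or> orient {x, y} = (y, x)"
        unfolding ab by (auto simp: doubleton_eq_iff)
      then have "p = orient {x, y} \<or> p = prod.swap (orient {x, y})" using p by auto
      then show "p \<in> E1 \<union> E2" using e by (auto simp: E1_def E2_def)
    qed
  qed (use \<open>E1 \<subseteq> E\<close> \<open>E2 \<subseteq> E\<close> in simp)
  let ?h = "\<lambda>(x, y). h x y"
  have val: "edge_value h e = ?h (orient e)" if "e \<in> edges E" for e
  proof -
    obtain a b where ab: "orient e = (a, b)" by (cases "orient e")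
    then have "e = {a, b}" "(a, b) \<in> E" using orient[OF that] by simp_all
    then show ?thesis using edge_value_eq[of h a b] sym ab by simp
  qed
  have S1: "edge_value h summable_on edges E \<longleftrightarrow> ?h summable_on E1"
    by (subst summable_on_reindex_bij_betw[OF bij, of ?h, symmetric])
       (rule summable_on_cong, simp add: val)
  have I1: "infsum (edge_value h) (edges E) = infsum ?h E1"
    by (subst infsum_reindex_bij_betw[OF bij, of ?h, symmetric]) (rule infsum_cong, simp add: val)
  have swap: "?h (prod.swap p) = ?h p" if "p \<in> E1" for p
    using that \<open>E1 \<subseteq> E\<close> sym by (cases p) auto
  have bij2: "bij_betw prod.swap E1 E2" unfolding E2_def by (rule inj_on_imp_bij_betw) simp
  have S2: "?h summable_on E2 \<longleftrightarrow> ?h summable_on E1"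
    by (subst summable_on_reindex_bij_betw[OF bij2, of ?h, symmetric])
       (rule summable_on_cong, erule swap)
  have I2: "infsum ?h E2 = infsum ?h E1"
    by (subst infsum_reindex_bij_betw[OF bij2, of ?h, symmetric]) (rule infsum_cong, erule swap)
  show iff: "edge_value h summable_on edges E \<longleftrightarrow> ?h summable_on E"
  proof
    assume "edge_value h summable_on edges E"
    then have "?h summable_on E1" "?h summable_on E2" using S1 S2 by auto
    then show "?h summable_on E" using summable_on_Un_disjoint[OF _ _ disjoint] union by metis
  next
    assume "?h summable_on E"
    then have "?h summable_on E1" using \<open>E1 \<subseteq> E\<close> by (rule summable_on_subset)
    then show "edge_value h summable_on edges E" using S1 by simp
  qed
  show "(\<Sum>\<^sub>\<infinity>e\<in>edges E. edge_value h e) = infsum ?h E / 2" if "?h summable_on E"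
  proof -
    have "?h summable_on E1" "?h summable_on E2"
      using that \<open>E1 \<subseteq> E\<close> \<open>E2 \<subseteq> E\<close> by (blast intro: summable_on_subset)+
    then have "infsum ?h (E1 \<union> E2) = infsum ?h E1 + infsum ?h E2"
      using disjoint by (rule infsum_Un_disjoint)
    then show ?thesis using I1 I2 union by simp
  qed
qed


section \<open>Coboundary, codifferential and adjacency operator\<close>

text \<open>
  Every operator of the graph is built from the codifferential and from the two ways to pull a
  function on the vertices back to the oriented edges.
\<close>

definition tail_lift :: "('v \<Rightarrow> complex) \<Rightarrow> ('v \<times> 'v \<Rightarrow> complex)" where
  "tail_lift u = (\<lambda>(x, y). if (x, y) \<in> E then u x else 0)"

definition head_lift :: "('v \<Rightarrow> complex) \<Rightarrow> ('v \<times> 'v \<Rightarrow> complex)" where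
  "head_lift u = (\<lambda>(x, y). if (x, y) \<in> E then u y else 0)"

lemma tail_lift_ell2:
  assumes "u \<in> ell2 V"
  shows "tail_lift u \<in> ell2 E" and "(ell2_norm E (tail_lift u))\<^sup>2 = real d * (ell2_norm V u)\<^sup>2"
proof -
  have "((\<lambda>(x, y). (cmod (u x))\<^sup>2) has_sum (real d * (ell2_norm V u)\<^sup>2)) E"
    using tail_has_sum[of "\<lambda>x. (cmod (u x))\<^sup>2"] assms
    by (simp add: ell2_summable ell2_norm_square_infsum)
  then have sum: "((\<lambda>p. (cmod (tail_lift u p))\<^sup>2) has_sum (real d * (ell2_norm V u)\<^sup>2)) E"
    by (rule has_sum_cong[THEN iffD1, rotated]) (auto simp: tail_lift_def)
  then show "tail_lift u \<in> ell2 E"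
    by (intro ell2I) (auto simp: tail_lift_def has_sum_imp_summable)
  show "(ell2_norm E (tail_lift u))\<^sup>2 = real d * (ell2_norm V u)\<^sup>2"
    using sum by (simp add: ell2_norm_square_infsum infsumI)
qed

lemma flip_ell2:
  assumes "f \<in> ell2 E"
  shows "(\<lambda>(x, y). f (y, x)) \<in> ell2 E"
proof (rule ell2I)
  have "(\<lambda>(x, y). (\<lambda>p. (cmod (f p))\<^sup>2) (y, x)) summable_on E"
    using ell2_summable[OF assms] flip_summable[of "\<lambda>p. (cmod (f p))\<^sup>2"] by simp
  then show "(\<lambda>p. (cmod (case p of (x, y) \<Rightarrow> f (y, x)))\<^sup>2) summable_on E"
    by (simp add: case_prod_unfold)
qed (use edge_sym ell2_outside[OF assms] in auto)

lemma flip_inner: "ell2_inner E f g = ell2_inner E (\<lambda>(x, y). f (y, x)) (\<lambda>(x, y). g (y, x))"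
  unfolding ell2_inner_def by (subst flip_infsum) (simp add: case_prod_unfold)

lemma head_lift_flip: "head_lift u = (\<lambda>(x, y). tail_lift u (y, x))"
  using edge_sym by (auto simp: head_lift_def tail_lift_def fun_eq_iff)

lemma tail_lift_flip: "tail_lift u = (\<lambda>(x, y). head_lift u (y, x))"
  using edge_sym by (auto simp: head_lift_def tail_lift_def fun_eq_iff)

lemma head_lift_ell2:
  assumes "u \<in> ell2 V"
  shows "head_lift u \<in> ell2 E" and "(ell2_norm E (head_lift u))\<^sup>2 = real d * (ell2_norm V u)\<^sup>2"
  unfolding head_lift_flip using tail_lift_ell2[OF assms] flip_inner[of "tail_lift u" "tail_lift u"]
  by (auto simp: ell2_norm_square intro: flip_ell2)

lemma codifferential_ell2:
  assumes f: "f \<in> ell2 E"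
  shows "codifferential E f \<in> ell2 V"
    and "ell2_norm V (codifferential E f) \<le> sqrt (real d) * ell2_norm E f"
proof -
  have flip: "(\<lambda>(x, y). (cmod (f (y, x)))\<^sup>2) summable_on E"
    using ell2_summable[OF f] flip_summable[of "\<lambda>p. (cmod (f p))\<^sup>2"] by simp
  have total: "(\<Sum>\<^sub>\<infinity>x\<in>V. \<Sum>y\<in>E `` {x}. (cmod (f (y, x)))\<^sup>2) = (ell2_norm E f)\<^sup>2"
    using infsum_by_tail(1)[OF flip] flip_infsum[of "\<lambda>p. (cmod (f p))\<^sup>2"]
    by (simp add: ell2_norm_square_infsum)
  have tail_summable: "(\<lambda>x. \<Sum>y\<in>E `` {x}. (cmod (f (y, x)))\<^sup>2) summable_on V"
    using infsum_by_tail(2)[OF flip] by simp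
  then have dominating: "(\<lambda>x. real d * (\<Sum>y\<in>E `` {x}. (cmod (f (y, x)))\<^sup>2)) summable_on V"
    by (rule summable_on_cmult_right)
  have pointwise: "(cmod (codifferential E f x))\<^sup>2 \<le> real d * (\<Sum>y\<in>E `` {x}. (cmod (f (y, x)))\<^sup>2)"
    if "x \<in> V" for x
  proof -
    have "(cmod (codifferential E f x))\<^sup>2 \<le> (\<Sum>y\<in>E `` {x}. cmod (f (y, x)))\<^sup>2"
      unfolding codifferential_def by (intro power_mono norm_sum norm_ge_zero)
    also have "\<dots> \<le> (\<Sum>y\<in>E `` {x}. (cmod (f (y, x)))\<^sup>2) * real (card (E `` {x}))"
      by (rule sum_squared_le_sum_of_squares)
    finally show ?thesis using card_neighbours[OF that] by (simp add: mult.commute)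
  qed
  show ell2: "codifferential E f \<in> ell2 V"
  proof (rule ell2I)
    show "codifferential E f x = 0" if "x \<notin> V" for x
      by (simp add: codifferential_def neighbours_outside[OF that])
    show "(\<lambda>x. (cmod (codifferential E f x))\<^sup>2) summable_on V"
      by (rule summable_on_comparison_test[OF dominating]) (auto simp: pointwise)
  qed
  have "(ell2_norm V (codifferential E f))\<^sup>2
      \<le> (\<Sum>\<^sub>\<infinity>x\<in>V. real d * (\<Sum>y\<in>E `` {x}. (cmod (f (y, x)))\<^sup>2))"
    unfolding ell2_norm_square_infsum by (intro infsum_mono ell2_summable ell2 dominating pointwise)
  also have "\<dots> = real d * (ell2_norm E f)\<^sup>2"
    by (simp add: infsum_cmult_right' total)
  also have "\<dots> = (sqrt (real d) * ell2_norm E f)\<^sup>2" by (simp add: power_mult_distrib)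
  finally show "ell2_norm V (codifferential E f) \<le> sqrt (real d) * ell2_norm E f"
    by (rule power2_le_imp_le) (simp add: ell2_norm_nonneg)
qed

text \<open>
  Summed edge by edge, the left-hand side pairs the value of \<open>f\<close> on an oriented edge with the value
  of \<open>v\<close> at its head.
\<close>

lemma codifferential_adjoint:
  assumes f: "f \<in> ell2 E" and v: "v \<in> ell2 V"
  shows "ell2_inner V (codifferential E f) v = ell2_inner E f (head_lift v)"
proof -
  have sum: "(\<lambda>p. (\<lambda>(x, y). f (y, x)) p \<bullet> tail_lift v p) summable_on E"
    by (intro inner_summable flip_ell2 f tail_lift_ell2 v)
  have "ell2_inner E f (head_lift v) = ell2_inner E (\<lambda>(x, y). f (y, x)) (\<lambda>(x, y). head_lift v (y, x))"
    by (rule flip_inner)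
  also have "\<dots> = infsum (\<lambda>p. (\<lambda>(x, y). f (y, x)) p \<bullet> tail_lift v p) E"
    unfolding ell2_inner_def tail_lift_flip[of v] ..
  also have "\<dots> = (\<Sum>\<^sub>\<infinity>x\<in>V. \<Sum>y\<in>E `` {x}. f (y, x) \<bullet> v x)"
    by (subst infsum_by_tail(1)[OF sum]) (simp add: tail_lift_def)
  also have "\<dots> = ell2_inner V (codifferential E f) v"
    by (simp add: ell2_inner_def codifferential_def inner_sum_left)
  finally show ?thesis by (rule sym)
qed

lemma adjacency_eq: "adjacency_op E u = codifferential E (tail_lift u)"
  unfolding adjacency_op_def codifferential_def
  by (intro ext sum.cong refl) (auto simp: tail_lift_def dest: edge_sym)

lemma adjacency_inner:
  assumes "u \<in> ell2 V" and "v \<in> ell2 V"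
  shows "ell2_inner V (adjacency_op E u) v = ell2_inner E (tail_lift u) (head_lift v)"
  using codifferential_adjoint[OF tail_lift_ell2(1)[OF assms(1)] assms(2)] by (simp add: adjacency_eq)

lemma adjacency_self_adjoint: "self_adjoint V (adjacency_op E)"
proof -
  have "ell2_norm V (adjacency_op E u) \<le> real d * ell2_norm V u" if u: "u \<in> ell2 V" for u
  proof -
    have "ell2_norm E (tail_lift u) = sqrt (real d) * ell2_norm V u"
      by (rule power2_eq_imp_eq)
         (simp_all add: power_mult_distrib tail_lift_ell2(2)[OF u] ell2_norm_nonneg)
    then show ?thesis
      using codifferential_ell2(2)[OF tail_lift_ell2(1)[OF u]]
      by (simp add: adjacency_eq flip: mult.assoc)
  qed
  then have "\<exists>C. \<forall>u\<in>ell2 V. ell2_norm V (adjacency_op E u) \<le> C * ell2_norm V u" by blast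
  then have "ell2_operator V (adjacency_op E)"
    unfolding bounded_operator_def
  proof (intro conjI ballI allI)
    show "adjacency_op E u \<in> ell2 V" if "u \<in> ell2 V" for u
      unfolding adjacency_eq by (intro codifferential_ell2 tail_lift_ell2 that)
  qed (simp_all add: adjacency_op_def sum.distrib sum_distrib_left)
  moreover have "ell2_inner V (adjacency_op E u) v = ell2_inner V u (adjacency_op E v)"
    if "u \<in> ell2 V" "v \<in> ell2 V" for u v
  proof -
    have "ell2_inner E (tail_lift u) (head_lift v) = ell2_inner E (head_lift u) (tail_lift v)"
      by (subst flip_inner) (simp flip: tail_lift_flip head_lift_flip)
    also have "\<dots> = ell2_inner E (tail_lift v) (head_lift u)" by (rule ell2_inner_commute)
    finally show ?thesis
      using that by (simp add: adjacency_inner ell2_inner_commute[of V u])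
  qed
  ultimately show ?thesis by (simp add: self_adjoint_def)
qed

lemma vertex_laplacian_affine:
  "vertex_laplacian E d = (\<lambda>u x. of_real (real d) * u x + of_real (- 1) * adjacency_op E u x)"
  by (simp add: vertex_laplacian_def fun_eq_iff)

lemma signless_laplacian_affine:
  "signless_laplacian E d = (\<lambda>u x. of_real (real d) * u x + of_real 1 * adjacency_op E u x)"
  by (simp add: signless_laplacian_def fun_eq_iff)

lemma vertex_laplacian_self_adjoint: "self_adjoint V (vertex_laplacian E d)"
  unfolding vertex_laplacian_affine by (rule self_adjoint_affine[OF adjacency_self_adjoint])

lemma signless_laplacian_self_adjoint: "self_adjoint V (signless_laplacian E d)"
  unfolding signless_laplacian_affine by (rule self_adjoint_affine[OF adjacency_self_adjoint])

lemma laplacian_forms: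
  assumes "u \<in> ell2 V"
  shows vertex_laplacian_form: "ell2_inner V (vertex_laplacian E d u) u
      = real d * (ell2_norm V u)\<^sup>2 - ell2_inner V (adjacency_op E u) u"
    and signless_laplacian_form: "ell2_inner V (signless_laplacian E d u) u
      = real d * (ell2_norm V u)\<^sup>2 + ell2_inner V (adjacency_op E u) u"
proof -
  have "ell2_operator V (adjacency_op E)"
    using adjacency_self_adjoint by (simp add: self_adjoint_def)
  note form = affine_form[OF this assms, of "real d"]
  show "ell2_inner V (vertex_laplacian E d u) u
      = real d * (ell2_norm V u)\<^sup>2 - ell2_inner V (adjacency_op E u) u"
    using form[of "- 1"] by (simp add: vertex_laplacian_affine)
  show "ell2_inner V (signless_laplacian E d u) u
      = real d * (ell2_norm V u)\<^sup>2 + ell2_inner V (adjacency_op E u) u"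
    using form[of 1] by (simp add: signless_laplacian_affine)
qed

text \<open>
  In the expansion of \<open>\<bar>u x \<plusminus> u y\<bar>\<^sup>2\<close> the tails and the heads contribute \<open>d \<parallel>u\<parallel>\<^sup>2\<close> each, and the mixed
  terms twice the form of the adjacency operator.
\<close>

lemma edge_square_sums:
  assumes u: "u \<in> ell2 V"
  shows edge_plus_has_sum: "((\<lambda>(x, y). (cmod (u x + u y))\<^sup>2) has_sum
      2 * (real d * (ell2_norm V u)\<^sup>2 + ell2_inner V (adjacency_op E u) u)) E"
    and edge_minus_has_sum: "((\<lambda>(x, y). (cmod (u x - u y))\<^sup>2) has_sum
      2 * (real d * (ell2_norm V u)\<^sup>2 - ell2_inner V (adjacency_op E u) u)) E"
proof -
  note lifts = tail_lift_ell2[OF u] head_lift_ell2[OF u]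
  have has_sum_norm: "((\<lambda>p. (cmod (f p))\<^sup>2) has_sum (ell2_norm E f)\<^sup>2) E" if "f \<in> ell2 E" for f
    using ell2_summable[OF that] by (simp add: ell2_norm_square_infsum)
  have plus: "(ell2_norm E (\<lambda>p. tail_lift u p + head_lift u p))\<^sup>2
      = 2 * (real d * (ell2_norm V u)\<^sup>2 + ell2_inner V (adjacency_op E u) u)"
    using lifts by (simp add: ell2_norm_square ell2_inner_add_left ell2_inner_add_right ell2_closed
        adjacency_inner u ell2_inner_commute[of E "head_lift u" "tail_lift u"])
  have minus: "(ell2_norm E (\<lambda>p. tail_lift u p - head_lift u p))\<^sup>2
      = 2 * (real d * (ell2_norm V u)\<^sup>2 - ell2_inner V (adjacency_op E u) u)"
    using lifts by (simp add: ell2_norm_square ell2_inner_diff_left ell2_inner_diff_right ell2_closed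
        adjacency_inner u ell2_inner_commute[of E "head_lift u" "tail_lift u"])
  show "((\<lambda>(x, y). (cmod (u x + u y))\<^sup>2) has_sum
      2 * (real d * (ell2_norm V u)\<^sup>2 + ell2_inner V (adjacency_op E u) u)) E"
    using has_sum_norm[OF ell2_add[OF lifts(1,3)], unfolded plus]
    by (rule has_sum_cong[THEN iffD1, rotated]) (auto simp: tail_lift_def head_lift_def)
  show "((\<lambda>(x, y). (cmod (u x - u y))\<^sup>2) has_sum
      2 * (real d * (ell2_norm V u)\<^sup>2 - ell2_inner V (adjacency_op E u) u)) E"
    using has_sum_norm[OF ell2_diff[OF lifts(1,3)], unfolded minus]
    by (rule has_sum_cong[THEN iffD1, rotated]) (auto simp: tail_lift_def head_lift_def)
qed

lemma adjacency_form_bounds: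
  assumes "u \<in> ell2 V"
  shows "ell2_inner V (adjacency_op E u) u \<le> real d * (ell2_norm V u)\<^sup>2"
    and "- real d * (ell2_norm V u)\<^sup>2 \<le> ell2_inner V (adjacency_op E u) u"
proof -
  have "0 \<le> 2 * (real d * (ell2_norm V u)\<^sup>2 - ell2_inner V (adjacency_op E u) u)"
    by (rule has_sum_nonneg[OF edge_minus_has_sum[OF assms]]) auto
  then show "ell2_inner V (adjacency_op E u) u \<le> real d * (ell2_norm V u)\<^sup>2" by simp
  have "0 \<le> 2 * (real d * (ell2_norm V u)\<^sup>2 + ell2_inner V (adjacency_op E u) u)"
    by (rule has_sum_nonneg[OF edge_plus_has_sum[OF assms]]) auto
  then show "- real d * (ell2_norm V u)\<^sup>2 \<le> ell2_inner V (adjacency_op E u) u" by simp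
qed

lemma signless_energy:
  assumes "u \<in> ell2 V"
  shows "(\<Sum>\<^sub>\<infinity>e\<in>edges E. edge_value (\<lambda>x y. (cmod (u x + u y))\<^sup>2) e)
       = ell2_inner V (signless_laplacian E d u) u"
proof -
  have "(\<Sum>\<^sub>\<infinity>e\<in>edges E. edge_value (\<lambda>x y. (cmod (u x + u y))\<^sup>2) e)
      = (\<Sum>\<^sub>\<infinity>(x, y)\<in>E. (cmod (u x + u y))\<^sup>2) / 2"
    by (rule edge_value_infsum)
       (use edge_plus_has_sum[OF assms] in \<open>auto simp: add.commute has_sum_imp_summable\<close>)
  then show ?thesis
    using edge_plus_has_sum[OF assms] by (simp add: infsumI signless_laplacian_form assms)
qed


section \<open>The edge Laplacian has the norm of the vertex Laplacian\<close>

text \<open>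
  Cochains are the antisymmetric elements of the \<open>l\<^sup>2\<close> space of oriented edges. As each edge has two
  orientations, their norm is the one of that space divided by \<open>\<surd>2\<close>.
\<close>

lemma cochain_iff:
  "f \<in> cochains E \<longleftrightarrow> f \<in> ell2 E \<and> (\<forall>x y. (x, y) \<in> E \<longrightarrow> f (y, x) = - f (x, y))"
proof -
  have "edge_value (\<lambda>x y. (cmod (f (x, y)))\<^sup>2) summable_on edges E \<longleftrightarrow>
      (\<lambda>p. (cmod (f p))\<^sup>2) summable_on E" if "\<And>x y. (x, y) \<in> E \<Longrightarrow> f (y, x) = - f (x, y)"
    using edge_value_summable_iff[of "\<lambda>x y. (cmod (f (x, y)))\<^sup>2"] that
    by (simp add: cond_case_prod_eta[of _ "\<lambda>p. (cmod (f p))\<^sup>2"])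
  then show ?thesis by (auto simp: cochains_def ell2_def)
qed

lemma cochain_norm_eq:
  assumes "f \<in> cochains E"
  shows "cochain_norm E f = ell2_norm E f / sqrt 2"
proof -
  have "(\<lambda>p. (cmod (f p))\<^sup>2) summable_on E" using assms by (simp add: cochain_iff ell2_summable)
  then show ?thesis
    using edge_value_infsum[of "\<lambda>x y. (cmod (f (x, y)))\<^sup>2"] assms
    by (simp add: cochain_norm_def cochain_iff ell2_norm_def
        cond_case_prod_eta[of _ "\<lambda>p. (cmod (f p))\<^sup>2"] flip: real_sqrt_divide)
qed

lemma coboundary_eq: "coboundary E u = (\<lambda>p. head_lift u p - tail_lift u p)"
  by (auto simp: coboundary_def head_lift_def tail_lift_def)

lemma coboundary_cochain:
  assumes "u \<in> ell2 V"
  shows "coboundary E u \<in> cochains E"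
proof -
  have "coboundary E u \<in> ell2 E"
    unfolding coboundary_eq by (intro ell2_closed head_lift_ell2 tail_lift_ell2 assms)
  then show ?thesis by (auto simp: cochain_iff coboundary_def dest: edge_sym)
qed

text \<open>
  Antisymmetry makes the tails contribute as much as the heads; the resulting factor 2 cancels against
  the normalization of the cochain norm.
\<close>

lemma coboundary_adjoint:
  assumes u: "u \<in> ell2 V" and f: "f \<in> cochains E"
  shows "ell2_inner E (coboundary E u) f = 2 * ell2_inner V u (codifferential E f)"
proof -
  have f2: "f \<in> ell2 E" and antisym: "\<And>x y. (x, y) \<in> E \<Longrightarrow> f (y, x) = - f (x, y)"
    using f by (auto simp: cochain_iff)
  have "ell2_inner E (tail_lift u) f = ell2_inner E (head_lift u) (\<lambda>(x, y). f (y, x))"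
    by (subst flip_inner) (simp flip: head_lift_flip)
  also have "\<dots> = (\<Sum>\<^sub>\<infinity>p\<in>E. - (head_lift u p \<bullet> f p))"
    unfolding ell2_inner_def by (rule infsum_cong) (auto simp: antisym)
  also have "\<dots> = - ell2_inner E (head_lift u) f" by (simp add: ell2_inner_def infsum_uminus)
  finally have "ell2_inner E (coboundary E u) f = 2 * ell2_inner E (head_lift u) f"
    using u f2 by (simp add: coboundary_eq ell2_inner_diff_left head_lift_ell2 tail_lift_ell2)
  then show ?thesis
    using codifferential_adjoint[OF f2 u] by (simp add: ell2_inner_commute)
qed

lemma codifferential_coboundary:
  assumes "u \<in> ell2 V"
  shows "codifferential E (coboundary E u) = vertex_laplacian E d u"
proof
  fix x
  have "codifferential E (coboundary E u) x = (\<Sum>y\<in>E `` {x}. u x - u y)"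
    unfolding codifferential_def coboundary_def by (intro sum.cong) (auto dest: edge_sym)
  then show "codifferential E (coboundary E u) x = vertex_laplacian E d u x"
    by (cases "x \<in> V")
       (simp_all add: vertex_laplacian_def adjacency_op_def sum_subtractf card_neighbours
         neighbours_outside ell2_outside[OF assms])
qed

text \<open>
  For an operator \<open>D\<close> with adjoint \<open>D'\<close>, an upper bound of \<open>D' D\<close> is one of \<open>D D'\<close>: putting
  \<open>u = D' f\<close>, \<open>\<parallel>D D' f\<parallel>\<^sup>2 \<le> K \<parallel>D' f\<parallel>\<^sup>2 \<le> K \<parallel>D D' f\<parallel> \<parallel>f\<parallel>\<close>.
\<close>

lemma (in -) adjoint_product_bound:
  fixes N1 :: "'a \<Rightarrow> real" and N2 :: "'b \<Rightarrow> real"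
  assumes nonneg: "\<And>u. u \<in> H1 \<Longrightarrow> 0 \<le> N1 u" "\<And>f. f \<in> H2 \<Longrightarrow> 0 \<le> N2 f"
    and D: "\<And>u. u \<in> H1 \<Longrightarrow> D u \<in> H2 \<and> (N2 (D u))\<^sup>2 \<le> N1 (D' (D u)) * N1 u"
    and D': "\<And>f. f \<in> H2 \<Longrightarrow> D' f \<in> H1 \<and> (N1 (D' f))\<^sup>2 \<le> N2 (D (D' f)) * N2 f"
    and K: "\<And>u. u \<in> H1 \<Longrightarrow> N1 (D' (D u)) \<le> K * N1 u" and "0 \<le> K" and f: "f \<in> H2"
  shows "N2 (D (D' f)) \<le> K * N2 f"
proof (cases "N2 (D (D' f)) = 0")
  case False
  have "(N2 (D (D' f)))\<^sup>2 \<le> N1 (D' (D (D' f))) * N1 (D' f)" using D D' f by blast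
  also have "\<dots> \<le> K * N1 (D' f) * N1 (D' f)" using K D' f by (intro mult_right_mono nonneg) auto
  also have "\<dots> = K * (N1 (D' f))\<^sup>2" by (simp add: power2_eq_square)
  also have "\<dots> \<le> K * (N2 (D (D' f)) * N2 f)" using D' f \<open>0 \<le> K\<close> by (intro mult_left_mono) auto
  finally have "N2 (D (D' f)) * N2 (D (D' f)) \<le> K * N2 f * N2 (D (D' f))"
    by (simp add: power2_eq_square algebra_simps)
  then show ?thesis
    by (rule mult_right_le_imp_le) (use False nonneg(2)[of "D (D' f)"] D D' f in auto)
qed (use nonneg f \<open>0 \<le> K\<close> in simp)

lemma nontrivial_ell2: "\<exists>u\<in>ell2 V. ell2_norm V u \<noteq> 0"
proof -
  obtain x where x: "x \<in> V" using nonempty by blast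
  define u where "u = (\<lambda>y. if y = x then 1 else 0 :: complex)"
  have u: "u \<in> ell2 V" by (rule ell2_finite_support[of "{x}"]) (use x in \<open>auto simp: u_def\<close>)
  then have "1 \<le> ell2_norm V u" using norm_le_ell2_norm[OF u, of x] by (simp add: u_def)
  then show ?thesis using u by force
qed

lemma cochain_zero: "(\<lambda>p. 0) \<in> cochains E"
  by (simp add: cochain_iff ell2_zero)

lemma cochain_scale: "f \<in> cochains E \<Longrightarrow> (\<lambda>p. c * f p) \<in> cochains E"
  by (auto simp: cochain_iff ell2_scale)

lemma cochain_norm_nonneg: "f \<in> cochains E \<Longrightarrow> 0 \<le> cochain_norm E f"
  by (simp add: cochain_norm_eq ell2_norm_nonneg)

lemma cochain_norm_scale: "f \<in> cochains E \<Longrightarrow> cochain_norm E (\<lambda>p. c * f p) = cmod c * cochain_norm E f"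
  by (simp add: cochain_norm_eq cochain_scale ell2_norm_scale)

lemma nontrivial_cochain: "\<exists>f\<in>cochains E. 0 < cochain_norm E f"
proof -
  obtain x where x: "x \<in> V" using nonempty by blast
  then have "E `` {x} \<noteq> {}" using card_neighbours[OF x] degree_pos by fastforce
  then obtain y where xy: "(x, y) \<in> E" by blast
  define u where "u = (\<lambda>z. if z = x then 1 else 0 :: complex)"
  have u: "u \<in> ell2 V" by (rule ell2_finite_support[of "{x}"]) (use x in \<open>auto simp: u_def\<close>)
  have "y \<noteq> x" using xy no_loop by blast
  then have "cmod (coboundary E u (x, y)) = 1" using xy by (simp add: coboundary_def u_def)
  moreover have "coboundary E u \<in> ell2 E" using coboundary_cochain[OF u] by (simp add: cochain_iff)
  ultimately have "1 \<le> ell2_norm E (coboundary E u)" using norm_le_ell2_norm by metis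
  then have "0 < cochain_norm E (coboundary E u)" by (simp add: cochain_norm_eq coboundary_cochain u)
  then show ?thesis using coboundary_cochain[OF u] by blast
qed

lemma coboundary_norm:
  assumes "u \<in> ell2 V"
  shows "(cochain_norm E (coboundary E u))\<^sup>2 = ell2_inner V (vertex_laplacian E d u) u"
  using coboundary_adjoint[OF assms coboundary_cochain[OF assms]]
  by (simp add: cochain_norm_eq coboundary_cochain assms power_divide ell2_norm_square
      codifferential_coboundary ell2_inner_commute)

lemma coboundary_bound:
  assumes u: "u \<in> ell2 V"
  shows "(cochain_norm E (coboundary E u))\<^sup>2
       \<le> ell2_norm V (codifferential E (coboundary E u)) * ell2_norm V u"
proof -
  have "vertex_laplacian E d u \<in> ell2 V"
    using u vertex_laplacian_self_adjoint by (auto simp: self_adjoint_def intro: operator_closed)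
  then show ?thesis
    using ell2_Cauchy_Schwarz[of "vertex_laplacian E d u" V u] u
    by (simp add: coboundary_norm codifferential_coboundary)
qed

lemma codifferential_bound:
  assumes f: "f \<in> cochains E"
  shows "(ell2_norm V (codifferential E f))\<^sup>2
       \<le> cochain_norm E (coboundary E (codifferential E f)) * cochain_norm E f"
proof -
  have f2: "f \<in> ell2 E" using f by (simp add: cochain_iff)
  then have v: "codifferential E f \<in> ell2 V" by (rule codifferential_ell2)
  have c: "coboundary E (codifferential E f) \<in> cochains E" by (rule coboundary_cochain[OF v])
  have "2 * (ell2_norm V (codifferential E f))\<^sup>2 = ell2_inner E (coboundary E (codifferential E f)) f"
    using coboundary_adjoint[OF v f] by (simp add: ell2_norm_square)
  also have "\<dots> \<le> ell2_norm E (coboundary E (codifferential E f)) * ell2_norm E f"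
    using ell2_Cauchy_Schwarz[of "coboundary E (codifferential E f)" E f] c f2 by (simp add: cochain_iff)
  finally show ?thesis using c f by (simp add: cochain_norm_eq)
qed

lemma codifferential_closed: "f \<in> cochains E \<Longrightarrow> codifferential E f \<in> ell2 V"
  by (intro codifferential_ell2) (simp add: cochain_iff)

lemma edge_bound_from_vertex_bound:
  assumes "\<And>u. u \<in> ell2 V \<Longrightarrow> ell2_norm V (vertex_laplacian E d u) \<le> K * ell2_norm V u"
    and "0 \<le> K" and "f \<in> cochains E"
  shows "cochain_norm E (edge_laplacian E f) \<le> K * cochain_norm E f"
  unfolding edge_laplacian_def
  by (rule adjoint_product_bound[where ?H1.0 = "ell2 V" and ?N1.0 = "ell2_norm V"
        and ?H2.0 = "cochains E" and ?N2.0 = "cochain_norm E"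
        and D = "coboundary E" and D' = "codifferential E"])
     (use assms in \<open>auto simp: ell2_norm_nonneg cochain_norm_nonneg codifferential_coboundary
        codifferential_closed coboundary_cochain codifferential_bound
        simp flip: coboundary_norm intro!: order_trans[OF coboundary_bound]\<close>)

lemma vertex_bound_from_edge_bound:
  assumes "\<And>f. f \<in> cochains E \<Longrightarrow> cochain_norm E (edge_laplacian E f) \<le> K * cochain_norm E f"
    and "0 \<le> K" and "u \<in> ell2 V"
  shows "ell2_norm V (vertex_laplacian E d u) \<le> K * ell2_norm V u"
  unfolding codifferential_coboundary[OF assms(3), symmetric]
  by (rule adjoint_product_bound[where ?H1.0 = "cochains E" and ?N1.0 = "cochain_norm E"
        and ?H2.0 = "ell2 V" and ?N2.0 = "ell2_norm V"
        and D = "codifferential E" and D' = "coboundary E"])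
     (use assms in \<open>auto simp: ell2_norm_nonneg cochain_norm_nonneg codifferential_closed
        coboundary_cochain codifferential_bound coboundary_bound edge_laplacian_def\<close>)

lemma edge_laplacian_bounded: "bounded_operator (cochains E) (cochain_norm E) (edge_laplacian E)"
proof -
  obtain C where "0 < C" and C: "\<And>u. u \<in> ell2 V \<Longrightarrow> ell2_norm V (vertex_laplacian E d u) \<le> C * ell2_norm V u"
    using bounded_operator_positive_bound[OF conjunct1[OF vertex_laplacian_self_adjoint[unfolded self_adjoint_def]]]
    by blast
  have "\<exists>C. \<forall>f\<in>cochains E. cochain_norm E (edge_laplacian E f) \<le> C * cochain_norm E f"
    using edge_bound_from_vertex_bound[OF C] \<open>0 < C\<close> by (meson less_imp_le)
  moreover have "edge_laplacian E (\<lambda>x. f x + g x) = (\<lambda>x. edge_laplacian E f x + edge_laplacian E g x)" for f g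
    by (auto simp: edge_laplacian_def codifferential_def coboundary_def sum.distrib fun_eq_iff)
  moreover have "edge_laplacian E (\<lambda>x. c * f x) = (\<lambda>x. c * edge_laplacian E f x)" for c f
    by (auto simp: edge_laplacian_def codifferential_def coboundary_def fun_eq_iff algebra_simps
        simp flip: sum_distrib_left)
  moreover have "edge_laplacian E f \<in> cochains E" if "f \<in> cochains E" for f
    unfolding edge_laplacian_def by (intro coboundary_cochain codifferential_closed that)
  ultimately show ?thesis unfolding bounded_operator_def by blast
qed

lemma edge_laplacian_norm:
  "operator_norm (cochains E) (cochain_norm E) (edge_laplacian E)
     = operator_norm (ell2 V) (ell2_norm V) (vertex_laplacian E d)"
proof -
  obtain v where v: "v \<in> ell2 V" "0 < ell2_norm V v"
    using nontrivial_ell2 ell2_norm_nonneg[of V] by (metis less_eq_real_def)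
  obtain g where g: "g \<in> cochains E" "0 < cochain_norm E g" using nontrivial_cochain by blast
  have vertex: "operator_norm (ell2 V) (ell2_norm V) (vertex_laplacian E d) \<le> K \<longleftrightarrow>
      (\<forall>u\<in>ell2 V. ell2_norm V (vertex_laplacian E d u) \<le> K * ell2_norm V u)" for K
    using vertex_laplacian_self_adjoint v unfolding self_adjoint_def
    by (intro operator_norm_le_iff ell2_norm_scale ell2_closed ell2_norm_nonneg) auto
  have edge: "operator_norm (cochains E) (cochain_norm E) (edge_laplacian E) \<le> K \<longleftrightarrow>
      (\<forall>f\<in>cochains E. cochain_norm E (edge_laplacian E f) \<le> K * cochain_norm E f)" for K
    by (intro operator_norm_le_iff cochain_norm_scale cochain_zero cochain_scale nontrivial_cochain
        cochain_norm_nonneg edge_laplacian_bounded)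
  have "operator_norm (cochains E) (cochain_norm E) (edge_laplacian E) \<le> K \<longleftrightarrow>
      operator_norm (ell2 V) (ell2_norm V) (vertex_laplacian E d) \<le> K" (is "?e \<le> K \<longleftrightarrow> ?v \<le> K") for K
    unfolding vertex edge
  proof (intro iffI ballI)
    fix f assume K: "\<forall>u\<in>ell2 V. ell2_norm V (vertex_laplacian E d u) \<le> K * ell2_norm V u"
      and f: "f \<in> cochains E"
    have "0 \<le> K * ell2_norm V v" using K v ell2_norm_nonneg order_trans by blast
    then have "0 \<le> K" using v by (simp add: zero_le_mult_iff)
    show "cochain_norm E (edge_laplacian E f) \<le> K * cochain_norm E f"
      using K by (intro edge_bound_from_vertex_bound \<open>0 \<le> K\<close> f) auto
  next
    fix u assume K: "\<forall>f\<in>cochains E. cochain_norm E (edge_laplacian E f) \<le> K * cochain_norm E f"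
      and u: "u \<in> ell2 V"
    have "edge_laplacian E g \<in> cochains E"
      using edge_laplacian_bounded g by (simp add: bounded_operator_def)
    then have "0 \<le> K * cochain_norm E g" using K g cochain_norm_nonneg order_trans by blast
    then have "0 \<le> K" using g by (simp add: zero_le_mult_iff)
    show "ell2_norm V (vertex_laplacian E d u) \<le> K * ell2_norm V u"
      using K by (intro vertex_bound_from_edge_bound \<open>0 \<le> K\<close> u) auto
  qed
  from this[of ?e] this[of ?v] show ?thesis by (intro antisym) simp_all
qed

end

section \<open>Equivalence of the extremality conditions\<close>

context regular_nonempty_graph
begin

abbreviation "adjacency_inf \<equiv> inf_spec (ell2 V) (ell2_norm V) (adjacency_op E)"
abbreviation "adjacency_sup \<equiv> sup_spec (ell2 V) (ell2_norm V) (adjacency_op E)"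

lemmas adjacency_le_inf_iff = le_inf_spec_iff[OF adjacency_self_adjoint nontrivial_ell2]
lemmas adjacency_sup_le_iff = sup_spec_le_iff[OF adjacency_self_adjoint nontrivial_ell2]

lemma vertex_form_le_iff:
  "(\<forall>u\<in>ell2 V. ell2_inner V (vertex_laplacian E d u) u \<le> K * (ell2_norm V u)\<^sup>2)
     \<longleftrightarrow> real d - adjacency_inf \<le> K"
proof -
  have "(\<forall>u\<in>ell2 V. ell2_inner V (vertex_laplacian E d u) u \<le> K * (ell2_norm V u)\<^sup>2)
      \<longleftrightarrow> (\<forall>u\<in>ell2 V. (real d - K) * (ell2_norm V u)\<^sup>2 \<le> ell2_inner V (adjacency_op E u) u)"
    by (intro ball_cong refl) (simp add: vertex_laplacian_form algebra_simps)
  then show ?thesis by (auto simp flip: adjacency_le_inf_iff)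
qed

lemma vertex_laplacian_norm:
  "operator_norm (ell2 V) (ell2_norm V) (vertex_laplacian E d) = real d - adjacency_inf" (is "?n = ?r")
proof -
  have "0 \<le> ell2_inner V (vertex_laplacian E d u) u" if "u \<in> ell2 V" for u
    using adjacency_form_bounds(1)[OF that] by (simp add: vertex_laplacian_form that)
  from positive_norm_le_iff[OF vertex_laplacian_self_adjoint this nontrivial_ell2]
  have "?n \<le> K \<longleftrightarrow> ?r \<le> K" for K by (simp add: vertex_form_le_iff)
  from this[of ?n] this[of ?r] show ?thesis by (intro antisym) simp_all
qed

lemma vertex_laplacian_sup:
  "sup_spec (ell2 V) (ell2_norm V) (vertex_laplacian E d) = real d - adjacency_inf" (is "?n = ?r")
proof -
  have "?n \<le> K \<longleftrightarrow> ?r \<le> K" for K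
    by (simp add: sup_spec_le_iff[OF vertex_laplacian_self_adjoint nontrivial_ell2] vertex_form_le_iff)
  from this[of ?n] this[of ?r] show ?thesis by (intro antisym) simp_all
qed

lemma signless_laplacian_inf:
  "inf_spec (ell2 V) (ell2_norm V) (signless_laplacian E d) = real d + adjacency_inf" (is "?n = ?r")
proof -
  have "K \<le> ?n \<longleftrightarrow> K \<le> ?r" for K
  proof -
    have "K \<le> ?n \<longleftrightarrow> (\<forall>u\<in>ell2 V. K * (ell2_norm V u)\<^sup>2 \<le> ell2_inner V (signless_laplacian E d u) u)"
      by (rule le_inf_spec_iff[OF signless_laplacian_self_adjoint nontrivial_ell2])
    also have "\<dots> \<longleftrightarrow> (\<forall>u\<in>ell2 V. (K - real d) * (ell2_norm V u)\<^sup>2 \<le> ell2_inner V (adjacency_op E u) u)"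
      by (intro ball_cong refl) (simp add: signless_laplacian_form algebra_simps)
    also have "\<dots> \<longleftrightarrow> K \<le> ?r" by (auto simp flip: adjacency_le_inf_iff)
    finally show ?thesis .
  qed
  from this[of ?n] this[of ?r] show ?thesis by (intro antisym) simp_all
qed

lemma adjacency_inf_ge: "- real d \<le> adjacency_inf"
  using adjacency_form_bounds(2) by (simp add: adjacency_le_inf_iff)

lemma adjacency_sup_le: "adjacency_sup \<le> real d"
  using adjacency_form_bounds(1) by (simp add: adjacency_sup_le_iff)

text \<open>
  The energy is the form of the signless Laplacian, and by homogeneity its infimum over unit vectors
  is the largest lower bound of that form.
\<close>

lemma energy_infimum:
  "(INF u \<in> {u \<in> ell2 V. ell2_norm V u = 1}.
      \<Sum>\<^sub>\<infinity>e\<in>edges E. edge_value (\<lambda>x y. (cmod (u x + u y))\<^sup>2) e)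
     = inf_spec (ell2 V) (ell2_norm V) (signless_laplacian E d)" (is "?I = ?s")
proof -
  define U where "U = {u \<in> ell2 V. ell2_norm V u = 1}"
  define F where "F u = ell2_inner V (signless_laplacian E d u) u" for u
  have "?I = Inf (F ` U)"
    unfolding U_def F_def by (rule arg_cong[of _ _ Inf], rule image_cong) (auto simp: signless_energy)
  have unit: "\<exists>v\<in>U. F u = F v * (ell2_norm V u)\<^sup>2" if u: "u \<in> ell2 V" "ell2_norm V u \<noteq> 0" for u
  proof (intro bexI)
    let ?r = "1 / ell2_norm V u"
    have pos: "0 < ell2_norm V u" using u ell2_norm_nonneg[of V u] by simp
    have "ell2_norm V (\<lambda>x. of_real ?r * u x) = 1"
      using pos by (simp only: ell2_norm_scale) (simp add: norm_divide)
    then show "(\<lambda>x. of_real ?r * u x) \<in> U" using u by (simp only: U_def mem_Collect_eq ell2_scale)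
    have B: "ell2_operator V (signless_laplacian E d)"
      using signless_laplacian_self_adjoint by (simp add: self_adjoint_def)
    have "F (\<lambda>x. of_real ?r * u x) = ?r * (?r * F u)"
      unfolding F_def operator_scale[OF B u(1)]
      by (simp only: ell2_inner_scale_real_left ell2_inner_scale_real_right)
    then show "F u = F (\<lambda>x. of_real ?r * u x) * (ell2_norm V u)\<^sup>2"
      using pos by (simp add: power2_eq_square)
  qed
  have "U \<noteq> {}" using unit nontrivial_ell2 by blast
  have "F u \<ge> 0" if "u \<in> U" for u
    using that adjacency_form_bounds(2)[of u] by (simp add: U_def F_def signless_laplacian_form)
  then have "bdd_below (F ` U)" by (auto intro: bdd_belowI[of _ 0])
  have "K \<le> Inf (F ` U) \<longleftrightarrow> K \<le> ?s" for K
  proof -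
    have "K \<le> Inf (F ` U) \<longleftrightarrow> (\<forall>u\<in>U. K \<le> F u)"
      using le_cInf_iff[of "F ` U" K] \<open>bdd_below (F ` U)\<close> \<open>U \<noteq> {}\<close> by simp
    also have "\<dots> \<longleftrightarrow> (\<forall>u\<in>ell2 V. K * (ell2_norm V u)\<^sup>2 \<le> F u)"
    proof (intro iffI ballI)
      fix u assume K: "\<forall>u\<in>U. K \<le> F u" and u: "u \<in> ell2 V"
      show "K * (ell2_norm V u)\<^sup>2 \<le> F u"
      proof (cases "ell2_norm V u = 0")
        case True
        then show ?thesis using adjacency_form_bounds(2)[OF u] by (simp add: F_def signless_laplacian_form u)
      next
        case False
        then obtain v where v: "v \<in> U" "F u = F v * (ell2_norm V u)\<^sup>2" using unit[OF u] by blast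
        then show ?thesis using K by (simp add: mult_right_mono)
      qed
    qed (auto simp: U_def)
    also have "\<dots> \<longleftrightarrow> K \<le> ?s"
      unfolding F_def by (rule le_inf_spec_iff[OF signless_laplacian_self_adjoint nontrivial_ell2, symmetric])
    finally show ?thesis .
  qed
  from this[of "Inf (F ` U)"] this[of ?s] have "Inf (F ` U) = ?s" by (intro antisym) simp_all
  then show ?thesis using \<open>?I = Inf (F ` U)\<close> by simp
qed

text \<open>
  All the quantities involved are affine functions of the bottom of the spectrum of the adjacency
  operator, and each condition says that this bottom has its least possible value \<open>- d\<close>.
\<close>

lemma conditions_iff:
  shows "norm_condition E d \<longleftrightarrow> adjacency_inf = - real d"
    and "spectral_condition V E d \<longleftrightarrow> adjacency_inf = - real d"
    and "signless_condition V E d \<longleftrightarrow> adjacency_inf = - real d"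
    and "variational_condition V E \<longleftrightarrow> adjacency_inf = - real d"
proof -
  show "norm_condition E d \<longleftrightarrow> adjacency_inf = - real d"
    by (auto simp: norm_condition_def edge_laplacian_norm vertex_laplacian_norm)
  show "signless_condition V E d \<longleftrightarrow> adjacency_inf = - real d"
    by (auto simp: signless_condition_def signless_laplacian_inf)
  show "variational_condition V E \<longleftrightarrow> adjacency_inf = - real d"
    unfolding variational_condition_def energy_infimum by (auto simp: signless_laplacian_inf)
  have "2 * of_nat d \<in> ell2_spectrum V (vertex_laplacian E d)"
    if "adjacency_inf = - real d"
    using sup_spec_in_spectrum[OF vertex_laplacian_self_adjoint nontrivial_ell2] that
    by (simp add: vertex_laplacian_sup)
  moreover have "adjacency_inf = - real d"
    if "2 * of_nat d \<in> ell2_spectrum V (vertex_laplacian E d)"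
    using spectrum_le_sup_spec[OF vertex_laplacian_self_adjoint nontrivial_ell2 that] adjacency_inf_ge
    by (simp add: vertex_laplacian_sup)
  ultimately show "spectral_condition V E d \<longleftrightarrow> adjacency_inf = - real d"
    by (auto simp: spectral_condition_def)
qed

lemma all_conditions_iff: "all_conditions V E d \<longleftrightarrow> adjacency_inf = - real d"
  by (simp add: all_conditions_def conditions_iff)

text \<open>
  On every edge, \<open>- Re (u x \<cdot> cnj (u y)) \<le> \<bar>u x\<bar> \<bar>u y\<bar>\<close>.
\<close>

lemma adjacency_form_modulus:
  assumes u: "u \<in> ell2 V"
  shows "(\<lambda>x. of_real (cmod (u x))) \<in> ell2 V"
    and "ell2_norm V (\<lambda>x. of_real (cmod (u x))) = ell2_norm V u"
    and "- ell2_inner V (adjacency_op E u) u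
       \<le> ell2_inner V (adjacency_op E (\<lambda>x. of_real (cmod (u x)))) (\<lambda>x. of_real (cmod (u x)))"
proof -
  let ?a = "\<lambda>x. complex_of_real (cmod (u x))"
  show a: "?a \<in> ell2 V" using u by (simp add: ell2_def)
  show "ell2_norm V ?a = ell2_norm V u" by (simp add: ell2_norm_def)
  note ha = inner_summable[OF tail_lift_ell2(1)[OF a] head_lift_ell2(1)[OF a]]
    and hu = inner_summable[OF tail_lift_ell2(1)[OF u] head_lift_ell2(1)[OF u]]
  have "- ell2_inner V (adjacency_op E u) u = (\<Sum>\<^sub>\<infinity>p\<in>E. - (tail_lift u p \<bullet> head_lift u p))"
    unfolding adjacency_inner[OF u u] by (simp add: ell2_inner_def infsum_uminus)
  also have "\<dots> \<le> (\<Sum>\<^sub>\<infinity>p\<in>E. tail_lift ?a p \<bullet> head_lift ?a p)"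
  proof (rule infsum_mono)
    fix p
    show "- (tail_lift u p \<bullet> head_lift u p) \<le> tail_lift ?a p \<bullet> head_lift ?a p"
      using Cauchy_Schwarz_ineq2[of "u (fst p)" "u (snd p)"]
      by (cases p) (auto simp: tail_lift_def head_lift_def inner_complex_def abs_le_iff)
  qed (use ha hu in \<open>simp_all add: summable_on_uminus\<close>)
  also have "\<dots> = ell2_inner V (adjacency_op E ?a) ?a"
    unfolding adjacency_inner[OF a a] by (simp add: ell2_inner_def)
  finally show "- ell2_inner V (adjacency_op E u) u \<le> ell2_inner V (adjacency_op E ?a) ?a" .
qed

text \<open>
  An upper bound \<open>K\<close> of the form at \<open>\<bar>u\<bar>\<close> is a lower bound \<open>- K\<close> of the form at \<open>u\<close>.
\<close>

lemma adjacency_sup_ge_minus_inf: "- adjacency_inf \<le> adjacency_sup"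
proof -
  have "- adjacency_sup * (ell2_norm V u)\<^sup>2 \<le> ell2_inner V (adjacency_op E u) u" if u: "u \<in> ell2 V" for u
  proof -
    have "\<forall>u\<in>ell2 V. ell2_inner V (adjacency_op E u) u \<le> adjacency_sup * (ell2_norm V u)\<^sup>2"
      using adjacency_sup_le_iff[of adjacency_sup] by simp
    then show ?thesis using adjacency_form_modulus[OF u] by fastforce
  qed
  then have "- adjacency_sup \<le> adjacency_inf" by (simp add: adjacency_le_inf_iff)
  then show ?thesis by simp
qed

lemma adjacency_sup_eq_degree: "adjacency_inf = - real d \<Longrightarrow> adjacency_sup = real d"
  using adjacency_sup_ge_minus_inf adjacency_sup_le by simp


section \<open>A Cheeger inequality\<close>

text \<open>
  The isoperimetric inequality for finite sets is the case of indicator functions; the general case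
  follows layer by layer, since lowering \<open>g\<close> on its support by its least positive value lowers the
  right-hand side by at least that value times the boundary of the support.
\<close>

lemma isoperimetric_functional:
  fixes g :: "'v \<Rightarrow> real"
  assumes iso: "\<And>\<Omega>. finite \<Omega> \<Longrightarrow> \<Omega> \<noteq> {} \<Longrightarrow> \<Omega> \<subseteq> V \<Longrightarrow>
      h * real (card \<Omega>) \<le> real (card (inner_boundary E \<Omega>))"
    and S: "finite S" "S \<subseteq> V"
    and "\<And>x. 0 \<le> g x" and "\<And>x. x \<notin> S \<Longrightarrow> g x = 0"
  shows "h * (\<Sum>x\<in>S. g x) \<le> (\<Sum>x\<in>S. \<Sum>y\<in>E `` {x}. max 0 (g x - g y))"
  using assms(4,5)
proof (induction "card {x\<in>S. g x > 0}" arbitrary: g rule: less_induct)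
  case less
  define P where "P = {x\<in>S. g x > 0}"
  have "finite P" "P \<subseteq> V" using S by (auto simp: P_def)
  show ?case
  proof (cases "P = {}")
    case True
    then have "g x = 0" for x using less.prems[of x] by (force simp: P_def)
    then show ?thesis by simp
  next
    case False
    define a where "a = Min (g ` P)"
    have "a \<in> g ` P" unfolding a_def using \<open>finite P\<close> False by (intro Min_in) auto
    then obtain p where p: "p \<in> P" "g p = a" by blast
    then have "0 < a" by (auto simp: P_def)
    have a_le: "a \<le> g x" if "x \<in> P" for x unfolding a_def using \<open>finite P\<close> that by simp
    have off: "g x = 0" if "x \<notin> P" for x using less.prems[of x] that by (force simp: P_def)
    define g' where "g' x = max 0 (g x - a)" for x
    have g: "g x = g' x + a * of_bool (x \<in> P)" for x
      using a_le[of x] off[of x] \<open>0 < a\<close> by (auto simp: g'_def)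
    have jump: "max 0 (g x - g y) = max 0 (g' x - g' y) + a * of_bool (x \<in> P \<and> y \<notin> P)" for x y
      using a_le[of x] a_le[of y] off[of x] off[of y] \<open>0 < a\<close> less.prems(1)[of x] less.prems(1)[of y]
      by (cases "x \<in> P"; cases "y \<in> P") (auto simp: g'_def)
    have "p \<notin> {x\<in>S. g' x > 0}" using p by (simp add: g'_def)
    moreover have "{x\<in>S. g' x > 0} \<subseteq> P" using \<open>0 < a\<close> by (auto simp: g'_def P_def)
    ultimately have "{x\<in>S. g' x > 0} \<subset> P" using p by blast
    then have "card {x\<in>S. g' x > 0} < card P" by (rule psubset_card_mono[OF \<open>finite P\<close>])
    then have IH: "h * (\<Sum>x\<in>S. g' x) \<le> (\<Sum>x\<in>S. \<Sum>y\<in>E `` {x}. max 0 (g' x - g' y))"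
      using less.prems(2) \<open>0 < a\<close> unfolding P_def by (intro less.hyps) (auto simp: g'_def)
    have "P \<subseteq> S" by (auto simp: P_def)
    then have indicator: "(\<Sum>x\<in>S. of_bool (x \<in> P)) = real (card P)"
      using S by (simp add: of_bool_def sum.If_cases Int_absorb1)
    have "(\<Sum>x\<in>S. of_bool (x \<in> inner_boundary E P)) \<le> (\<Sum>x\<in>S. \<Sum>y\<in>E `` {x}. of_bool (x \<in> P \<and> y \<notin> P) :: real)"
    proof (rule sum_mono)
      fix x
      show "of_bool (x \<in> inner_boundary E P) \<le> (\<Sum>y\<in>E `` {x}. of_bool (x \<in> P \<and> y \<notin> P) :: real)"
      proof (cases "x \<in> inner_boundary E P")
        case True
        then obtain y where "x \<in> P" "y \<in> E `` {x}" "y \<notin> P" by (auto simp: inner_boundary_def)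
        then show ?thesis
          using member_le_sum[of y "E `` {x}" "\<lambda>y. of_bool (x \<in> P \<and> y \<notin> P) :: real"]
          by (simp add: finite_neighbours)
      qed (simp add: sum_nonneg)
    qed
    moreover have "(\<Sum>x\<in>S. of_bool (x \<in> inner_boundary E P)) = real (card (inner_boundary E P))"
    proof -
      have "inner_boundary E P \<subseteq> S" using \<open>P \<subseteq> S\<close> by (auto simp: inner_boundary_def)
      then show ?thesis using S by (simp add: of_bool_def sum.If_cases Int_absorb1)
    qed
    ultimately have layer: "h * real (card P) \<le> (\<Sum>x\<in>S. \<Sum>y\<in>E `` {x}. of_bool (x \<in> P \<and> y \<notin> P) :: real)"
      using iso[OF \<open>finite P\<close> False \<open>P \<subseteq> V\<close>] by linarith
    have "h * (\<Sum>x\<in>S. g x) = h * (\<Sum>x\<in>S. g' x) + a * (h * real (card P))"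
      by (simp add: g sum.distrib indicator algebra_simps flip: sum_distrib_left)
    also have "\<dots> \<le> (\<Sum>x\<in>S. \<Sum>y\<in>E `` {x}. max 0 (g' x - g' y))
        + a * (\<Sum>x\<in>S. \<Sum>y\<in>E `` {x}. of_bool (x \<in> P \<and> y \<notin> P))"
      using \<open>0 < a\<close> by (intro add_mono IH mult_left_mono layer) auto
    also have "\<dots> = (\<Sum>x\<in>S. \<Sum>y\<in>E `` {x}. max 0 (g x - g y))"
      by (simp add: jump sum.distrib sum_distrib_left)
    finally show ?thesis .
  qed
qed

lemma (in -) summable_superlevel_finite:
  fixes g :: "'a \<Rightarrow> real"
  assumes g: "g summable_on A" "\<And>x. x \<in> A \<Longrightarrow> 0 \<le> g x" and "0 < t"
  shows "finite {x\<in>A. t < g x}"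
proof (rule ccontr)
  assume "infinite {x\<in>A. t < g x}"
  obtain n :: nat where n: "infsum g A / t < real n" using reals_Archimedean2 by blast
  obtain F where F: "F \<subseteq> {x\<in>A. t < g x}" "finite F" "card F = n"
    using infinite_arbitrarily_large[OF \<open>infinite _\<close>] by metis
  have "real n * t = (\<Sum>x\<in>F. t)" using F by simp
  also have "\<dots> \<le> sum g F" using F by (intro sum_mono) auto
  also have "\<dots> \<le> infsum g A" using F g by (intro finite_sum_le_infsum) auto
  finally show False using n \<open>0 < t\<close> by (simp add: divide_less_eq)
qed

text \<open>
  The truncations \<open>max 0 (\<bar>u\<bar>\<^sup>2 - t)\<close> have finite support; letting \<open>t \<rightarrow> 0\<close> carries the functional
  isoperimetric inequality over to \<open>\<bar>u\<bar>\<^sup>2\<close>.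
\<close>

lemma isoperimetric_ell2:
  assumes iso: "\<And>\<Omega>. finite \<Omega> \<Longrightarrow> \<Omega> \<noteq> {} \<Longrightarrow> \<Omega> \<subseteq> V \<Longrightarrow>
      h * real (card \<Omega>) \<le> real (card (inner_boundary E \<Omega>))" and "0 < h"
    and u: "u \<in> ell2 V"
    and variation: "(\<lambda>(x, y). \<bar>(cmod (u x))\<^sup>2 - (cmod (u y))\<^sup>2\<bar>) summable_on E"
  shows "h * (ell2_norm V u)\<^sup>2 \<le> (\<Sum>\<^sub>\<infinity>(x, y)\<in>E. \<bar>(cmod (u x))\<^sup>2 - (cmod (u y))\<^sup>2\<bar>)"
proof -
  define g where "g x = (cmod (u x))\<^sup>2" for x
  define D where "D = (\<Sum>\<^sub>\<infinity>(x, y)\<in>E. \<bar>g x - g y\<bar>)"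
  have g_summable: "g summable_on V" using ell2_summable[OF u] by (simp add: g_def[abs_def])
  have g_outside: "g x = 0" if "x \<notin> V" for x using ell2_outside[OF u that] by (simp add: g_def)
  have truncated: "h * sum g F \<le> D + h * t * real (card F)" if F: "finite F" "F \<subseteq> V" and "0 < t" for F t
  proof -
    define S where "S = F \<union> {x\<in>V. t < g x}"
    have S: "finite S" "S \<subseteq> V"
      unfolding S_def using F summable_superlevel_finite[OF g_summable _ \<open>0 < t\<close>] by (auto simp: g_def)
    define gt where "gt x = max 0 (g x - t)" for x
    have gt_off: "gt x = 0" if "x \<notin> S" for x
      using that g_outside[of x] \<open>0 < t\<close> by (cases "x \<in> V") (auto simp: gt_def S_def)
    have "sum g F \<le> (\<Sum>x\<in>F. gt x + t)" by (intro sum_mono) (simp add: gt_def)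
    also have "\<dots> = sum gt F + t * real (card F)" by (simp add: sum.distrib)
    also have "sum gt F \<le> sum gt S" by (rule sum_mono2[OF S(1)]) (auto simp: S_def gt_def)
    finally have "sum g F \<le> sum gt S + t * real (card F)" by simp
    then have "h * sum g F \<le> h * (sum gt S + t * real (card F))"
      using \<open>0 < h\<close> by (intro mult_left_mono) auto
    then have "h * sum g F \<le> h * sum gt S + h * t * real (card F)" by (simp add: algebra_simps)
    also have "h * sum gt S \<le> (\<Sum>x\<in>S. \<Sum>y\<in>E `` {x}. max 0 (gt x - gt y))"
      by (rule isoperimetric_functional[OF iso S]) (use gt_off in \<open>auto simp: gt_def\<close>)
    also have "\<dots> \<le> (\<Sum>x\<in>S. \<Sum>y\<in>E `` {x}. \<bar>g x - g y\<bar>)"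
      by (intro sum_mono) (auto simp: gt_def)
    also have "\<dots> = (\<Sum>(x, y)\<in>Sigma S (\<lambda>x. E `` {x}). \<bar>g x - g y\<bar>)"
      by (rule sum.Sigma) (use S finite_neighbours in auto)
    also have "\<dots> \<le> D"
      unfolding D_def
      by (rule finite_sum_le_infsum)
         (use variation S finite_neighbours in \<open>auto simp: g_def[abs_def] intro!: finite_SigmaI\<close>)
    finally show ?thesis by simp
  qed
  have "h * sum g F \<le> D" if F: "finite F" "F \<subseteq> V" for F
  proof (rule field_le_epsilon)
    fix e :: real assume "0 < e"
    \<comment> \<open>adding 1 keeps the denominator positive for empty \<open>F\<close>\<close>
    define t where "t = e / (h * real (card F) + 1)"
    have pos: "0 < h * real (card F) + 1" using \<open>0 < h\<close> by (simp add: add_nonneg_pos)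
    have "0 < t" using pos \<open>0 < e\<close> by (simp add: t_def)
    then have "h * t * real (card F) \<le> t * (h * real (card F) + 1)" by (simp add: algebra_simps)
    also have "\<dots> = e" using pos by (simp add: t_def)
    finally have "h * t * real (card F) \<le> e" .
    then show "h * sum g F \<le> D + e" using truncated[OF F \<open>0 < t\<close>] by linarith
  qed
  then have "infsum g V \<le> D / h"
    using \<open>0 < h\<close> by (intro infsum_le_finite_sums g_summable) (simp add: le_divide_eq mult.commute)
  then show ?thesis
    using \<open>0 < h\<close> by (simp add: ell2_norm_square_infsum D_def g_def[abs_def] le_divide_eq mult.commute)
qed

text \<open>
  With \<open>\<bar>a\<^sup>2 - b\<^sup>2\<bar> \<le> (s (a - b)\<^sup>2 + (a + b)\<^sup>2 / s) / 2\<close> the total variation of \<open>\<bar>u\<bar>\<^sup>2\<close> is at most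
  \<open>s \<langle>\<Delta>\<^sub>0 u, u\<rangle> + 2 d \<parallel>u\<parallel>\<^sup>2 / s\<close>; the choice \<open>s = 4 d / h\<close> turns this into a spectral gap.
\<close>

lemma Cheeger_gap:
  assumes iso: "\<And>\<Omega>. finite \<Omega> \<Longrightarrow> \<Omega> \<noteq> {} \<Longrightarrow> \<Omega> \<subseteq> V \<Longrightarrow>
      h * real (card \<Omega>) \<le> real (card (inner_boundary E \<Omega>))" and "0 < h"
  shows "adjacency_sup \<le> real d - h\<^sup>2 / (8 * real d)"
  unfolding adjacency_sup_le_iff
proof
  fix u assume u: "u \<in> ell2 V"
  let ?q = "ell2_inner V (adjacency_op E u) u" and ?N = "(ell2_norm V u)\<^sup>2"
  define s where "s = 4 * real d / h"
  have "0 < s" using \<open>0 < h\<close> degree_pos by (simp add: s_def)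
  define b where "b = (\<lambda>(x, y). (s / 2 + 1 / (2 * s)) * (cmod (u x - u y))\<^sup>2 + 1 / (2 * s) * (cmod (u x + u y))\<^sup>2)"
  have b_sum: "(b has_sum ((s / 2 + 1 / (2 * s)) * (2 * (real d * ?N - ?q))
      + 1 / (2 * s) * (2 * (real d * ?N + ?q)))) E"
  proof -
    have "((\<lambda>p. (s / 2 + 1 / (2 * s)) * (case p of (x, y) \<Rightarrow> (cmod (u x - u y))\<^sup>2)
        + 1 / (2 * s) * (case p of (x, y) \<Rightarrow> (cmod (u x + u y))\<^sup>2))
        has_sum ((s / 2 + 1 / (2 * s)) * (2 * (real d * ?N - ?q)) + 1 / (2 * s) * (2 * (real d * ?N + ?q)))) E"
      by (intro has_sum_add has_sum_cmult_right edge_plus_has_sum edge_minus_has_sum u)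
    then show ?thesis by (simp add: b_def case_prod_unfold)
  qed
  have bound: "\<bar>(cmod a)\<^sup>2 - (cmod c)\<^sup>2\<bar> \<le> (s / 2 + 1 / (2 * s)) * (cmod (a - c))\<^sup>2 + 1 / (2 * s) * (cmod (a + c))\<^sup>2" for a c
  proof -
    define m p where "m = \<bar>cmod a - cmod c\<bar>" and "p = cmod a + cmod c"
    have "m \<le> cmod (a - c)" unfolding m_def by (rule norm_triangle_ineq3)
    then have m: "m\<^sup>2 \<le> (cmod (a - c))\<^sup>2" by (intro power_mono) (simp_all add: m_def)
    have "p\<^sup>2 \<le> 2 * ((cmod a)\<^sup>2 + (cmod c)\<^sup>2)"
      unfolding p_def using sum_squares_bound[of "cmod a" "cmod c"] by (simp add: power2_sum)
    also have "\<dots> = (cmod (a - c))\<^sup>2 + (cmod (a + c))\<^sup>2"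
      using dot_norm[of a c] dot_norm_neg[of a c] by simp
    finally have p: "p\<^sup>2 \<le> (cmod (a - c))\<^sup>2 + (cmod (a + c))\<^sup>2" .
    have "\<bar>(cmod a)\<^sup>2 - (cmod c)\<^sup>2\<bar> = m * p"
      by (simp add: m_def p_def power2_eq_square square_diff_square_factored abs_mult)
    also have "\<dots> \<le> s / 2 * m\<^sup>2 + 1 / (2 * s) * p\<^sup>2"
    proof -
      have "0 \<le> (s * m - p)\<^sup>2 / (2 * s)" using \<open>0 < s\<close> by simp
      then show ?thesis using \<open>0 < s\<close> by (simp add: power2_eq_square field_simps)
    qed
    also have "\<dots> \<le> s / 2 * (cmod (a - c))\<^sup>2 + 1 / (2 * s) * ((cmod (a - c))\<^sup>2 + (cmod (a + c))\<^sup>2)"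
      using \<open>0 < s\<close> by (intro add_mono mult_left_mono m p) auto
    finally show ?thesis by (simp add: algebra_simps)
  qed
  have b_bound: "(case p of (x, y) \<Rightarrow> \<bar>(cmod (u x))\<^sup>2 - (cmod (u y))\<^sup>2\<bar>) \<le> b p" for p
    using bound[of "u (fst p)" "u (snd p)"] by (simp add: b_def case_prod_beta)
  have variation: "(\<lambda>(x, y). \<bar>(cmod (u x))\<^sup>2 - (cmod (u y))\<^sup>2\<bar>) summable_on E"
    by (rule summable_on_comparison_test[OF has_sum_imp_summable[OF b_sum] b_bound]) auto
  have "h * ?N \<le> (\<Sum>\<^sub>\<infinity>(x, y)\<in>E. \<bar>(cmod (u x))\<^sup>2 - (cmod (u y))\<^sup>2\<bar>)"
    by (rule isoperimetric_ell2[OF iso \<open>0 < h\<close> u variation])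
  also have "\<dots> \<le> infsum b E"
    by (rule infsum_mono[OF variation has_sum_imp_summable[OF b_sum] b_bound])
  also have "\<dots> = s * (real d * ?N - ?q) + 2 * real d / s * ?N"
  proof -
    define r where "r = 1 / (2 * s)"
    have "infsum b E = (s / 2 + r) * (2 * (real d * ?N - ?q)) + r * (2 * (real d * ?N + ?q))"
      using infsumI[OF b_sum] unfolding r_def .
    also have "\<dots> = s * (real d * ?N - ?q) + 4 * r * real d * ?N" by (simp add: algebra_simps)
    finally show ?thesis by (simp add: r_def)
  qed
  also have "2 * real d / s = h / 2" using degree_pos \<open>0 < h\<close> by (simp add: s_def)
  finally have "h / 2 * ?N \<le> 4 * real d / h * (real d * ?N - ?q)" by (simp add: s_def)
  then have "h / (4 * real d) * (h / 2 * ?N) \<le> h / (4 * real d) * (4 * real d / h * (real d * ?N - ?q))"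
    using \<open>0 < h\<close> by (intro mult_left_mono) auto
  also have "\<dots> = real d * ?N - ?q" using degree_pos \<open>0 < h\<close> by simp
  finally show "?q \<le> (real d - h\<^sup>2 / (8 * real d)) * ?N"
    by (simp add: algebra_simps power2_eq_square)
qed

text \<open>
  Without a spectral gap no positive isoperimetric constant can exist, so there are finite sets with
  an arbitrarily small ratio of boundary to volume.
\<close>

lemma amenable_if_sup_eq_degree:
  assumes "adjacency_sup = real d"
  shows "amenable V E"
proof -
  have "\<exists>\<Omega>. finite \<Omega> \<and> \<Omega> \<noteq> {} \<and> \<Omega> \<subseteq> V \<and> real (card (inner_boundary E \<Omega>)) < h * real (card \<Omega>)"
    if "0 < h" for h
  proof (rule ccontr)
    assume "\<not> ?thesis"
    then have "adjacency_sup \<le> real d - h\<^sup>2 / (8 * real d)"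
      using \<open>0 < h\<close> by (intro Cheeger_gap) (auto simp: not_less)
    moreover have "0 < h\<^sup>2 / (8 * real d)" using \<open>0 < h\<close> degree_pos by simp
    ultimately show False using assms by simp
  qed
  then have "\<forall>n. \<exists>\<Omega>. finite \<Omega> \<and> \<Omega> \<noteq> {} \<and> \<Omega> \<subseteq> V \<and>
      real (card (inner_boundary E \<Omega>)) < inverse (real (Suc n)) * real (card \<Omega>)"
    by simp
  then obtain \<Omega> where \<Omega>: "\<And>n. finite (\<Omega> n) \<and> \<Omega> n \<noteq> {} \<and> \<Omega> n \<subseteq> V"
    and small: "\<And>n. real (card (inner_boundary E (\<Omega> n))) < inverse (real (Suc n)) * real (card (\<Omega> n))"
    by metis
  have "(\<lambda>n. real (card (inner_boundary E (\<Omega> n))) / real (card (\<Omega> n))) \<longlonglongrightarrow> 0"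
  proof (rule tendsto_sandwich[OF _ _ tendsto_const LIMSEQ_inverse_real_of_nat])
    have "0 < card (\<Omega> n)" for n using \<Omega> by (simp add: card_gt_0_iff)
    then show "\<forall>\<^sub>F n in sequentially. real (card (inner_boundary E (\<Omega> n))) / real (card (\<Omega> n)) \<le> inverse (real (Suc n))"
      using small by (intro always_eventually allI) (simp add: pos_divide_le_eq less_imp_le)
  qed simp
  then show ?thesis unfolding amenable_def using \<Omega> by blast
qed

end

section \<open>Bipartite graphs\<close>

context regular_nonempty_graph
begin

text \<open>
  On a bipartite graph take the indicator of \<open>\<Omega>\<close> with opposite signs on the two classes. The signless
  Laplacian annihilates it at the points of \<open>\<Omega>\<close> off the boundary, and it vanishes outside \<open>\<Omega>\<close>; so
  only the boundary contributes to its energy.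
\<close>

lemma bipartite_test_function:
  assumes bipartite: "bipartite V E" and \<Omega>: "finite \<Omega>" "\<Omega> \<subseteq> V"
  shows "(real d + adjacency_inf) * real (card \<Omega>) \<le> real d * real (card (inner_boundary E \<Omega>))"
proof -
  obtain X Y where XY: "X \<union> Y = V" "X \<inter> Y = {}" "E \<subseteq> X \<times> Y \<union> Y \<times> X"
    using bipartite by (auto simp: bipartite_def)
  define \<sigma> :: "'v \<Rightarrow> complex" where "\<sigma> x = (if x \<in> X then 1 else - 1)" for x
  define u where "u x = \<sigma> x * of_bool (x \<in> \<Omega>)" for x
  have alternate: "\<sigma> y = - \<sigma> x" if "(x, y) \<in> E" for x y
    using XY that by (auto simp: \<sigma>_def)
  have unit: "\<sigma> x \<bullet> \<sigma> x = 1" for x by (simp add: \<sigma>_def)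
  have u: "u \<in> ell2 V" by (rule ell2_finite_support[OF \<Omega>]) (simp add: u_def)
  have norm: "(ell2_norm V u)\<^sup>2 = real (card \<Omega>)"
  proof -
    have "(ell2_norm V u)\<^sup>2 = (\<Sum>\<^sub>\<infinity>x\<in>\<Omega>. 1)"
      unfolding ell2_norm_square_infsum
      by (rule infsum_cong_neutral) (use \<Omega> in \<open>auto simp: u_def \<sigma>_def\<close>)
    then show ?thesis using \<Omega> by simp
  qed
  have local: "signless_laplacian E d u x \<bullet> u x \<le> real d * of_bool (x \<in> inner_boundary E \<Omega>)"
    if "x \<in> \<Omega>" for x
  proof -
    have "(\<Sum>y\<in>E `` {x}. u y \<bullet> u x) = (\<Sum>y\<in>E `` {x}. - of_bool (y \<in> \<Omega>))"
    proof (rule sum.cong)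
      fix y assume "y \<in> E `` {x}"
      then have "\<sigma> y = - \<sigma> x" by (intro alternate) auto
      then show "u y \<bullet> u x = - of_bool (y \<in> \<Omega>)" using unit[of x] that by (simp add: u_def)
    qed simp
    moreover have "(of_nat d * u x) \<bullet> u x = real d"
      using unit[of x] that by (simp add: u_def inner_complex_def algebra_simps flip: distrib_left)
    ultimately have eq: "signless_laplacian E d u x \<bullet> u x = real d - (\<Sum>y\<in>E `` {x}. of_bool (y \<in> \<Omega>))"
      by (simp add: signless_laplacian_def adjacency_op_def inner_add_left inner_sum_left sum_negf)
    show ?thesis
    proof (cases "x \<in> inner_boundary E \<Omega>")
      case True
      then show ?thesis by (simp add: eq sum_nonneg)
    next
      case False
      then have "\<forall>y\<in>E `` {x}. y \<in> \<Omega>" using that by (auto simp: inner_boundary_def)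
      then have "(\<Sum>y\<in>E `` {x}. of_bool (y \<in> \<Omega>) :: real) = (\<Sum>y\<in>E `` {x}. 1)"
        by (intro sum.cong) auto
      then show ?thesis using False card_neighbours[of x] that \<Omega> by (auto simp: eq)
    qed
  qed
  have "(real d + adjacency_inf) * real (card \<Omega>) \<le> ell2_inner V (signless_laplacian E d u) u"
    using adjacency_le_inf_iff[of adjacency_inf] u
    by (simp add: signless_laplacian_form norm algebra_simps flip: norm)
  also have "\<dots> = (\<Sum>\<^sub>\<infinity>x\<in>\<Omega>. signless_laplacian E d u x \<bullet> u x)"
    unfolding ell2_inner_def by (rule infsum_cong_neutral) (use \<Omega> in \<open>auto simp: u_def\<close>)
  also have "\<dots> \<le> (\<Sum>x\<in>\<Omega>. real d * of_bool (x \<in> inner_boundary E \<Omega>))"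
    by (subst infsum_finite[OF \<Omega>(1)]) (intro sum_mono local)
  also have "\<dots> = real d * real (card (inner_boundary E \<Omega>))"
  proof -
    have "inner_boundary E \<Omega> \<subseteq> \<Omega>" by (auto simp: inner_boundary_def)
    then show ?thesis using \<Omega> by (simp add: of_bool_def sum.If_cases Int_absorb1 flip: sum_distrib_left)
  qed
  finally show ?thesis .
qed

lemma bipartite_amenable_conditions:
  assumes "bipartite V E" and "amenable V E"
  shows "all_conditions V E d"
proof -
  obtain \<Omega> where \<Omega>: "\<And>R. finite (\<Omega> R) \<and> \<Omega> R \<noteq> {} \<and> \<Omega> R \<subseteq> V"
    and lim: "(\<lambda>R. real (card (inner_boundary E (\<Omega> R))) / real (card (\<Omega> R))) \<longlonglongrightarrow> 0"
    using assms(2) by (auto simp: amenable_def)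
  have "real d + adjacency_inf \<le> real d * (real (card (inner_boundary E (\<Omega> R))) / real (card (\<Omega> R)))" for R
  proof -
    have "0 < card (\<Omega> R)" using \<Omega>[of R] by (simp add: card_gt_0_iff)
    then show ?thesis
      using bipartite_test_function[OF assms(1), of "\<Omega> R"] \<Omega>[of R] by (simp add: le_divide_eq)
  qed
  then have "real d + adjacency_inf \<le> real d * 0"
    by (intro LIMSEQ_le_const[OF tendsto_mult[OF tendsto_const lim]]) auto
  then show ?thesis using adjacency_inf_ge by (simp add: all_conditions_iff)
qed

text \<open>
  The whole vertex set has no boundary.
\<close>

lemma finite_amenable:
  assumes "finite V"
  shows "amenable V E"
proof -
  have "inner_boundary E V = {}" using edge_vertices by (auto simp: inner_boundary_def)
  then show ?thesis unfolding amenable_def using assms nonempty by (intro exI[of _ "\<lambda>_. V"]) simp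
qed

lemma (in -) finite_pointwise_bounded_subsequence:
  fixes U :: "nat \<Rightarrow> 'a \<Rightarrow> 'b::heine_borel"
  assumes "finite F" and "\<And>x. x \<in> F \<Longrightarrow> bounded (range (\<lambda>n. U n x))"
  shows "\<exists>r l. strict_mono r \<and> (\<forall>x\<in>F. (\<lambda>n. U (r n) x) \<longlonglongrightarrow> l x)"
  using assms
proof (induction F)
  case empty
  then show ?case by (auto intro: exI[of _ "id :: nat \<Rightarrow> nat"] simp: strict_mono_def)
next
  case (insert a F)
  then obtain r l where r: "strict_mono r" "\<And>x. x \<in> F \<Longrightarrow> (\<lambda>n. U (r n) x) \<longlonglongrightarrow> l x" by auto
  have "bounded (range (\<lambda>n. U (r n) a))"
    using insert.prems[of a] by (rule bounded_subset) auto
  then obtain m s where s: "strict_mono s" "((\<lambda>n. U (r n) a) \<circ> s) \<longlonglongrightarrow> m"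
    using bounded_imp_convergent_subsequence by blast
  have "strict_mono (r \<circ> s)" using r(1) s(1) by (rule strict_mono_o)
  moreover have "(\<lambda>n. U ((r \<circ> s) n) x) \<longlonglongrightarrow> (l(a := m)) x" if "x \<in> insert a F" for x
  proof (cases "x = a")
    case True
    then show ?thesis using s(2) by (simp add: o_def)
  next
    case False
    then show ?thesis using LIMSEQ_subseq_LIMSEQ[OF r(2) s(1), of x] that by (simp add: o_def)
  qed
  ultimately show ?case by blast
qed

text \<open>
  On a finite graph the infimum of the energy is attained, by compactness; a function \<open>u\<close> without
  energy changes sign along every edge, so that connectedness splits \<open>V\<close> into \<open>u = c\<close> and \<open>u = - c\<close>.
\<close>

lemma finite_extremal_bipartite:
  assumes "finite V" and "connected_graph V E" and extremal: "adjacency_inf = - real d"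
  shows "bipartite V E"
proof -
  have "\<exists>u. u \<in> ell2 V \<and> ell2_norm V u = 1 \<and> ell2_inner V (signless_laplacian E d u) u < inverse (real (Suc n))" for n
  proof -
    define F where "F u = (\<Sum>\<^sub>\<infinity>e\<in>edges E. edge_value (\<lambda>x y. (cmod (u x + u y))\<^sup>2) e)" for u
    define S where "S = {u \<in> ell2 V. ell2_norm V u = 1}"
    have "Inf (F ` S) = 0" using extremal unfolding F_def S_def energy_infimum by (simp add: signless_laplacian_inf)
    moreover have "S \<noteq> {}"
    proof -
      obtain x where x: "x \<in> V" using nonempty by blast
      have "(\<lambda>y. of_bool (y = x)) \<in> S"
      proof -
        have "(\<lambda>y. of_bool (y = x)) \<in> ell2 V"
          by (rule ell2_finite_support[of "{x}"]) (use x in auto)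
        moreover have "(\<Sum>\<^sub>\<infinity>y\<in>V. (cmod (of_bool (y = x)))\<^sup>2) = (\<Sum>\<^sub>\<infinity>y\<in>{x}. 1)"
          by (rule infsum_cong_neutral) (use x in auto)
        ultimately show ?thesis by (simp add: S_def ell2_norm_def)
      qed
      then show ?thesis by blast
    qed
    ultimately obtain u where "u \<in> S" "F u < inverse (real (Suc n))"
      using cInf_lessD[of "F ` S" "inverse (real (Suc n))"] by auto
    then show ?thesis by (auto simp: S_def F_def signless_energy)
  qed
  then obtain U where U: "\<And>n. U n \<in> ell2 V" "\<And>n. ell2_norm V (U n) = 1"
    and energy: "\<And>n. ell2_inner V (signless_laplacian E d (U n)) (U n) < inverse (real (Suc n))"
    by metis
  have "bounded (range (\<lambda>n. U n x))" for x
    using norm_le_ell2_norm[OF U(1)] U(2) by (auto intro!: boundedI[of _ 1])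
  then obtain r u where r: "strict_mono r" and lim: "\<And>x. x \<in> V \<Longrightarrow> (\<lambda>n. U (r n) x) \<longlonglongrightarrow> u x"
    using finite_pointwise_bounded_subsequence[OF assms(1), of U] by metis
  have "(\<Sum>x\<in>V. (cmod (u x))\<^sup>2) = 1"
  proof (rule LIMSEQ_unique)
    show "(\<lambda>n. \<Sum>x\<in>V. (cmod (U (r n) x))\<^sup>2) \<longlonglongrightarrow> (\<Sum>x\<in>V. (cmod (u x))\<^sup>2)"
      by (intro tendsto_intros lim)
    have "(\<Sum>x\<in>V. (cmod (U (r n) x))\<^sup>2) = 1" for n
      using U(2)[of "r n"] assms(1) ell2_norm_square_infsum[of V "U (r n)"] by simp
    then show "(\<lambda>n. \<Sum>x\<in>V. (cmod (U (r n) x))\<^sup>2) \<longlonglongrightarrow> 1" by simp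
  qed
  then have "\<not> (\<forall>x\<in>V. u x = 0)" by (intro notI) simp
  then obtain a where a: "a \<in> V" "u a \<noteq> 0" by blast
  have flip: "u y = - u x" if xy: "(x, y) \<in> E" for x y
  proof -
    have "(cmod (U n x + U n y))\<^sup>2 \<le> 2 * inverse (real (Suc n))" for n
    proof -
      note sum = edge_plus_has_sum[OF U(1)[of n]]
      have "(\<Sum>p\<in>{(x, y)}. case p of (x, y) \<Rightarrow> (cmod (U n x + U n y))\<^sup>2)
          \<le> (\<Sum>\<^sub>\<infinity>(x, y)\<in>E. (cmod (U n x + U n y))\<^sup>2)"
        by (rule finite_sum_le_infsum) (use xy has_sum_imp_summable[OF sum] in auto)
      then show ?thesis
        using infsumI[OF sum] energy[of n] by (simp add: signless_laplacian_form U(1))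
    qed
    then have small: "(cmod (U (r n) x + U (r n) y))\<^sup>2 \<le> 2 * inverse (real (Suc (r n)))" for n .
    have "(cmod (u x + u y))\<^sup>2 \<le> 2 * 0"
    proof (rule LIMSEQ_le)
      show "(\<lambda>n. (cmod (U (r n) x + U (r n) y))\<^sup>2) \<longlonglongrightarrow> (cmod (u x + u y))\<^sup>2"
        by (intro tendsto_intros lim edge_vertices[OF xy])
      show "(\<lambda>n. 2 * inverse (real (Suc (r n)))) \<longlonglongrightarrow> 2 * 0"
        using LIMSEQ_subseq_LIMSEQ[OF LIMSEQ_inverse_real_of_nat r] by (intro tendsto_intros) (simp add: o_def)
    qed (use small in blast)
    then show ?thesis by (simp add: add_eq_0_iff)
  qed
  define X Y where "X = {x\<in>V. u x = u a}" and "Y = {x\<in>V. u x = - u a}"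
  have "x \<in> X \<union> Y" if "x \<in> V" for x
  proof -
    have "(a, x) \<in> E\<^sup>*" using assms(2) that a by (simp add: connected_graph_def)
    then have "u x = u a \<or> u x = - u a"
    proof (induction rule: rtrancl_induct)
      case (step y z)
      then show ?case using flip[OF step.hyps(2)] by (elim disjE) simp_all
    qed simp
    then show ?thesis using that by (auto simp: X_def Y_def)
  qed
  then have "X \<union> Y = V" by (auto simp: X_def Y_def)
  moreover have "X \<inter> Y = {}"
  proof -
    have "u a \<noteq> - u a" using a(2) by simp
    then show ?thesis by (auto simp: X_def Y_def)
  qed
  moreover have "E \<subseteq> X \<times> Y \<union> Y \<times> X"
  proof
    fix p assume "p \<in> E"
    obtain x y where p: "p = (x, y)" by (cases p)
    then have xy: "(x, y) \<in> E" using \<open>p \<in> E\<close> by simp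
    then have "x \<in> X \<union> Y" using edge_vertices(1) \<open>X \<union> Y = V\<close> by blast
    then show "p \<in> X \<times> Y \<union> Y \<times> X"
      using flip[OF xy] edge_vertices(2)[OF xy] by (auto simp: p X_def Y_def)
  qed
  ultimately show ?thesis unfolding bipartite_def by blast
qed

end

section \<open>Periodic lattices are amenable\<close>

lemma free_abelian_group: "group (free_abelian r)"
  unfolding free_abelian_def by (intro product_group) simp

lemma free_abelian_simps:
  "carrier (free_abelian r) = (\<Pi>\<^sub>E i\<in>{..<r}. UNIV)"
  "g \<otimes>\<^bsub>free_abelian r\<^esub> h = (\<lambda>i\<in>{..<r}. g i + h i)"
  by (simp_all add: free_abelian_def integer_group_def)

lemma orbit_representatives:
  assumes "group_action G V \<phi>" and "finite (orbits G V \<phi>)"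
  obtains F where "finite F" and "F \<subseteq> V" and "\<And>x. x \<in> V \<Longrightarrow> \<exists>g\<in>carrier G. \<exists>y\<in>F. x = \<phi> g y"
proof -
  have "orbits G V \<phi> = orbit G \<phi> ` V" unfolding orbits_def by (rule Setcompr_eq_image)
  then have "finite (orbit G \<phi> ` V)" using assms(2) by simp
  from finite_subset_image[OF this subset_refl]
  obtain F where F: "F \<subseteq> V" "finite F" "orbit G \<phi> ` V = orbit G \<phi> ` F"
    by (elim exE conjE) (rule that)
  have "\<exists>g\<in>carrier G. \<exists>y\<in>F. x = \<phi> g y" if "x \<in> V" for x
  proof -
    have "orbit G \<phi> x \<in> orbit G \<phi> ` F" unfolding F(3)[symmetric] using that by (rule imageI)
    then obtain y where y: "y \<in> F" "orbit G \<phi> x = orbit G \<phi> y" by (elim imageE) (rule that)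
    have "x \<in> orbit G \<phi> y" using group_action.orbit_refl[OF assms(1) that] y(2) by simp
    then show ?thesis using y(1) by (auto simp: orbit_def)
  qed
  then show ?thesis using that F by blast
qed

context regular_nonempty_graph
begin

text \<open>
  The translates of a finite fundamental set by a box of side \<open>n\<close> in the group number at least
  \<open>n ^ r\<close>, as the action is free. A neighbour of a translate by \<open>g\<close> is a translate by \<open>g + h\<close> with
  \<open>\<bar>h i\<bar> \<le> K\<close>; so only the \<open>n ^ r - (n - 2 K) ^ r\<close> elements \<open>g\<close> near the boundary of the box
  contribute to the boundary of this set.
\<close>

lemma periodic_amenable:
  assumes "periodic V E"
  shows "amenable V E"
proof -
  obtain r \<phi> where action: "group_action (free_abelian r) V \<phi>"
    and free: "\<forall>g\<in>carrier (free_abelian r). \<forall>x\<in>V. \<phi> g x = x \<longrightarrow> g = \<one>\<^bsub>free_abelian r\<^esub>"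
    and invariant: "\<forall>g\<in>carrier (free_abelian r). \<forall>x y. (x, y) \<in> E \<longrightarrow> (\<phi> g x, \<phi> g y) \<in> E"
    and orbits: "finite (orbits (free_abelian r) V \<phi>)"
    using assms unfolding periodic_def by (elim exE conjE) (rule that)
  define G where "G = free_abelian r"
  interpret G: group G unfolding G_def by (rule free_abelian_group)
  interpret group_action G V \<phi> unfolding G_def by (rule action)
  obtain F where F: "finite F" "F \<subseteq> V" and cover: "\<And>x. x \<in> V \<Longrightarrow> \<exists>g\<in>carrier G. \<exists>y\<in>F. x = \<phi> g y"
    using orbit_representatives[OF action orbits] unfolding G_def by blast
  have "F \<noteq> {}" using cover nonempty by blast
  then obtain y0 where y0: "y0 \<in> F" by blast
  define Z where "Z = (\<Union>y\<in>F. E `` {y})"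
  have "finite Z" using F finite_neighbours by (simp add: Z_def)
  have "\<forall>z\<in>Z. \<exists>g. g \<in> carrier G \<and> (\<exists>w\<in>F. z = \<phi> g w)"
  proof
    fix z assume "z \<in> Z"
    then have "z \<in> V" using edge_vertices by (auto simp: Z_def)
    from cover[OF this] show "\<exists>g. g \<in> carrier G \<and> (\<exists>w\<in>F. z = \<phi> g w)" by blast
  qed
  from bchoice[OF this] obtain s where s: "\<forall>z\<in>Z. s z \<in> carrier G \<and> (\<exists>w\<in>F. z = \<phi> (s z) w)" ..
  define K where "K = (\<Sum>z\<in>Z. \<Sum>i<r. nat \<bar>s z i\<bar>)"
  have s_le: "\<bar>s z i\<bar> \<le> int K" if "z \<in> Z" "i < r" for z i
  proof -
    have "nat \<bar>s z i\<bar> \<le> (\<Sum>i<r. nat \<bar>s z i\<bar>)" using that by (intro member_le_sum) auto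
    also have "\<dots> \<le> K" unfolding K_def using that \<open>finite Z\<close> by (intro member_le_sum) auto
    finally show ?thesis by simp
  qed
  define Box where "Box n = (\<Pi>\<^sub>E i\<in>{..<r}. {0..<int n})" for n
  define Inner where "Inner n = (\<Pi>\<^sub>E i\<in>{..<r}. {int K..<int n - int K})" for n
  have Box: "Box n \<subseteq> carrier G" "finite (Box n)" "card (Box n) = n ^ r" for n
    by (auto simp: Box_def G_def free_abelian_simps card_PiE intro!: finite_PiE)
  have Inner: "Inner n \<subseteq> Box n" "card (Inner n) = (n - 2 * K) ^ r" for n
  proof -
    show "Inner n \<subseteq> Box n" unfolding Inner_def Box_def by (rule PiE_mono) auto
    have "nat (int n - int K - int K) = n - 2 * K" by simp
    then show "card (Inner n) = (n - 2 * K) ^ r" by (simp add: Inner_def card_PiE)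
  qed
  define \<Omega> where "\<Omega> n = (\<lambda>(g, y). \<phi> g y) ` (Box n \<times> F)" for n
  have \<Omega>: "finite (\<Omega> n)" "\<Omega> n \<subseteq> V" for n
  proof -
    show "finite (\<Omega> n)" unfolding \<Omega>_def using Box F by simp
    have "\<phi> g y \<in> V" if "g \<in> Box n" "y \<in> F" for g y
      using element_image[of g y "\<phi> g y"] that Box F by blast
    then show "\<Omega> n \<subseteq> V" by (auto simp: \<Omega>_def)
  qed
  have volume: "n ^ r \<le> card (\<Omega> n)" for n
  proof -
    have "inj_on (\<lambda>g. \<phi> g y0) (Box n)"
    proof (rule inj_onI)
      fix g h assume gh: "g \<in> Box n" "h \<in> Box n" "\<phi> g y0 = \<phi> h y0"
      then have carrier: "g \<in> carrier G" "h \<in> carrier G" using Box by blast+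
      have y0V: "y0 \<in> V" using y0 F by blast
      have "\<phi> (inv\<^bsub>G\<^esub> h \<otimes>\<^bsub>G\<^esub> g) y0 = \<phi> (inv\<^bsub>G\<^esub> h) (\<phi> h y0)"
        using composition_rule[OF y0V _ carrier(1), of "inv\<^bsub>G\<^esub> h"] carrier gh(3) by simp
      also have "\<dots> = y0" by (rule orbit_sym_aux[OF carrier(2) y0V refl])
      finally have "inv\<^bsub>G\<^esub> h \<otimes>\<^bsub>G\<^esub> g = \<one>\<^bsub>G\<^esub>"
        using free[folded G_def, rule_format, of "inv\<^bsub>G\<^esub> h \<otimes>\<^bsub>G\<^esub> g" y0] carrier y0V by simp
      then show "g = h" using carrier by (metis G.inv_closed G.inv_equality G.inv_inv)
    qed
    then have "card (Box n) = card ((\<lambda>g. \<phi> g y0) ` Box n)" by (simp add: card_image)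
    also have "\<dots> \<le> card (\<Omega> n)" by (rule card_mono[OF \<Omega>(1)]) (use y0 in \<open>auto simp: \<Omega>_def\<close>)
    finally show ?thesis by (simp add: Box)
  qed
  have boundary: "inner_boundary E (\<Omega> n) \<subseteq> (\<lambda>(g, y). \<phi> g y) ` ((Box n - Inner n) \<times> F)" for n
  proof
    fix x assume "x \<in> inner_boundary E (\<Omega> n)"
    then obtain x' where "x \<in> \<Omega> n" and xx': "(x, x') \<in> E" "x' \<notin> \<Omega> n"
      unfolding inner_boundary_def by blast
    then obtain g y where g: "g \<in> Box n" and y: "y \<in> F" and x: "x = \<phi> g y"
      unfolding \<Omega>_def by auto
    have carrier: "g \<in> carrier G" using g Box by blast
    define z where "z = \<phi> (inv\<^bsub>G\<^esub> g) x'"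
    have yV: "y \<in> V" using y F by blast
    have "(\<phi> (inv\<^bsub>G\<^esub> g) x, z) \<in> E"
      unfolding z_def using invariant[folded G_def] xx'(1) carrier G.inv_closed by blast
    moreover have "\<phi> (inv\<^bsub>G\<^esub> g) x = y" using orbit_sym_aux[OF carrier yV] x by simp
    ultimately have "(y, z) \<in> E" by simp
    then have "z \<in> Z" using y unfolding Z_def by blast
    then obtain w where w: "w \<in> F" "z = \<phi> (s z) w" and sz: "s z \<in> carrier G"
      using s[rule_format, OF \<open>z \<in> Z\<close>] by blast
    have "x' = \<phi> g z"
      using orbit_sym_aux[of "inv\<^bsub>G\<^esub> g" x' z] carrier edge_vertices(2)[OF xx'(1)] by (simp add: z_def)
    also have "\<dots> = \<phi> (g \<otimes>\<^bsub>G\<^esub> s z) w"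
    proof -
      have "w \<in> V" using w(1) F by blast
      then show ?thesis by (subst w(2)) (simp add: composition_rule carrier sz)
    qed
    finally have "g \<otimes>\<^bsub>G\<^esub> s z \<notin> Box n" using xx'(2) w(1) unfolding \<Omega>_def by force
    have "g \<notin> Inner n"
    proof
      assume "g \<in> Inner n"
      then have "g i + s z i \<in> {0..<int n}" if "i < r" for i
      proof -
        have "g i \<in> {int K..<int n - int K}"
          using \<open>g \<in> Inner n\<close> that unfolding Inner_def by (intro PiE_mem[of g]) auto
        then show ?thesis using s_le[OF \<open>z \<in> Z\<close> that] by auto
      qed
      then show False
        using \<open>g \<otimes>\<^bsub>G\<^esub> s z \<notin> Box n\<close> by (auto simp: Box_def G_def free_abelian_simps)
    qed
    then show "x \<in> (\<lambda>(g, y). \<phi> g y) ` ((Box n - Inner n) \<times> F)" using g y x by blast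
  qed
  have "card (inner_boundary E (\<Omega> n)) \<le> (n ^ r - (n - 2 * K) ^ r) * card F" for n
  proof -
    have fin: "finite ((Box n - Inner n) \<times> F)" using Box F by simp
    have "card (inner_boundary E (\<Omega> n)) \<le> card ((Box n - Inner n) \<times> F)"
      by (rule order_trans[OF card_mono[OF finite_imageI[OF fin] boundary] card_image_le[OF fin]])
    also have "\<dots> = (n ^ r - (n - 2 * K) ^ r) * card F"
    proof -
      have "finite (Inner n)" using Inner(1) Box(2) by (rule finite_subset)
      then have "card (Box n - Inner n) = n ^ r - (n - 2 * K) ^ r"
        using Inner[of n] Box[of n] by (simp add: card_Diff_subset)
      then show ?thesis by (simp add: card_cartesian_product)
    qed
    finally show ?thesis .
  qed
  then have ratio: "real (card (inner_boundary E (\<Omega> n))) / real (card (\<Omega> n))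
      \<le> (1 - (real (n - 2 * K) / real n) ^ r) * real (card F)" if "0 < n" for n
  proof -
    have "real (card (inner_boundary E (\<Omega> n))) / real (card (\<Omega> n))
        \<le> real ((n ^ r - (n - 2 * K) ^ r) * card F) / real (n ^ r)"
      using that volume[of n] \<open>card (inner_boundary E (\<Omega> n)) \<le> _\<close>
      by (intro frac_le) (simp_all only: of_nat_le_iff of_nat_0_le_iff of_nat_0_less_iff zero_less_power)
    also have "\<dots> = (1 - (real (n - 2 * K) / real n) ^ r) * real (card F)"
      using that by (simp add: of_nat_diff power_mono power_divide field_simps)
    finally show ?thesis .
  qed
  \<comment> \<open>the shift keeps the side of the box above \<open>2 K\<close>, where truncated subtraction is harmless\<close>
  define N where "N R = R + 2 * K + 1" for R
  have N: "0 < N R" "real (N R - 2 * K) / real (N R) = 1 - real (2 * K) / real (R + (2 * K + 1))" for R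
    by (simp_all add: N_def field_simps)
  have "(\<lambda>R. real (2 * K) / real (R + (2 * K + 1))) \<longlonglongrightarrow> 0"
    by (rule LIMSEQ_ignore_initial_segment[OF lim_const_over_n])
  then have "(\<lambda>R. (1 - (1 - real (2 * K) / real (R + (2 * K + 1))) ^ r) * real (card F))
      \<longlonglongrightarrow> (1 - (1 - 0) ^ r) * real (card F)"
    by (intro tendsto_intros)
  then have upper: "(\<lambda>R. (1 - (real (N R - 2 * K) / real (N R)) ^ r) * real (card F)) \<longlonglongrightarrow> 0"
    by (simp add: N(2))
  have "(\<lambda>R. real (card (inner_boundary E (\<Omega> (N R)))) / real (card (\<Omega> (N R)))) \<longlonglongrightarrow> 0"
    by (rule tendsto_sandwich[OF _ _ tendsto_const upper]) (simp_all add: ratio N(1))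
  moreover have "\<Omega> (N R) \<noteq> {}" for R
    using volume[of "N R"] N(1)[of R] by (metis card.empty not_le zero_less_power)
  ultimately show ?thesis unfolding amenable_def using \<Omega> by (intro exI[of _ "\<lambda>R. \<Omega> (N R)"]) simp
qed

end

section \<open>Actions by integer vectors\<close>

text \<open>
  Periodicity refers to integer sequences of length \<open>r\<close>, while the concrete lattices have vectors as
  translations; a numbering of the coordinates mediates.
\<close>

lemma integer_vector_coordinates:
  obtains vec :: "(nat \<Rightarrow> int) \<Rightarrow> int ^ 'n" where
    "bij_betw vec (carrier (free_abelian CARD('n))) UNIV"
    "\<And>g h. vec (g \<otimes>\<^bsub>free_abelian CARD('n)\<^esub> h) = vec g + vec h"
proof -
  obtain \<beta> :: "nat \<Rightarrow> 'n" where "bij_betw \<beta> {0..<CARD('n)} UNIV"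
    using ex_bij_betw_nat_finite[of "UNIV :: 'n set"] by auto
  then have \<beta>: "bij_betw \<beta> {..<CARD('n)} UNIV" by (simp add: atLeast0LessThan)
  define \<gamma> where "\<gamma> = inv_into {..<CARD('n)} \<beta>"
  have \<gamma>: "\<gamma> i < CARD('n)" "\<beta> (\<gamma> i) = i" for i
    using bij_betwE[OF bij_betw_inv_into[OF \<beta>]] bij_betw_inv_into_right[OF \<beta>] by (auto simp: \<gamma>_def)
  have \<gamma>\<beta>: "\<gamma> (\<beta> k) = k" if "k < CARD('n)" for k
    using bij_betw_inv_into_left[OF \<beta>] that by (simp add: \<gamma>_def)
  define vec :: "(nat \<Rightarrow> int) \<Rightarrow> int ^ 'n" where "vec g = (\<chi> i. g (\<gamma> i))" for g
  have "bij_betw vec (carrier (free_abelian CARD('n))) UNIV"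
  proof (rule bij_betw_byWitness[where f' = "\<lambda>a. \<lambda>k\<in>{..<CARD('n)}. a $ \<beta> k"])
    show "\<forall>g\<in>carrier (free_abelian CARD('n)). (\<lambda>k\<in>{..<CARD('n)}. vec g $ \<beta> k) = g"
    proof
      fix g assume "g \<in> carrier (free_abelian CARD('n))"
      then have "g \<in> extensional {..<CARD('n)}" by (simp add: free_abelian_simps PiE_iff)
      then show "(\<lambda>k\<in>{..<CARD('n)}. vec g $ \<beta> k) = g"
        by (intro extensionalityI[OF restrict_extensional]) (simp_all add: vec_def \<gamma>\<beta>)
    qed
    show "\<forall>a\<in>UNIV. vec (\<lambda>k\<in>{..<CARD('n)}. a $ \<beta> k) = a"
      by (simp add: vec_def vec_eq_iff \<gamma>)
  qed (simp_all add: free_abelian_simps image_subset_iff PiE_iff)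
  moreover have "vec (g \<otimes>\<^bsub>free_abelian CARD('n)\<^esub> h) = vec g + vec h" for g h
    by (simp add: vec_def free_abelian_simps vec_eq_iff \<gamma>)
  ultimately show ?thesis using that by blast
qed

text \<open>
  Every edge is a translate of one that starts in the fundamental set, so local finiteness bounds the
  number of edge orbits.
\<close>

lemma translations_periodic:
  fixes \<tau> :: "int ^ 'n \<Rightarrow> 'v \<Rightarrow> 'v"
  assumes E: "E \<subseteq> V \<times> V" and "locally_finite V E"
    and \<tau>_closed: "\<And>a x. x \<in> V \<Longrightarrow> \<tau> a x \<in> V"
    and \<tau>_0: "\<And>x. x \<in> V \<Longrightarrow> \<tau> 0 x = x"
    and \<tau>_add: "\<And>a b x. x \<in> V \<Longrightarrow> \<tau> (a + b) x = \<tau> a (\<tau> b x)"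
    and free: "\<And>a x. x \<in> V \<Longrightarrow> \<tau> a x = x \<Longrightarrow> a = 0"
    and invariant: "\<And>a x y. (x, y) \<in> E \<Longrightarrow> (\<tau> a x, \<tau> a y) \<in> E"
    and F: "finite F" "F \<subseteq> V" and cover: "\<And>x. x \<in> V \<Longrightarrow> \<exists>a. \<exists>y\<in>F. x = \<tau> a y"
  shows "periodic V E"
proof -
  define G where "G = free_abelian CARD('n)"
  obtain vec :: "(nat \<Rightarrow> int) \<Rightarrow> int ^ 'n" where bij: "bij_betw vec (carrier G) UNIV"
    and vec_add: "\<And>g h. vec (g \<otimes>\<^bsub>G\<^esub> h) = vec g + vec h"
    using integer_vector_coordinates[where 'n = 'n] unfolding G_def by metis
  interpret G: group G unfolding G_def by (rule free_abelian_group)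
  have vec_1: "vec \<one>\<^bsub>G\<^esub> = 0" using vec_add[of "\<one>\<^bsub>G\<^esub>" "\<one>\<^bsub>G\<^esub>"] by simp
  define \<phi> where "\<phi> g = restrict (\<tau> (vec g)) V" for g
  have \<phi>: "\<phi> g x = \<tau> (vec g) x" if "x \<in> V" for g x using that by (simp add: \<phi>_def)
  have \<phi>_image: "\<phi> g ` e = \<tau> (vec g) ` e" if "e \<subseteq> V" for g e
    by (rule image_cong) (use that \<phi> in auto)
  have inverse: "\<tau> (- a) (\<tau> a x) = x" "\<tau> a (\<tau> (- a) x) = x" if "x \<in> V" for a x
    using \<tau>_add[OF that, of "- a" a] \<tau>_add[OF that, of a "- a"] \<tau>_0[OF that] by simp_all
  have Bij: "\<phi> g \<in> Bij V" for g
  proof -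
    have "bij_betw (\<tau> (vec g)) V V"
      by (rule bij_betw_byWitness[where f' = "\<tau> (- vec g)"]) (auto simp: inverse \<tau>_closed)
    then have "bij_betw (\<phi> g) V V" by (rule bij_betw_cong[THEN iffD1, rotated]) (simp add: \<phi>)
    then show ?thesis by (simp add: Bij_def \<phi>_def)
  qed
  have "\<phi> \<in> hom G (BijGroup V)"
  proof (rule homI)
    fix g h
    show "\<phi> (g \<otimes>\<^bsub>G\<^esub> h) = \<phi> g \<otimes>\<^bsub>BijGroup V\<^esub> \<phi> h"
    proof -
      have "\<phi> g \<otimes>\<^bsub>BijGroup V\<^esub> \<phi> h = compose V (\<phi> g) (\<phi> h)" using Bij by (simp add: BijGroup_def)
      also have "\<dots> = \<phi> (g \<otimes>\<^bsub>G\<^esub> h)"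
        by (rule extensionalityI[of _ V])
           (auto simp: compose_def \<phi>_def vec_add \<tau>_add \<tau>_closed)
      finally show ?thesis ..
    qed
  qed (simp add: BijGroup_def Bij)
  then have action: "group_action G V \<phi>"
    unfolding group_action_def group_hom_def group_hom_axioms_def
    using G.is_group group_BijGroup by blast
  have vec_range: "vec ` carrier G = UNIV" using bij by (simp add: bij_betw_def)
  have vertex_orbit: "orbit G \<phi> x = range (\<lambda>a. \<tau> a x)" if "x \<in> V" for x
  proof -
    have "orbit G \<phi> x = (\<lambda>a. \<tau> a x) ` (vec ` carrier G)" using that by (auto simp: orbit_def \<phi>)
    then show ?thesis by (simp add: vec_range)
  qed
  have edge_orbit: "orbit G (\<lambda>g e. \<phi> g ` e) e = range (\<lambda>a. \<tau> a ` e)" if "e \<subseteq> V" for e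
  proof -
    have "orbit G (\<lambda>g e. \<phi> g ` e) e = (\<lambda>a. \<tau> a ` e) ` (vec ` carrier G)"
      using that by (auto simp: orbit_def \<phi>_image)
    then show ?thesis by (simp add: vec_range)
  qed
  have shift: "range (\<lambda>a. f (a + b)) = range f" for f :: "int ^ 'n \<Rightarrow> 'c" and b
    using image_image[of f "\<lambda>a. a + b" UNIV] by simp
  have "orbits G V \<phi> \<subseteq> orbit G \<phi> ` F"
  proof
    fix A assume "A \<in> orbits G V \<phi>"
    then obtain x where x: "x \<in> V" "A = orbit G \<phi> x" by (auto simp: orbits_def)
    obtain b y where y: "y \<in> F" "x = \<tau> b y" using cover[OF x(1)] by blast
    then have yV: "y \<in> V" using F by blast
    have "A = range (\<lambda>a. \<tau> (a + b) y)" using x vertex_orbit y(2) \<tau>_add[OF yV] by simp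
    also have "\<dots> = orbit G \<phi> y" using shift[of "\<lambda>a. \<tau> a y" b] vertex_orbit[OF yV] by simp
    finally show "A \<in> orbit G \<phi> ` F" using y(1) by blast
  qed
  then have vertex_orbits: "finite (orbits G V \<phi>)" using F(1) by (rule finite_subset[OF _ finite_imageI])
  let ?R = "Sigma F (\<lambda>y. E `` {y})"
  have "orbits G (edges E) (\<lambda>g e. \<phi> g ` e) \<subseteq> (\<lambda>(y, z). orbit G (\<lambda>g e. \<phi> g ` e) {y, z}) ` ?R"
  proof
    fix A assume "A \<in> orbits G (edges E) (\<lambda>g e. \<phi> g ` e)"
    then obtain x x' where xx': "(x, x') \<in> E" and A: "A = orbit G (\<lambda>g e. \<phi> g ` e) {x, x'}"
      by (auto simp: orbits_def edges_def)
    then have V: "x \<in> V" "x' \<in> V" using E by auto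
    obtain b y where y: "y \<in> F" "x = \<tau> b y" using cover[OF V(1)] by blast
    then have yV: "y \<in> V" using F by blast
    define z where "z = \<tau> (- b) x'"
    have z: "x' = \<tau> b z" "z \<in> V" using V by (simp_all add: z_def inverse \<tau>_closed)
    have "(\<tau> (- b) x, z) \<in> E" unfolding z_def by (rule invariant[OF xx'])
    then have "(y, z) \<in> E" using inverse(1)[OF yV] y(2) by simp
    have "A = range (\<lambda>a. \<tau> a ` {x, x'})" using A edge_orbit[of "{x, x'}"] V by simp
    also have "\<dots> = range (\<lambda>a. \<tau> (a + b) ` {y, z})" using \<tau>_add yV z y(2) by simp
    also have "\<dots> = orbit G (\<lambda>g e. \<phi> g ` e) {y, z}"
      using shift[of "\<lambda>a. \<tau> a ` {y, z}" b] edge_orbit[of "{y, z}"] yV z(2) by simp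
    finally show "A \<in> (\<lambda>(y, z). orbit G (\<lambda>g e. \<phi> g ` e) {y, z}) ` ?R"
      using \<open>(y, z) \<in> E\<close> y(1) by (intro image_eqI[of _ _ "(y, z)"]) auto
  qed
  moreover have "finite ?R" using F assms(2) by (auto simp: locally_finite_def)
  ultimately have edge_orbits: "finite (orbits G (edges E) (\<lambda>g e. \<phi> g ` e))"
    by (meson finite_imageI finite_subset)
  have "g = \<one>\<^bsub>G\<^esub>" if g: "g \<in> carrier G" and x: "x \<in> V" "\<phi> g x = x" for g x
  proof -
    have "vec g = vec \<one>\<^bsub>G\<^esub>" using free[OF x(1), of "vec g"] x by (simp add: \<phi> vec_1)
    then show ?thesis using bij g by (auto simp: bij_betw_def dest: inj_onD)
  qed
  moreover have "(\<phi> g x, \<phi> g y) \<in> E" if "(x, y) \<in> E" for g x y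
    using invariant[OF that, of "vec g"] that E by (auto simp: \<phi>)
  ultimately show ?thesis
    unfolding periodic_def
    using action vertex_orbits edge_orbits unfolding G_def
    by (intro exI[of _ "CARD('n)"] exI[of _ \<phi>]) auto
qed

text \<open>
  Induction on the \<open>l\<^sup>1\<close> norm: a nonzero vector gets shorter by a step along one of its nonzero
  coordinates.
\<close>

lemma integer_vector_induct:
  fixes x :: "int ^ 'n"
  assumes "P 0" and up: "\<And>x i. P x \<Longrightarrow> P (x + axis i 1)" and down: "\<And>x i. P x \<Longrightarrow> P (x - axis i 1)"
  shows "P x"
proof (induction "nat (\<Sum>i\<in>UNIV. \<bar>x $ i\<bar>)" arbitrary: x rule: less_induct)
  case less
  have decrease: "P y" if y: "\<bar>y $ i\<bar> < \<bar>x $ i\<bar>" "\<And>j. j \<noteq> i \<Longrightarrow> y $ j = x $ j" for y i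
  proof (rule less)
    have "(\<Sum>j\<in>UNIV. \<bar>y $ j\<bar>) < (\<Sum>j\<in>UNIV. \<bar>x $ j\<bar>)"
    proof (rule sum_strict_mono_ex1)
      show "\<forall>j\<in>UNIV. \<bar>y $ j\<bar> \<le> \<bar>x $ j\<bar>" using y by (metis less_imp_le order_refl)
    qed (use y in auto)
    moreover have "0 \<le> (\<Sum>j\<in>UNIV. \<bar>y $ j\<bar>)" by (simp add: sum_nonneg)
    ultimately show "nat (\<Sum>j\<in>UNIV. \<bar>y $ j\<bar>) < nat (\<Sum>j\<in>UNIV. \<bar>x $ j\<bar>)" by linarith
  qed
  show ?case
  proof (cases "x = 0")
    case True
    then show ?thesis using assms(1) by simp
  next
    case False
    then obtain i where i: "x $ i \<noteq> 0" by (auto simp: vec_eq_iff)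
    show ?thesis
    proof (cases "0 < x $ i")
      case True
      have "P (x - axis i 1)" by (rule decrease[of _ i]) (use True in \<open>auto simp: axis_def\<close>)
      then show ?thesis using up[of "x - axis i 1" i] by simp
    next
      case False
      have "P (x + axis i 1)" by (rule decrease[of _ i]) (use False i in \<open>auto simp: axis_def\<close>)
      then show ?thesis using down[of "x + axis i 1" i] by simp
    qed
  qed
qed


lemma connected_from_root:
  assumes "simple_graph V E" and "r \<in> V" and "\<And>x. x \<in> V \<Longrightarrow> (r, x) \<in> E\<^sup>*"
  shows "connected_graph V E"
proof -
  have "sym (E\<^sup>*)" using assms(1) by (simp add: simple_graph_def sym_rtrancl)
  then have "(x, y) \<in> E\<^sup>*" if "x \<in> V" "y \<in> V" for x y
    using assms(3)[OF that(1)] assms(3)[OF that(2)] by (meson rtrancl_trans symD)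
  then show ?thesis using assms(2) by (auto simp: connected_graph_def)
qed

lemma regular_locally_finite:
  assumes "regular_graph V E d" and "0 < d"
  shows "locally_finite V E"
  using assms by (auto simp: regular_graph_def locally_finite_def intro: card_ge_0_finite)


section \<open>The integer lattices\<close>

lemma unit_integer_vectors:
  "{z :: int ^ 'n. (\<Sum>i\<in>UNIV. \<bar>z $ i\<bar>) = 1} = (\<lambda>(i, s). axis i s) ` (UNIV \<times> {1, - 1})"
proof (intro Set.set_eqI iffI)
  fix z :: "int ^ 'n" assume "z \<in> {z. (\<Sum>i\<in>UNIV. \<bar>z $ i\<bar>) = 1}"
  then have one: "(\<Sum>i\<in>UNIV. \<bar>z $ i\<bar>) = 1" by simp
  then have "\<exists>i. z $ i \<noteq> 0" by (metis (mono_tags, lifting) abs_zero sum.neutral zero_neq_one)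
  then obtain i where i: "z $ i \<noteq> 0" by blast
  have split: "(\<Sum>j\<in>UNIV. \<bar>z $ j\<bar>) = \<bar>z $ i\<bar> + (\<Sum>j\<in>UNIV - {i}. \<bar>z $ j\<bar>)"
    by (rule sum.remove) auto
  moreover have nonneg: "0 \<le> (\<Sum>j\<in>UNIV - {i}. \<bar>z $ j\<bar>)" by (simp add: sum_nonneg)
  ultimately have "\<bar>z $ i\<bar> = 1" "(\<Sum>j\<in>UNIV - {i}. \<bar>z $ j\<bar>) = 0" using one i by linarith+
  then have "z $ j = 0" if "j \<noteq> i" for j using that by (simp add: sum_nonneg_eq_0_iff)
  then have "z = axis i (z $ i)" by (auto simp: vec_eq_iff axis_def)
  moreover have "z $ i \<in> {1, - 1}" using \<open>\<bar>z $ i\<bar> = 1\<close> by auto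
  ultimately show "z \<in> (\<lambda>(i, s). axis i s) ` (UNIV \<times> {1, - 1})" by force
next
  fix z :: "int ^ 'n" assume "z \<in> (\<lambda>(i, s). axis i s) ` (UNIV \<times> {1, - 1})"
  then obtain i s where z: "z = axis i s" "\<bar>s\<bar> = 1" by auto
  have "(\<Sum>j\<in>UNIV. \<bar>z $ j\<bar>) = (\<Sum>j\<in>UNIV. if j = i then 1 else 0)"
    by (rule sum.cong) (auto simp: z axis_def)
  then show "z \<in> {z. (\<Sum>i\<in>UNIV. \<bar>z $ i\<bar>) = 1}" by simp
qed

lemma integer_lattice_neighbours:
  fixes x :: "int ^ 'n"
  shows "integer_lattice_edges `` {x} = (\<lambda>(i, s). x + axis i s) ` ((UNIV :: 'n set) \<times> {1, - 1})"
proof -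
  have "integer_lattice_edges `` {x} = (\<lambda>z. x + z) ` {z :: int ^ 'n. (\<Sum>i\<in>UNIV. \<bar>z $ i\<bar>) = 1}"
  proof (intro Set.set_eqI iffI)
    fix y assume "y \<in> integer_lattice_edges `` {x}"
    then have "(\<Sum>i\<in>UNIV. \<bar>x $ i - y $ i\<bar>) = 1" by (simp add: integer_lattice_edges_def)
    then have "y - x \<in> {z. (\<Sum>i\<in>UNIV. \<bar>z $ i\<bar>) = 1}" by (simp add: abs_minus_commute)
    then show "y \<in> (\<lambda>z. x + z) ` {z. (\<Sum>i\<in>UNIV. \<bar>z $ i\<bar>) = 1}"
      by (intro image_eqI[of _ _ "y - x"]) simp_all
  qed (auto simp: integer_lattice_edges_def)
  then show ?thesis unfolding unit_integer_vectors by (simp add: image_image case_prod_unfold)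
qed

text \<open>
  The classes of the bipartition are the vectors with even and with odd coordinate sum; a step along
  an axis changes this parity.
\<close>

lemma integer_lattice:
  shows integer_lattice_periodic:
      "periodic_lattice (UNIV :: (int ^ 'n) set) integer_lattice_edges (2 * CARD('n))"
    and integer_lattice_bipartite: "bipartite (UNIV :: (int ^ 'n) set) integer_lattice_edges"
proof -
  let ?E = "integer_lattice_edges :: ((int ^ 'n) \<times> (int ^ 'n)) set"
  have step: "(x, x + axis i s) \<in> ?E" if "s = 1 \<or> s = - 1" for x i s
    using integer_lattice_neighbours[of x] that by force
  have simple: "simple_graph UNIV ?E"
    by (auto simp: simple_graph_def integer_lattice_edges_def sym_def irrefl_def abs_minus_commute)
  have regular: "regular_graph UNIV ?E (2 * CARD('n))"
  proof -
    have "inj_on (\<lambda>(i, s). x + axis i s) ((UNIV :: 'n set) \<times> {1, - 1 :: int})" for x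
      by (auto simp: inj_on_def axis_eq_axis)
    then have "card (?E `` {x}) = card ((UNIV :: 'n set) \<times> {1, - 1 :: int})" for x
      unfolding integer_lattice_neighbours by (rule card_image)
    then show ?thesis by (simp add: regular_graph_def)
  qed
  then have finite: "locally_finite UNIV ?E" by (rule regular_locally_finite) simp
  have "(0, x) \<in> ?E\<^sup>*" for x
  proof (induction x rule: integer_vector_induct)
    case (2 x i)
    then show ?case using step[of 1 x i] by (simp add: rtrancl.rtrancl_into_rtrancl)
  next
    case (3 x i)
    have "x + axis i (- 1) = x - axis i 1" by (simp add: vec_eq_iff axis_def)
    then show ?case using step[of "- 1" x i] 3 by (simp add: rtrancl.rtrancl_into_rtrancl)
  qed simp
  then have connected: "connected_graph UNIV ?E" by (intro connected_from_root[OF simple, of 0]) auto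
  have "periodic UNIV ?E"
    by (rule translations_periodic[where \<tau> = "\<lambda>a x. a + x" and F = "{0}"])
       (use finite in \<open>auto simp: integer_lattice_edges_def add.assoc\<close>)
  then show "periodic_lattice UNIV ?E (2 * CARD('n))"
    using simple connected finite regular by (simp add: periodic_lattice_def)
  have parity: "even (\<Sum>i\<in>UNIV. x $ i) \<longleftrightarrow> odd (\<Sum>i\<in>UNIV. y $ i)" if "(x, y) \<in> ?E" for x y
  proof -
    have "y \<in> ?E `` {x}" using that by simp
    then obtain i s where y: "y = x + axis i s" "s = 1 \<or> s = - 1"
      unfolding integer_lattice_neighbours by auto
    have "(\<Sum>j\<in>UNIV. y $ j) = (\<Sum>j\<in>UNIV. x $ j) + (\<Sum>j\<in>UNIV. if j = i then s else 0)"
      unfolding sum.distrib[symmetric] by (rule sum.cong) (auto simp: y axis_def)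
    then show ?thesis using y(2) by auto
  qed
  show "bipartite UNIV ?E"
    unfolding bipartite_def
    by (intro exI[of _ "{x. even (\<Sum>i\<in>UNIV. x $ i)}"] exI[of _ "{x. odd (\<Sum>i\<in>UNIV. x $ i)}"])
       (use parity in auto)
qed


section \<open>The diamond lattice\<close>

lemma diamond_neighbours:
  "diamond_edges `` {DiamondA x} = insert (DiamondB x) (range (\<lambda>j. DiamondB (x - axis j 1)))"
  "diamond_edges `` {DiamondB x} = insert (DiamondA x) (range (\<lambda>j. DiamondA (x + axis j 1)))"
proof -
  show "diamond_edges `` {DiamondA x} = insert (DiamondB x) (range (\<lambda>j. DiamondB (x - axis j 1)))"
    by (auto simp: diamond_edges_def Let_def)
  have "DiamondA (x + axis j 1) \<in> diamond_edges `` {DiamondB x}" for j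
    by (simp add: diamond_edges_def Let_def) (metis add_diff_cancel_right')
  then show "diamond_edges `` {DiamondB x} = insert (DiamondA x) (range (\<lambda>j. DiamondA (x + axis j 1)))"
    by (auto simp: diamond_edges_def Let_def)
qed

fun diamond_translation :: "int ^ 3 \<Rightarrow> diamond_vertex \<Rightarrow> diamond_vertex" where
  "diamond_translation a (DiamondA x) = DiamondA (a + x)"
| "diamond_translation a (DiamondB x) = DiamondB (a + x)"

text \<open>
  The walk \<open>A x\<close>, \<open>B x\<close>, \<open>A (x + e\<^sub>j)\<close> and its reverse reach every vertex of type \<open>A\<close>, whence
  every vertex.
\<close>

lemma diamond_lattice:
  shows diamond_periodic: "periodic_lattice UNIV diamond_edges 4"
    and diamond_bipartite: "bipartite UNIV diamond_edges"
proof -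
  have flip: "(y, x) \<in> diamond_edges" if "(x, y) \<in> diamond_edges" for x y
    using that by (auto simp: diamond_edges_def Let_def)
  have cases: "(\<exists>a b. x = DiamondA a \<and> y = DiamondB b) \<or> (\<exists>a b. x = DiamondB a \<and> y = DiamondA b)"
    if "(x, y) \<in> diamond_edges" for x y
    using that by (auto simp: diamond_edges_def Let_def)
  have classes: "range DiamondA \<union> range DiamondB = UNIV"
  proof -
    have "v \<in> range DiamondA \<union> range DiamondB" for v by (cases v) simp_all
    then show ?thesis by auto
  qed
  have "countable (range DiamondA \<union> range DiamondB)"
    by (intro countable_Un countable_image countableI_type)
  then have "countable (UNIV :: diamond_vertex set)" unfolding classes .
  moreover have "(v, v) \<notin> diamond_edges" for v using cases[of v v] by auto
  ultimately have simple: "simple_graph UNIV diamond_edges"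
    unfolding simple_graph_def by (intro conjI symI irreflI) (auto dest: flip)
  have axis_inj: "inj (\<lambda>j :: 3. axis j (1 :: int))" by (rule injI) (simp add: axis_eq_axis)
  have axis_nz: "axis j (1 :: int) \<noteq> 0" for j :: 3 by (simp add: axis_eq_0_iff)
  have regular: "regular_graph UNIV diamond_edges 4"
  proof -
    have "card (diamond_edges `` {v}) = 4" for v
    proof (cases v)
      case (DiamondA x)
      have "inj (\<lambda>j. DiamondB (x - axis j 1))" using axis_inj by (auto simp: inj_def)
      moreover have "DiamondB x \<notin> range (\<lambda>j. DiamondB (x - axis j 1))" using axis_nz by auto
      ultimately show ?thesis by (simp add: DiamondA diamond_neighbours card_image)
    next
      case (DiamondB x)
      have "inj (\<lambda>j. DiamondA (x + axis j 1))" using axis_inj by (auto simp: inj_def)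
      moreover have "DiamondA x \<notin> range (\<lambda>j. DiamondA (x + axis j 1))" using axis_nz by auto
      ultimately show ?thesis by (simp add: DiamondB diamond_neighbours card_image)
    qed
    then show ?thesis by (simp add: regular_graph_def)
  qed
  then have finite: "locally_finite UNIV diamond_edges" by (rule regular_locally_finite) simp
  have AB: "(DiamondA x, DiamondB x) \<in> diamond_edges" "(DiamondB x, DiamondA (x + axis j 1)) \<in> diamond_edges"
    "(DiamondA x, DiamondB (x - axis j 1)) \<in> diamond_edges" for x j
    by (simp_all add: Image_singleton_iff[symmetric] diamond_neighbours del: Image_singleton_iff)
  have A: "(DiamondA 0, DiamondA x) \<in> diamond_edges\<^sup>*" for x
  proof (induction x rule: integer_vector_induct)
    case (2 x i)
    show ?case by (rule rtrancl_into_rtrancl[OF rtrancl_into_rtrancl[OF 2 AB(1)] AB(2)])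
  next
    case (3 x i)
    show ?case by (rule rtrancl_into_rtrancl[OF rtrancl_into_rtrancl[OF 3 AB(3)] flip[OF AB(1)]])
  qed simp
  have "(DiamondA 0, v) \<in> diamond_edges\<^sup>*" for v
    by (cases v) (simp_all add: A rtrancl_into_rtrancl[OF A AB(1)])
  then have connected: "connected_graph UNIV diamond_edges"
    by (intro connected_from_root[OF simple, of "DiamondA 0"]) auto
  have "periodic UNIV diamond_edges"
  proof (rule translations_periodic[where \<tau> = diamond_translation and F = "{DiamondA 0, DiamondB 0}"])
    fix a b x y
    show "diamond_translation 0 x = x" by (cases x) simp_all
    show "diamond_translation (a + b) x = diamond_translation a (diamond_translation b x)"
      by (cases x) (simp_all add: add.assoc)
    show "diamond_translation a x = x \<Longrightarrow> a = 0" by (cases x) simp_all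
    show "\<exists>a. \<exists>y\<in>{DiamondA 0, DiamondB 0}. x = diamond_translation a y"
      by (cases x) (auto intro: exI)
    show "(diamond_translation a x, diamond_translation a y) \<in> diamond_edges"
      if xy: "(x, y) \<in> diamond_edges"
    proof (cases x)
      case (DiamondA v)
      then have "y \<in> diamond_edges `` {DiamondA v}" using xy by simp
      then have "diamond_translation a y \<in> diamond_edges `` {DiamondA (a + v)}"
        unfolding diamond_neighbours by (auto simp: add_diff_eq)
      then show ?thesis by (simp add: DiamondA)
    next
      case (DiamondB v)
      then have "y \<in> diamond_edges `` {DiamondB v}" using xy by simp
      then have "diamond_translation a y \<in> diamond_edges `` {DiamondB (a + v)}"
        unfolding diamond_neighbours by (auto simp: add.assoc)
      then show ?thesis by (simp add: DiamondB)
    qed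
  qed (use finite in auto)
  then show "periodic_lattice UNIV diamond_edges 4"
    using simple connected finite regular by (simp add: periodic_lattice_def)
  show "bipartite UNIV diamond_edges"
    unfolding bipartite_def
  proof (intro exI conjI)
    show "range DiamondA \<union> range DiamondB = UNIV" by (rule classes)
    show "range DiamondA \<inter> range DiamondB = {}" by auto
    show "diamond_edges \<subseteq> range DiamondA \<times> range DiamondB \<union> range DiamondB \<times> range DiamondA"
    proof
      fix p assume "p \<in> diamond_edges"
      then show "p \<in> range DiamondA \<times> range DiamondB \<union> range DiamondB \<times> range DiamondA"
        using cases[of "fst p" "snd p"] by (cases p) auto
    qed
  qed
qed


section \<open>The body-centred cubic lattice\<close>

lemma bcc_vertices_iff: "x \<in> bcc_vertices \<longleftrightarrow> (\<forall>i. x $ i \<in> \<int>) \<or> (\<forall>i. x $ i - 1 / 2 \<in> \<int>)"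
proof -
  have "x \<in> (\<lambda>x. x + (\<chi> i. 1 / 2)) ` integer_points \<longleftrightarrow> (\<forall>i. x $ i - 1 / 2 \<in> \<int>)"
  proof
    assume "\<forall>i. x $ i - 1 / 2 \<in> \<int>"
    then have "x - (\<chi> i. 1 / 2) \<in> integer_points" by (simp add: integer_points_def)
    then show "x \<in> (\<lambda>x. x + (\<chi> i. 1 / 2)) ` integer_points"
      by (rule image_eqI[rotated]) simp
  qed (auto simp: integer_points_def)
  then show ?thesis by (auto simp: bcc_vertices_def integer_points_def)
qed

definition half_vectors :: "(real ^ 3) set" where
  "half_vectors = {v. \<forall>i. v $ i = 1 / 2 \<or> v $ i = - 1 / 2}"

lemma card_half_vectors: "card half_vectors = 8"
proof -
  have eq: "half_vectors = vec_lambda ` (\<Pi>\<^sub>E i\<in>UNIV. {1 / 2, - 1 / 2})"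
  proof (intro Set.set_eqI iffI)
    fix v assume "v \<in> half_vectors"
    then have "vec_nth v \<in> (\<Pi>\<^sub>E i\<in>UNIV. {1 / 2, - 1 / 2})" by (simp add: half_vectors_def PiE_iff)
    then show "v \<in> vec_lambda ` (\<Pi>\<^sub>E i\<in>UNIV. {1 / 2, - 1 / 2})"
      by (rule image_eqI[rotated]) (simp add: vec_nth_inverse)
  qed (auto simp: half_vectors_def PiE_iff)
  have inj: "inj_on vec_lambda (\<Pi>\<^sub>E i\<in>(UNIV :: 3 set). {1 / 2, - 1 / 2 :: real})"
    by (rule inj_onI) (simp add: vec_lambda_inject)
  have "card half_vectors = card (\<Pi>\<^sub>E i\<in>(UNIV :: 3 set). {1 / 2, - 1 / 2 :: real})"
    unfolding eq by (rule card_image[OF inj])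
  also have "\<dots> = 8" by (simp add: card_PiE power3_eq_cube)
  finally show ?thesis .
qed

lemma half_odd_square:
  fixes t :: real
  assumes "t - 1 / 2 \<in> \<int>"
  shows "1 / 4 \<le> t\<^sup>2"
proof -
  obtain k where k: "t - 1 / 2 = of_int k" using assms by (elim Ints_cases)
  have "0 \<le> k * (k + 1)" by (cases "0 \<le> k") (auto simp: mult_nonneg_nonneg mult_nonpos_nonpos)
  then have "0 \<le> real_of_int (k * (k + 1))" by (simp only: of_int_0_le_iff)
  moreover have "t\<^sup>2 = real_of_int (k * (k + 1)) + 1 / 4"
  proof -
    have t: "t = of_int k + 1 / 2" using k by simp
    show ?thesis unfolding t by (simp add: power2_eq_square algebra_simps)
  qed
  ultimately show ?thesis by linarith
qed

text \<open>
  Two vertices of the same class differ by an integer vector, whose squared length is not \<open>3 / 4\<close>;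
  otherwise the three coordinates of the difference are half-odd, with squares at least \<open>1 / 4\<close>.
\<close>

lemma bcc_edge_iff:
  "(x, y) \<in> bcc_edges \<longleftrightarrow> x \<in> bcc_vertices \<and> y - x \<in> half_vectors"
proof -
  define S where "S = (\<Sum>i\<in>UNIV. (y $ i - x $ i)\<^sup>2)"
  have "dist x y = sqrt S"
    by (simp add: S_def dist_vec_def L2_set_def dist_real_def power2_commute)
  moreover have "sqrt 3 / 2 = sqrt (3 / 4)" by (simp add: real_sqrt_divide)
  ultimately have dist: "dist x y = sqrt 3 / 2 \<longleftrightarrow> S = 3 / 4" by (simp only: real_sqrt_eq_iff)
  have edge: "(x, y) \<in> bcc_edges \<longleftrightarrow> x \<in> bcc_vertices \<and> y \<in> bcc_vertices \<and> S = 3 / 4"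
    by (simp only: bcc_edges_def mem_Collect_eq case_prod_conv dist)
  have half: "w\<^sup>2 = 1 / 4 \<longleftrightarrow> w = 1 / 2 \<or> w = - 1 / 2" for w :: real
    using power2_eq_iff[of w "1 / 2"] by (simp add: power2_eq_square)
  have S3: "S = (y $ 1 - x $ 1)\<^sup>2 + (y $ 2 - x $ 2)\<^sup>2 + (y $ 3 - x $ 3)\<^sup>2" by (simp add: S_def sum_3)
  show ?thesis
  proof
    assume "(x, y) \<in> bcc_edges"
    then have V: "x \<in> bcc_vertices" "y \<in> bcc_vertices" and "S = 3 / 4"
      by (simp_all only: edge)
    have "\<not> (\<forall>i. y $ i - x $ i \<in> \<int>)"
    proof
      assume "\<forall>i. y $ i - x $ i \<in> \<int>"
      then have "S \<in> \<int>" unfolding S3 by (intro Ints_add Ints_power) auto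
      then obtain k where "3 / 4 = real_of_int k" using \<open>S = 3 / 4\<close> by (auto elim: Ints_cases)
      then have "real_of_int 3 = real_of_int (4 * k)" by simp
      then have "3 = 4 * k" by (simp only: of_int_eq_iff)
      then show False by presburger
    qed
    moreover have "(\<forall>i. y $ i - x $ i \<in> \<int>) \<or> (\<forall>i. y $ i - x $ i - 1 / 2 \<in> \<int>)"
    proof -
      have 1: "y $ i - x $ i \<in> \<int>" if "x $ i \<in> \<int>" "y $ i \<in> \<int>" for i using that by simp
      have 2: "y $ i - x $ i \<in> \<int>" if "x $ i - 1 / 2 \<in> \<int>" "y $ i - 1 / 2 \<in> \<int>" for i
        using Ints_diff[OF that(2,1)] by simp
      have 3: "y $ i - x $ i - 1 / 2 \<in> \<int>" if "x $ i \<in> \<int>" "y $ i - 1 / 2 \<in> \<int>" for i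
        using Ints_diff[OF that(2,1)] by (simp add: algebra_simps)
      have 4: "y $ i - x $ i - 1 / 2 \<in> \<int>" if "x $ i - 1 / 2 \<in> \<int>" "y $ i \<in> \<int>" for i
      proof -
        have "y $ i - x $ i - 1 / 2 = y $ i - (x $ i - 1 / 2) - 1" by simp
        then show ?thesis using Ints_diff[OF Ints_diff[OF that(2,1)] Ints_1] by simp
      qed
      show ?thesis using V 1 2 3 4 unfolding bcc_vertices_iff by blast
    qed
    ultimately have "1 / 4 \<le> (y $ i - x $ i)\<^sup>2" for i by (blast intro: half_odd_square)
    from this[of 1] this[of 2] this[of 3]
    have "(y $ 1 - x $ 1)\<^sup>2 = 1 / 4 \<and> (y $ 2 - x $ 2)\<^sup>2 = 1 / 4 \<and> (y $ 3 - x $ 3)\<^sup>2 = 1 / 4"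
      using S3 \<open>S = 3 / 4\<close> by linarith
    then have "y - x \<in> half_vectors" 
      by (simp only: half_vectors_def mem_Collect_eq forall_3 vector_minus_component half)
    then show "x \<in> bcc_vertices \<and> y - x \<in> half_vectors" using V by simp
  next
    assume xy: "x \<in> bcc_vertices \<and> y - x \<in> half_vectors"
    then have h: "y $ i = x $ i + 1 / 2 \<or> y $ i = x $ i - 1 / 2" for i
    proof -
      have "y $ i - x $ i = 1 / 2 \<or> y $ i - x $ i = - 1 / 2"
        using xy by (simp only: half_vectors_def mem_Collect_eq vector_minus_component)
      then show ?thesis
      proof
        assume "y $ i - x $ i = 1 / 2"
        then show ?thesis by (intro disjI1) linarith
      next
        assume "y $ i - x $ i = - 1 / 2"
        then show ?thesis by (intro disjI2) linarith
      qed
    qed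
    have "(y $ i - x $ i)\<^sup>2 = 1 / 4" for i using h[of i] half[of "y $ i - x $ i"] by auto
    then have "S = 3 / 4" by (simp add: S3)
    moreover have "y \<in> bcc_vertices"
    proof -
      have 1: "y $ i - 1 / 2 \<in> \<int>" if "x $ i \<in> \<int>" for i
      proof -
        have "y $ i - 1 / 2 = x $ i \<or> y $ i - 1 / 2 = x $ i - 1" using h[of i] by auto
        then show ?thesis using that by (elim disjE) simp_all
      qed
      have 2: "y $ i \<in> \<int>" if "x $ i - 1 / 2 \<in> \<int>" for i
      proof -
        have "y $ i = (x $ i - 1 / 2) + 1 \<or> y $ i = x $ i - 1 / 2" using h[of i] by auto
        then show ?thesis using that Ints_add[OF that Ints_1] by (elim disjE) simp_all
      qed
      show ?thesis using xy 1 2 unfolding bcc_vertices_iff by blast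
    qed
    ultimately show "(x, y) \<in> bcc_edges" using xy by (simp only: edge)
  qed
qed

text \<open>
  Two edges lead from an integer point \<open>x\<close> to \<open>x + e\<^sub>i\<close>, through the cell centre \<open>x + (1/2, 1/2, 1/2)\<close>;
  so all integer points, and with them all centres, are reached from the origin. The two classes are
  the integer points and the centres.
\<close>

lemma bcc_lattice:
  shows bcc_periodic: "periodic_lattice bcc_vertices bcc_edges 8"
    and bcc_bipartite: "bipartite bcc_vertices bcc_edges"
proof -
  define embed :: "int ^ 3 \<Rightarrow> real ^ 3" where "embed a = (\<chi> i. of_int (a $ i))" for a
  define half :: "real ^ 3" where "half = (\<chi> i. 1 / 2)"
  have embed_add: "embed (a + b) = embed a + embed b" for a b by (simp add: embed_def vec_eq_iff)
  have points: "integer_points = range embed"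
  proof
    show "integer_points \<subseteq> range embed"
    proof
      fix x assume "x \<in> integer_points"
      then have "x = embed (\<chi> i. \<lfloor>x $ i\<rfloor>)" by (simp add: integer_points_def embed_def vec_eq_iff)
      then show "x \<in> range embed" by blast
    qed
  qed (auto simp: integer_points_def embed_def)
  have V: "bcc_vertices = range embed \<union> range (\<lambda>a. embed a + half)"
    unfolding bcc_vertices_def points half_def image_image ..
  have subset: "bcc_edges \<subseteq> bcc_vertices \<times> bcc_vertices" by (auto simp: bcc_edges_def)
  have simple: "simple_graph bcc_vertices bcc_edges"
    unfolding simple_graph_def
  proof (intro conjI subset)
    show "countable bcc_vertices" unfolding V by (intro countable_Un countable_image countableI_type)
    show "sym bcc_edges" by (auto simp: sym_def bcc_edges_def dist_commute)
    show "irrefl bcc_edges" by (auto simp: irrefl_def bcc_edges_def)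
  qed
  have neighbours: "bcc_edges `` {x} = (\<lambda>v. x + v) ` half_vectors" if "x \<in> bcc_vertices" for x
  proof (intro Set.set_eqI iffI)
    fix y assume "y \<in> bcc_edges `` {x}"
    then have "y - x \<in> half_vectors" by (simp add: bcc_edge_iff)
    then show "y \<in> (\<lambda>v. x + v) ` half_vectors" by (rule image_eqI[rotated]) simp
  qed (use that in \<open>auto simp: bcc_edge_iff\<close>)
  have regular: "regular_graph bcc_vertices bcc_edges 8"
    unfolding regular_graph_def by (simp add: neighbours card_image card_half_vectors)
  then have finite: "locally_finite bcc_vertices bcc_edges" by (rule regular_locally_finite) simp
  have step: "(x, x + v) \<in> bcc_edges" if "x \<in> bcc_vertices" "v \<in> half_vectors" for x v
    using that by (simp add: bcc_edge_iff)
  have half_in: "half \<in> half_vectors" "- half \<in> half_vectors"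
    "embed (axis i 1) - half \<in> half_vectors" "half - embed (axis i 1) \<in> half_vectors" for i
    by (auto simp: half_vectors_def half_def embed_def axis_def)
  have integer: "(0, embed a) \<in> bcc_edges\<^sup>*" for a
  proof (induction a rule: integer_vector_induct)
    case 1
    have "embed 0 = 0" by (simp add: embed_def vec_eq_iff)
    then show ?case by simp
  next
    case (2 a i)
    have "(embed a, embed a + half) \<in> bcc_edges" by (rule step) (auto simp: V half_in)
    moreover have "(embed a + half, (embed a + half) + (embed (axis i 1) - half)) \<in> bcc_edges"
      by (rule step) (auto simp: V half_in)
    moreover have "(embed a + half) + (embed (axis i 1) - half) = embed (a + axis i 1)"
      by (simp add: embed_add)
    ultimately show ?case using 2 by (metis rtrancl.rtrancl_into_rtrancl)
  next
    case (3 a i)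
    have eq: "embed a - embed (axis i 1) = embed (a - axis i 1)" by (simp add: embed_def vec_eq_iff)
    have "(embed a, embed a + - half) \<in> bcc_edges" by (rule step) (auto simp: V half_in)
    moreover have "embed a + - half \<in> bcc_vertices" using calculation subset by blast
    then have "(embed a + - half, (embed a + - half) + (half - embed (axis i 1))) \<in> bcc_edges"
      by (rule step) (rule half_in)
    moreover have "(embed a + - half) + (half - embed (axis i 1)) = embed (a - axis i 1)"
      by (simp add: eq)
    ultimately show ?case using 3 by (metis rtrancl.rtrancl_into_rtrancl)
  qed
  have "(0, x) \<in> bcc_edges\<^sup>*" if "x \<in> bcc_vertices" for x
  proof -
    have "(embed a, embed a + half) \<in> bcc_edges" for a by (rule step) (auto simp: V half_in)
    then have "(0, embed a + half) \<in> bcc_edges\<^sup>*" for a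
      using integer[of a] by (rule rtrancl.rtrancl_into_rtrancl[rotated])
    then show ?thesis using that integer by (auto simp: V)
  qed
  moreover have "0 \<in> bcc_vertices" by (simp add: bcc_vertices_iff)
  ultimately have connected: "connected_graph bcc_vertices bcc_edges"
    by (intro connected_from_root[OF simple, of 0])
  have "periodic bcc_vertices bcc_edges"
  proof (rule translations_periodic[where \<tau> = "\<lambda>a x. embed a + x" and F = "{0, half}"])
    show closed: "embed a + x \<in> bcc_vertices" if "x \<in> bcc_vertices" for a x
    proof -
      have "embed a + embed b \<in> range embed" "embed a + (embed b + half) \<in> range (\<lambda>a. embed a + half)" for b
        by (auto simp: embed_add[symmetric] add.assoc[symmetric])
      then show ?thesis using that unfolding V by blast
    qed
    show "(embed a + x, embed a + y) \<in> bcc_edges" if "(x, y) \<in> bcc_edges" for a x y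
      using that closed by (simp add: bcc_edge_iff)
    show "\<exists>a. \<exists>y\<in>{0, half}. x = embed a + y" if "x \<in> bcc_vertices" for x
      using that by (auto simp: V)
    show "embed a + x = x \<Longrightarrow> a = 0" for a x by (simp add: embed_def vec_eq_iff)
    show "{0, half} \<subseteq> bcc_vertices" by (simp add: bcc_vertices_iff half_def)
  qed (use subset finite in \<open>simp_all add: embed_add add.assoc, simp add: embed_def vec_eq_iff\<close>)
  then show "periodic_lattice bcc_vertices bcc_edges 8"
    using simple connected finite regular by (simp add: periodic_lattice_def)
  show "bipartite bcc_vertices bcc_edges"
    unfolding bipartite_def
  proof (intro exI conjI)
    let ?X = "{x :: real ^ 3. x $ 1 \<in> \<int>} \<inter> bcc_vertices" and ?Y = "bcc_vertices - {x. x $ 1 \<in> \<int>}"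
    show "?X \<union> ?Y = bcc_vertices" "?X \<inter> ?Y = {}" by auto
    have "x $ 1 \<in> \<int> \<longleftrightarrow> y $ 1 \<notin> \<int>" if "(x, y) \<in> bcc_edges" for x y
    proof -
      have half_odd: "s - 1 / 2 \<notin> \<int>" if s: "s \<in> \<int>" for s :: real
      proof
        assume "s - 1 / 2 \<in> \<int>"
        from Ints_diff[OF s this] obtain k where "s - (s - 1 / 2) = real_of_int k"
          by (elim Ints_cases)
        then have "real_of_int 1 = real_of_int (2 * k)" by simp
        then have "1 = 2 * k" by (simp only: of_int_eq_iff)
        then show False by presburger
      qed
      have exclusive: "s - 1 / 2 \<in> \<int> \<longleftrightarrow> s \<notin> \<int>" if "z \<in> bcc_vertices" "s = z $ 1" for z s
        using that half_odd unfolding bcc_vertices_iff by blast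
      have xV: "x \<in> bcc_vertices" and yV: "y \<in> bcc_vertices" using that subset by auto
      have "y $ 1 - 1 / 2 = x $ 1 \<or> y $ 1 - 1 / 2 = x $ 1 - 1"
        using that by (auto simp: bcc_edge_iff half_vectors_def algebra_simps dest: spec[of _ 1])
      then have "y $ 1 - 1 / 2 \<in> \<int> \<longleftrightarrow> x $ 1 \<in> \<int>"
        using Ints_add[of "x $ 1 - 1" 1] Ints_diff[of "x $ 1" 1] by auto
      then show ?thesis using exclusive[OF yV refl] by simp
    qed
    then show "bcc_edges \<subseteq> ?X \<times> ?Y \<union> ?Y \<times> ?X" using subset by blast
  qed
qed

section \<open>The norm of the edge Laplacian of a regular graph\<close>

lemma connected_regular_graph:
  assumes "simple_graph V E" and "connected_graph V E" and "locally_finite V E"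
    and "regular_graph V E d" and "0 < d"
  shows "regular_nonempty_graph V E d"
  using assms by (auto simp: connected_graph_def intro!: regular_nonempty_graph.intro)

lemma finite_bipartite_conditions:
  assumes "simple_graph V E" and "V \<noteq> {}" and "finite V" and "regular_graph V E d" and "0 < d"
    and "bipartite V E"
  shows "all_conditions V E d"
proof -
  interpret regular_nonempty_graph V E d
    using assms by (intro regular_nonempty_graph.intro regular_locally_finite)
  show ?thesis using bipartite_amenable_conditions[OF assms(6) finite_amenable[OF assms(3)]] .
qed

lemma periodic_bipartite_conditions:
  assumes "periodic_lattice V E d" and "0 < d" and "bipartite V E"
  shows "all_conditions V E d"
proof -
  interpret regular_nonempty_graph V E d
    using assms by (intro connected_regular_graph) (simp_all add: periodic_lattice_def)
  have "periodic V E" using assms by (simp add: periodic_lattice_def)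
  then show ?thesis by (intro bipartite_amenable_conditions assms periodic_amenable)
qed

theorem proposition7p2:
  fixes V :: "'v set" and E :: "('v \<times> 'v) set" and d :: nat
  assumes "simple_graph V E" and "connected_graph V E" and "locally_finite V E"
    and "regular_graph V E d" and "d \<ge> 2"
  shows
    "bounded_operator (ell2 V) (ell2_norm V) (adjacency_op E) \<and>
     bounded_operator (ell2 V) (ell2_norm V) (vertex_laplacian E d) \<and>
     bounded_operator (ell2 V) (ell2_norm V) (signless_laplacian E d) \<and>
     bounded_operator (cochains E) (cochain_norm E) (edge_laplacian E) \<and>

     operator_norm (cochains E) (cochain_norm E) (edge_laplacian E)
       = operator_norm (ell2 V) (ell2_norm V) (vertex_laplacian E d) \<and>
     operator_norm (ell2 V) (ell2_norm V) (vertex_laplacian E d)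
       = real d - inf_spec (ell2 V) (ell2_norm V) (adjacency_op E) \<and>
     real d - inf_spec (ell2 V) (ell2_norm V) (adjacency_op E) \<le> 2 * real d \<and>

     (norm_condition E d \<longleftrightarrow> spectral_condition V E d) \<and>
     (spectral_condition V E d \<longleftrightarrow> signless_condition V E d) \<and>
     (signless_condition V E d \<longleftrightarrow> variational_condition V E) \<and>

     (norm_condition E d \<or> spectral_condition V E d \<or> signless_condition V E d \<longrightarrow>
        sup_spec (ell2 V) (ell2_norm V) (adjacency_op E) = real d) \<and>
     (sup_spec (ell2 V) (ell2_norm V) (adjacency_op E) = real d \<longrightarrow> amenable V E) \<and>

     (bipartite V E \<and> amenable V E \<longrightarrow> all_conditions V E d) \<and>
     (\<forall>(V' :: 'v set) E' d'. simple_graph V' E' \<and> V' \<noteq> {} \<and> finite V' \<and> regular_graph V' E' d' \<and>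
        d' \<ge> 2 \<and> bipartite V' E' \<longrightarrow> all_conditions V' E' d') \<and>
     (\<forall>(V' :: 'v set) E' d'. periodic_lattice V' E' d' \<and> d' \<ge> 2 \<and> bipartite V' E' \<longrightarrow>
        all_conditions V' E' d') \<and>

     (periodic_lattice (UNIV :: (int ^ 2) set) integer_lattice_edges 4 \<and>
      bipartite (UNIV :: (int ^ 2) set) integer_lattice_edges \<and>
      all_conditions (UNIV :: (int ^ 2) set) integer_lattice_edges 4) \<and>
     (periodic_lattice (UNIV :: (int ^ 3) set) integer_lattice_edges 6 \<and>
      bipartite (UNIV :: (int ^ 3) set) integer_lattice_edges \<and>
      all_conditions (UNIV :: (int ^ 3) set) integer_lattice_edges 6) \<and>
     (periodic_lattice (UNIV :: (int ^ 4) set) integer_lattice_edges 8 \<and>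
      bipartite (UNIV :: (int ^ 4) set) integer_lattice_edges \<and>
      all_conditions (UNIV :: (int ^ 4) set) integer_lattice_edges 8) \<and>
     (periodic_lattice bcc_vertices bcc_edges 8 \<and>
      bipartite bcc_vertices bcc_edges \<and>
      all_conditions bcc_vertices bcc_edges 8) \<and>
     (periodic_lattice (UNIV :: diamond_vertex set) diamond_edges 4 \<and>
      bipartite (UNIV :: diamond_vertex set) diamond_edges \<and>
      all_conditions (UNIV :: diamond_vertex set) diamond_edges 4) \<and>

     (finite V \<longrightarrow>
        (norm_condition E d \<longleftrightarrow> bipartite V E) \<and>
        (spectral_condition V E d \<longleftrightarrow> bipartite V E) \<and>
        (signless_condition V E d \<longleftrightarrow> bipartite V E))"
proof -
  interpret regular_nonempty_graph V E d
    using assms by (intro connected_regular_graph) auto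
  have Z2: "periodic_lattice (UNIV :: (int ^ 2) set) integer_lattice_edges 4"
    using integer_lattice_periodic[where 'n = 2] by simp
  have Z3: "periodic_lattice (UNIV :: (int ^ 3) set) integer_lattice_edges 6"
    using integer_lattice_periodic[where 'n = 3] by simp
  have Z4: "periodic_lattice (UNIV :: (int ^ 4) set) integer_lattice_edges 8"
    using integer_lattice_periodic[where 'n = 4] by simp
  have examples:
    "all_conditions (UNIV :: (int ^ 2) set) integer_lattice_edges 4"
    "all_conditions (UNIV :: (int ^ 3) set) integer_lattice_edges 6"
    "all_conditions (UNIV :: (int ^ 4) set) integer_lattice_edges 8"
    "all_conditions bcc_vertices bcc_edges 8"
    "all_conditions UNIV diamond_edges 4"
    using Z2 Z3 Z4 bcc_periodic diamond_periodic
    by (simp_all add: periodic_bipartite_conditions integer_lattice_bipartite bcc_bipartite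
        diamond_bipartite)
  have finite_iff: "adjacency_inf = - real d \<longleftrightarrow> bipartite V E" if "finite V"
    using finite_extremal_bipartite[OF that assms(2)] finite_amenable[OF that]
      bipartite_amenable_conditions all_conditions_iff by blast
  have bounded:
    "ell2_operator V (adjacency_op E)"
    "ell2_operator V (vertex_laplacian E d)"
    "ell2_operator V (signless_laplacian E d)"
    using adjacency_self_adjoint vertex_laplacian_self_adjoint signless_laplacian_self_adjoint
    by (simp_all only: self_adjoint_def)
  show ?thesis
  proof (intro conjI)
    show "real d - adjacency_inf \<le> 2 * real d" using adjacency_inf_ge by simp
    show "norm_condition E d \<or> spectral_condition V E d \<or> signless_condition V E d \<longrightarrow>
        adjacency_sup = real d"
      using adjacency_sup_eq_degree by (simp add: conditions_iff)
    show "adjacency_sup = real d \<longrightarrow> amenable V E" using amenable_if_sup_eq_degree by simp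
    show "bipartite V E \<and> amenable V E \<longrightarrow> all_conditions V E d"
      using bipartite_amenable_conditions by simp
    show "\<forall>(V' :: 'v set) E' d'. simple_graph V' E' \<and> V' \<noteq> {} \<and> finite V' \<and> regular_graph V' E' d' \<and>
        d' \<ge> 2 \<and> bipartite V' E' \<longrightarrow> all_conditions V' E' d'"
      by (intro allI impI finite_bipartite_conditions) auto
    show "\<forall>(V' :: 'v set) E' d'. periodic_lattice V' E' d' \<and> d' \<ge> 2 \<and> bipartite V' E' \<longrightarrow>
        all_conditions V' E' d'"
      by (intro allI impI periodic_bipartite_conditions) auto
    show "finite V \<longrightarrow>
        (norm_condition E d \<longleftrightarrow> bipartite V E) \<and>
        (spectral_condition V E d \<longleftrightarrow> bipartite V E) \<and>
        (signless_condition V E d \<longleftrightarrow> bipartite V E)"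
      using finite_iff by (simp add: conditions_iff)
  qed (simp_all only: bounded edge_laplacian_bounded edge_laplacian_norm vertex_laplacian_norm
      conditions_iff Z2 Z3 Z4 bcc_periodic diamond_periodic integer_lattice_bipartite bcc_bipartite
      diamond_bipartite examples)
qed

end
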